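(* Let $G\leq\operatorname{Aut}(T)$ be a branch group. (1) If $G$ is not torsion-free, then it contains a continuum of generalized parabolic subgroups that are not parabolic. (2) If $G$ has elements of arbitrarily high finite order, then there are infinitely many tree-equivalence classes of generalized parabolic subgroups of $G$ that each contain a continuum of subgroups. (3) If $G$ is torsion, then there is a continuum of tree-equivalence classes of generalized parabolic subgroups of $G$ that each contain infinitely many subgroups.
   Context: $T$ is a rooted tree; all rooted trees are infinite and spherically regular (the number of children of a vertex depends only on its level), and every vertex has at least two children. $\operatorname{Aut}(T)$ is the group of graph automorphisms fixing the root; $\mathcal L_n$ is the set of vertices of level $n$; $T_v$ is the subtree of descendants of $v$. The boundary $\partial T$ is the set of infinite rays starting at the root, with the metric in which two distinct rays first differing at index $i$ are at distance $2^{-i}$. For $G\le\operatorname{Aut}(T)$, $\operatorname{Rist}_G(v)$ is the subgroup of elements acting trivially outside $T_v$, and $\operatorname{Rist}_G(\mathcal L_n)=\prod_{v\in\mathcal L_n}\operatorname{Rist}_G(v)$. $G$ is branch if it acts transitively on every $\mathcal L_n$ and $\operatorname{Rist}_G(\mathcal L_n)$ has finite index in $G$ for every $n$. $\operatorname{SStab}_G(C)$ is the setwise stabilizer of $C\subseteq \partial T$. A generalized parabolic subgroup of $G$ is a subgroup of the form $\operatorname{SStab}_G(C)$ where $C\subset\partial T$ is closed and not open and the action $\operatorname{SStab}_G(C)\curvearrowright C$ is minimal (every orbit is dense in $C$); for branch $G$ the set $C$ with these properties is determined by the subgroup. A parabolic subgroup of $G$ is the stabilizer $\operatorname{Stab}_G(\xi)$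 of a ray $\xi\in\partial T$. Two generalized parabolic subgroups $\operatorname{SStab}_G(C_1)$ and $\operatorname{SStab}_G(C_2)$ are tree-equivalent if there is $\varphi\in\operatorname{Aut}(T)$ with $\varphi(C_1)=C_2$. "A continuum" means $2^{\aleph_0}$ pairwise distinct objects. *)

theory Defs
  imports "HOL-Analysis.Analysis" "HOL-Algebra.Algebra" "HOL-Library.Equipollence"
begin

section \<open>Rooted trees\<close>

record 'v rooted_graph =
  verts :: "'v set"
  edges :: "('v \<times> 'v) set"
  root_vertex :: 'v

definition simple_path :: "'v rooted_graph \<Rightarrow> 'v \<Rightarrow> 'v \<Rightarrow> 'v list \<Rightarrow> bool" where
  "simple_path T u v p \<longleftrightarrow>
     p \<noteq> [] \<and> hd p = u \<and> last p = v \<and> set p \<subseteq> verts T \<and> distinct p \<and>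
     successively (\<lambda>x y. (x, y) \<in> edges T) p"

definition rooted_tree :: "'v rooted_graph \<Rightarrow> bool" where
  "rooted_tree T \<longleftrightarrow>
     edges T \<subseteq> verts T \<times> verts T \<and> sym (edges T) \<and> irrefl (edges T) \<and> root_vertex T \<in> verts T \<and>
     (\<forall>u\<in>verts T. \<forall>v\<in>verts T. \<exists>!p. simple_path T u v p)"

definition root_path :: "'v rooted_graph \<Rightarrow> 'v \<Rightarrow> 'v list" where
  "root_path T v = (THE p. simple_path T (root_vertex T) v p)"

definition level_of :: "'v rooted_graph \<Rightarrow> 'v \<Rightarrow> nat" where
  "level_of T v = length (root_path T v) - 1"

definition level :: "'v rooted_graph \<Rightarrow> nat \<Rightarrow> 'v set" where
  "level T n = {v \<in> verts T. level_of T v = n}"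

definition children :: "'v rooted_graph \<Rightarrow> 'v \<Rightarrow> 'v set" where
  "children T v = {w. (v, w) \<in> edges T \<and> level_of T w = Suc (level_of T v)}"

definition descendants :: "'v rooted_graph \<Rightarrow> 'v \<Rightarrow> 'v set" where
  "descendants T v = {u \<in> verts T. v \<in> set (root_path T u)}"

text \<open>
  Having two children at every vertex makes the tree infinite. Local finiteness is not imposed:
  numbers of children are compared as cardinals. It holds as soon as there is a branch group,
  whose rigid level stabilizers have finite index and fix the level pointwise.
\<close>

definition spherically_regular_tree :: "'v rooted_graph \<Rightarrow> bool" where
  "spherically_regular_tree T \<longleftrightarrow>
     rooted_tree T \<and>
     (\<forall>v\<in>verts T. \<exists>a\<in>children T v. \<exists>b\<in>children T v. a \<noteq> b) \<and>
     (\<forall>u\<in>verts T. \<forall>v\<in>verts T. level_of T u = level_of T v \<longrightarrow> children T u \<approx> children T v)"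


section \<open>Automorphisms and branch groups\<close>

definition aut_group :: "'v rooted_graph \<Rightarrow> ('v \<Rightarrow> 'v) monoid" where
  "aut_group T = (BijGroup (verts T))
     \<lparr>carrier := {\<phi> \<in> Bij (verts T). \<phi> (root_vertex T) = root_vertex T \<and>
        (\<forall>u\<in>verts T. \<forall>v\<in>verts T. (\<phi> u, \<phi> v) \<in> edges T \<longleftrightarrow> (u, v) \<in> edges T)}\<rparr>"

abbreviation subgroup_struct :: "'v rooted_graph \<Rightarrow> ('v \<Rightarrow> 'v) set \<Rightarrow> ('v \<Rightarrow> 'v) monoid" where
  "subgroup_struct T G \<equiv> (aut_group T)\<lparr>carrier := G\<rparr>"

definition rist :: "'v rooted_graph \<Rightarrow> ('v \<Rightarrow> 'v) set \<Rightarrow> 'v \<Rightarrow> ('v \<Rightarrow> 'v) set" where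
  "rist T G v = {g \<in> G. \<forall>u \<in> verts T - descendants T v. g u = u}"

text \<open>
  The rigid stabilizers of distinct vertices of one level commute and intersect trivially, so
  their internal product is the subgroup they generate.
\<close>

definition rist_level :: "'v rooted_graph \<Rightarrow> ('v \<Rightarrow> 'v) set \<Rightarrow> nat \<Rightarrow> ('v \<Rightarrow> 'v) set" where
  "rist_level T G n = generate (aut_group T) (\<Union>v \<in> level T n. rist T G v)"

definition branch_group :: "'v rooted_graph \<Rightarrow> ('v \<Rightarrow> 'v) set \<Rightarrow> bool" where
  "branch_group T G \<longleftrightarrow>
     subgroup G (aut_group T) \<and>
     (\<forall>n. \<forall>u\<in>level T n. \<forall>v\<in>level T n. \<exists>g\<in>G. g u = v) \<and>
     (\<forall>n. finite (rcosets\<^bsub>subgroup_struct T G\<^esub> (rist_level T G n)))"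

text \<open>In HOL-Algebra, elements of infinite order have \<open>group.ord\<close> equal to 0.\<close>

definition torsion_free :: "('a, 'b) monoid_scheme \<Rightarrow> bool" where
  "torsion_free K \<longleftrightarrow> (\<forall>g\<in>carrier K. g \<noteq> \<one>\<^bsub>K\<^esub> \<longrightarrow> group.ord K g = 0)"

definition torsion :: "('a, 'b) monoid_scheme \<Rightarrow> bool" where
  "torsion K \<longleftrightarrow> (\<forall>g\<in>carrier K. group.ord K g \<noteq> 0)"

definition unbounded_finite_orders :: "('a, 'b) monoid_scheme \<Rightarrow> bool" where
  "unbounded_finite_orders K \<longleftrightarrow>
     (\<forall>N. \<exists>g\<in>carrier K. group.ord K g \<noteq> 0 \<and> N \<le> group.ord K g)"


section \<open>The boundary\<close>

definition boundary :: "'v rooted_graph \<Rightarrow> (nat \<Rightarrow> 'v) set" where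
  "boundary T = {\<xi>. \<xi> 0 = root_vertex T \<and> inj \<xi> \<and> range \<xi> \<subseteq> verts T \<and>
                    (\<forall>i. (\<xi> i, \<xi> (Suc i)) \<in> edges T)}"

definition ray_dist :: "(nat \<Rightarrow> 'v) \<Rightarrow> (nat \<Rightarrow> 'v) \<Rightarrow> real" where
  "ray_dist \<xi> \<eta> = (if \<xi> = \<eta> then 0 else (1/2) ^ (LEAST i. \<xi> i \<noteq> \<eta> i))"

definition boundary_topology :: "'v rooted_graph \<Rightarrow> (nat \<Rightarrow> 'v) topology" where
  "boundary_topology T = Metric_space.mtopology (boundary T) ray_dist"

definition ray_image :: "('v \<Rightarrow> 'v) \<Rightarrow> (nat \<Rightarrow> 'v) \<Rightarrow> (nat \<Rightarrow> 'v)" where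
  "ray_image g \<xi> = g \<circ> \<xi>"

definition sstab :: "('v \<Rightarrow> 'v) set \<Rightarrow> (nat \<Rightarrow> 'v) set \<Rightarrow> ('v \<Rightarrow> 'v) set" where
  "sstab G C = {g \<in> G. ray_image g ` C = C}"

definition ray_stab :: "('v \<Rightarrow> 'v) set \<Rightarrow> (nat \<Rightarrow> 'v) \<Rightarrow> ('v \<Rightarrow> 'v) set" where
  "ray_stab G \<xi> = {g \<in> G. ray_image g \<xi> = \<xi>}"

definition minimal_action :: "'v rooted_graph \<Rightarrow> ('v \<Rightarrow> 'v) set \<Rightarrow> (nat \<Rightarrow> 'v) set \<Rightarrow> bool" where
  "minimal_action T H C \<longleftrightarrow>
     (\<forall>\<xi>\<in>C. subtopology (boundary_topology T) C closure_of ((\<lambda>h. ray_image h \<xi>) ` H) = C)"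


section \<open>Generalized parabolic subgroups\<close>

definition gen_parabolic_set ::
  "'v rooted_graph \<Rightarrow> ('v \<Rightarrow> 'v) set \<Rightarrow> (nat \<Rightarrow> 'v) set \<Rightarrow> bool" where
  "gen_parabolic_set T G C \<longleftrightarrow>
     closedin (boundary_topology T) C \<and> \<not> openin (boundary_topology T) C \<and>
     minimal_action T (sstab G C) C"

definition gen_parabolics :: "'v rooted_graph \<Rightarrow> ('v \<Rightarrow> 'v) set \<Rightarrow> ('v \<Rightarrow> 'v) set set" where
  "gen_parabolics T G = {sstab G C | C. gen_parabolic_set T G C}"

definition parabolics :: "'v rooted_graph \<Rightarrow> ('v \<Rightarrow> 'v) set \<Rightarrow> ('v \<Rightarrow> 'v) set set" where
  "parabolics T G = {ray_stab G \<xi> | \<xi>. \<xi> \<in> boundary T}"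

text \<open>
  For branch groups the set \<open>C\<close> is determined by the subgroup \<open>sstab G C\<close>, so that this is an
  equivalence relation on the generalized parabolic subgroups.
\<close>

definition tree_equiv ::
  "'v rooted_graph \<Rightarrow> ('v \<Rightarrow> 'v) set \<Rightarrow> (('v \<Rightarrow> 'v) set \<times> ('v \<Rightarrow> 'v) set) set" where
  "tree_equiv T G =
     {(sstab G C1, sstab G C2) | C1 C2.
        gen_parabolic_set T G C1 \<and> gen_parabolic_set T G C2 \<and>
        (\<exists>\<phi> \<in> carrier (aut_group T). ray_image \<phi> ` C1 = C2)}"

definition tree_classes :: "'v rooted_graph \<Rightarrow> ('v \<Rightarrow> 'v) set \<Rightarrow> ('v \<Rightarrow> 'v) set set set" where
  "tree_classes T G = gen_parabolics T G // tree_equiv T G"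

text \<open>
  Over a locally finite tree there are at most continuum many closed subsets of the boundary, so
  for the families considered here ``at least'' and ``exactly'' continuum many agree.
\<close>

definition continuum :: "'a set \<Rightarrow> bool" where
  "continuum S \<longleftrightarrow> S \<approx> (UNIV :: nat set set)"


section \<open>Well-definedness\<close>

lemma group_aut_group:
  assumes "root_vertex T \<in> verts T"
  shows "group (aut_group T)"
proof -
  let ?V = "verts T"
  interpret B: group "BijGroup ?V" by (rule group_BijGroup)
  let ?A = "{\<phi> \<in> Bij ?V. \<phi> (root_vertex T) = root_vertex T \<and>
        (\<forall>u\<in>?V. \<forall>v\<in>?V. (\<phi> u, \<phi> v) \<in> edges T \<longleftrightarrow> (u, v) \<in> edges T)}"
  have "subgroup ?A (BijGroup ?V)" if r: "root_vertex T \<in> ?V"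
  proof (rule B.subgroupI)
    show "?A \<subseteq> carrier (BijGroup ?V)" by (auto simp: BijGroup_def)
    have "(\<lambda>x\<in>?V. x) \<in> ?A" using r by (auto simp: id_Bij)
    then show "?A \<noteq> {}" by blast
  next
    fix f assume f: "f \<in> ?A"
    then have fB: "f \<in> Bij ?V" by simp
    then have bij: "bij_betw f ?V ?V" by (simp add: Bij_def)
    let ?g = "restrict (inv_into ?V f) ?V"
    have inv: "inv\<^bsub>BijGroup ?V\<^esub> f = ?g" using fB by (rule inv_BijGroup)
    have gB: "?g \<in> Bij ?V" using fB by (rule restrict_inv_into_Bij)
    have mem: "inv_into ?V f u \<in> ?V" "f (inv_into ?V f u) = u" if "u \<in> ?V" for u
      using bij_betw_inv_into_right[OF bij that] bij_betwE[OF bij_betw_inv_into[OF bij]] that by auto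
    have "inv_into ?V f (root_vertex T) = root_vertex T"
      using f r bij_betw_inv_into_left[OF bij r] by simp
    moreover have "(inv_into ?V f u, inv_into ?V f v) \<in> edges T \<longleftrightarrow> (u, v) \<in> edges T"
      if "u \<in> ?V" "v \<in> ?V" for u v
    proof -
      have "(f (inv_into ?V f u), f (inv_into ?V f v)) \<in> edges T \<longleftrightarrow>
            (inv_into ?V f u, inv_into ?V f v) \<in> edges T"
        using f mem that by blast
      then show ?thesis using mem that by simp
    qed
    ultimately show "inv\<^bsub>BijGroup ?V\<^esub> f \<in> ?A" using gB r inv by simp
  next
    fix f g assume f: "f \<in> ?A" and g: "g \<in> ?A"
    then have fg: "f \<in> Bij ?V" "g \<in> Bij ?V" by auto
    have mult: "f \<otimes>\<^bsub>BijGroup ?V\<^esub> g = compose ?V f g" using fg by (simp add: BijGroup_def)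
    have "g u \<in> ?V" if "u \<in> ?V" for u
      using fg(2) that by (auto simp: Bij_def bij_betw_def)
    then show "f \<otimes>\<^bsub>BijGroup ?V\<^esub> g \<in> ?A"
      using f g r compose_Bij[OF fg] unfolding mult by (simp add: compose_def)
  qed
  then show ?thesis unfolding aut_group_def using assms by (auto intro: B.subgroup_imp_group)
qed

lemma Metric_space_boundary: "Metric_space (boundary T) ray_dist"
proof
  fix x y z :: "nat \<Rightarrow> 'a"
  show "0 \<le> ray_dist x y" by (simp add: ray_dist_def)
  have "(\<lambda>i. x i \<noteq> y i) = (\<lambda>i. y i \<noteq> x i)" by (rule ext) metis
  then show "ray_dist x y = ray_dist y x" by (cases "x = y") (simp_all add: ray_dist_def)
  show "(ray_dist x y = 0) = (x = y)" by (simp add: ray_dist_def)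
  show "ray_dist x z \<le> ray_dist x y + ray_dist y z"
  proof -
    have nonneg: "0 \<le> ray_dist a b" for a b :: "nat \<Rightarrow> 'a" by (simp add: ray_dist_def)
    have large: "(1/2) ^ i \<le> ray_dist a b" if "a i \<noteq> b i" for a b :: "nat \<Rightarrow> 'a" and i
    proof -
      have "a \<noteq> b" using that by blast
      moreover have "(LEAST i. a i \<noteq> b i) \<le> i" using that by (rule Least_le)
      ultimately show ?thesis by (simp add: ray_dist_def power_decreasing del: power_divide)
    qed
    show ?thesis
    proof (cases "x = z")
      case True
      then show ?thesis using nonneg[of x y] nonneg[of y z] by (simp add: ray_dist_def)
    next
      case False
      define i where "i = (LEAST i. x i \<noteq> z i)"
      have "\<exists>i. x i \<noteq> z i" using False by blast
      then have "x i \<noteq> z i" unfolding i_def by (rule LeastI_ex)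
      then have "x i \<noteq> y i \<or> y i \<noteq> z i" by metis
      moreover have "ray_dist x z = (1/2) ^ i" using False unfolding ray_dist_def i_def by (rule if_not_P)
      ultimately show ?thesis
        using large[of x i y] large[of y i z] nonneg[of x y] nonneg[of y z] by linarith
    qed
  qed
qed

end

theory Submission imports Defs begin

text \<open>
  Let \<open>H\<close> be a subgroup of \<open>G\<close> and \<open>\<xi>\<close> a ray. The closure of the orbit \<open>H \<xi>\<close> is closed and its
  setwise stabilizer, which contains \<open>H\<close>, acts minimally on it; so it defines a generalized parabolic
  subgroup as soon as it contains no cylinder \<open>\<partial> T\<^sub>v\<close>. A closed set with finitely many translates
  under \<open>G\<close> contains a cylinder, because the translates cover the boundary. Applied to
  \<open>C \<inter> \<partial> T\<^sub>v\<close>, this shows that \<open>\<partial> T\<^sub>v\<close> meets \<open>C\<close> if and only if the rigid stabilizer of \<open>v\<close>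
  does not stabilize \<open>C\<close>, so that \<open>C\<close> is determined by its stabilizer.

  For finite cyclic \<open>H\<close> choose \<open>w\<close> such that the stabilizer of \<open>w\<close> in \<open>H\<close> acts trivially below \<open>w\<close>. The
  orbits of the continuum of rays through \<open>w\<close> are pairwise distinct and tree-equivalent, and their
  common cardinality is large if \<open>H\<close> has a large orbit on vertices; this gives (1) and (2).

  For (3) choose torsion elements \<open>h\<^sub>i\<close> in the rigid stabilizers of vertices \<open>v\<^sub>i\<close> along a ray such that
  \<open>h\<^sub>i\<close> moves \<open>v\<^sub>i\<^sub>+\<^sub>1\<close>, but each power of \<open>h\<^sub>i\<close> that fixes \<open>v\<^sub>i\<^sub>+\<^sub>1\<close> acts trivially below it.
  In the closure of the orbit of the ray under the group generated by the
  \<open>h\<^sub>i\<close> with \<open>i \<in> A\<close>, the number of vertices grows between the levels of \<open>v\<^sub>i\<close> and \<open>v\<^sub>i\<^sub>+\<^sub>1\<close> exactly if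
  \<open>i \<in> A\<close>. Hence the tree-equivalence class determines \<open>A\<close>; it is infinite because the translates
  of the closed set under \<open>G\<close> are.
\<close>

section \<open>Rooted trees\<close>

locale rtree =
  fixes T :: "'v rooted_graph"
  assumes rooted_tree: "rooted_tree T"
begin

abbreviation "V \<equiv> verts T"
abbreviation "rt \<equiv> root_vertex T"
abbreviation "rp \<equiv> root_path T"
abbreviation "lv \<equiv> level_of T"

lemma root_in_V: "rt \<in> V"
  using rooted_tree by (simp add: rooted_tree_def)

lemma simple_path_root_path:
  assumes "v \<in> V" shows "simple_path T rt v (rp v)"
  unfolding root_path_def
  by (rule theI') (use assms rooted_tree in \<open>auto simp: rooted_tree_def\<close>)

lemma root_path_eqI:
  assumes "simple_path T rt v p" shows "rp v = p"
proof -
  have "v \<in> V" using assms last_in_set unfolding simple_path_def by blast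
  then have "\<exists>!p. simple_path T rt v p"
    using rooted_tree by (auto simp: rooted_tree_def)
  with simple_path_root_path[OF \<open>v \<in> V\<close>] assms show ?thesis by blast
qed

lemma root_path_root: "rp rt = [rt]"
  by (rule root_path_eqI) (simp add: simple_path_def root_in_V)

lemma
  assumes "v \<in> V"
  shows root_path_ne: "rp v \<noteq> []"
    and hd_root_path: "hd (rp v) = rt"
    and last_root_path: "last (rp v) = v"
    and set_root_path: "set (rp v) \<subseteq> V"
    and distinct_root_path: "distinct (rp v)"
    and succ_root_path: "successively (\<lambda>x y. (x, y) \<in> edges T) (rp v)"
  using simple_path_root_path[OF assms] by (auto simp: simple_path_def)

lemma length_root_path: "v \<in> V \<Longrightarrow> length (rp v) = Suc (lv v)"
  using root_path_ne[of v] by (simp add: level_of_def)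

lemma root_path_nth_level: "v \<in> V \<Longrightarrow> rp v ! lv v = v"
  using last_root_path[of v] root_path_ne[of v] by (simp add: level_of_def last_conv_nth)

lemma root_path_nth_0: "v \<in> V \<Longrightarrow> rp v ! 0 = rt"
  using hd_root_path[of v] root_path_ne[of v] by (simp add: hd_conv_nth)

text \<open>An initial segment of a simple path is simple, so uniqueness makes it the root path of
  its last vertex.\<close>

lemma root_path_prefix:
  assumes "v \<in> V" "rp v = p @ u # q" shows "rp u = p @ [u]"
proof (rule root_path_eqI)
  have *: "rp v = (p @ [u]) @ q" using assms by simp
  with assms(1) show "simple_path T rt u (p @ [u])"
    using hd_root_path[of v] set_root_path[of v] distinct_root_path[of v]
      succ_root_path[of v, unfolded * successively_append_iff[of _ "p @ [u]"]]
    unfolding simple_path_def by (cases p) auto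
qed

lemma root_path_nth:
  assumes "v \<in> V" "i \<le> lv v"
  shows "rp (rp v ! i) = take (Suc i) (rp v)"
proof -
  have "i < length (rp v)" using assms by (simp add: length_root_path)
  then have "rp v = take i (rp v) @ rp v ! i # drop (Suc i) (rp v)"
    by (rule id_take_nth_drop)
  from root_path_prefix[OF assms(1) this] show ?thesis
    using \<open>i < length (rp v)\<close> by (simp add: take_Suc_conv_app_nth)
qed

lemma root_path_nth_in_V: "v \<in> V \<Longrightarrow> i \<le> lv v \<Longrightarrow> rp v ! i \<in> V"
  using set_root_path[of v] length_root_path[of v] nth_mem[of i "rp v"] by auto

lemma level_root_path_nth: "v \<in> V \<Longrightarrow> i \<le> lv v \<Longrightarrow> lv (rp v ! i) = i"
  using root_path_nth[of v i] length_root_path[of v]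
    level_of_def[of T "rp v ! i"] by simp

lemma level_root: "lv rt = 0"
  by (simp add: level_of_def root_path_root)

text \<open>If \<open>v\<close> is not on the root path of \<open>u\<close>, appending
  \<open>v\<close> to that path keeps it simple. Otherwise the prefix ending in \<open>v\<close>
  avoids \<open>u\<close>, which is the last entry, and appending \<open>u\<close> to this prefix
  gives a simple path that must be the root path of \<open>u\<close>.\<close>

lemma edge_root_path:
  assumes e: "(u, v) \<in> edges T"
  shows "rp v = rp u @ [v] \<or> rp u = rp v @ [u]"
proof -
  have uv: "u \<in> V" "v \<in> V" "u \<noteq> v" "(v, u) \<in> edges T"
    using rooted_tree e by (auto simp: rooted_tree_def sym_def irrefl_def)
  show ?thesis
  proof (cases "v \<in> set (rp u)")
    case False
    have "rp v = rp u @ [v]"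
      by (rule root_path_eqI)
        (use False uv e root_path_ne hd_root_path last_root_path set_root_path distinct_root_path
          succ_root_path in \<open>auto simp: simple_path_def successively_append_iff\<close>)
    then show ?thesis ..
  next
    case True
    then obtain p q where pq: "rp u = p @ v # q" by (auto simp: in_set_conv_decomp)
    have pv: "rp v = p @ [v]" using root_path_prefix[OF uv(1) pq] .
    have "u \<notin> set p"
    proof
      assume "u \<in> set p"
      then have "u \<noteq> last (v # q)" using distinct_root_path[OF uv(1)] pq last_in_set[of "v # q"]
        by auto
      then show False using last_root_path[OF uv(1)] pq by simp
    qed
    have "rp u = rp v @ [u]"
      by (rule root_path_eqI)
        (use \<open>u \<notin> set p\<close> pv uv root_path_ne[of v] hd_root_path[of v] last_root_path[of v]
          set_root_path[of v] distinct_root_path[of v] succ_root_path[of v]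
         in \<open>auto simp: simple_path_def successively_append_iff hd_append\<close>)
    then show ?thesis ..
  qed
qed

lemma edge_in_V: "(u, v) \<in> edges T \<Longrightarrow> u \<in> V \<and> v \<in> V"
  using rooted_tree by (auto simp: rooted_tree_def)

text \<open>The levels in the definition of \<open>children\<close> decide between the two
  alternatives of \<open>edge_root_path\<close>.\<close>

lemma children_iff:
  assumes "v \<in> V" shows "w \<in> children T v \<longleftrightarrow> w \<in> V \<and> rp w = rp v @ [w]"
proof
  assume w: "w \<in> children T v"
  then have "(v, w) \<in> edges T" "lv w = Suc (lv v)" by (auto simp: children_def)
  moreover from this have "w \<in> V" using edge_in_V by blast
  moreover have "rp v \<noteq> rp w @ [v]"
    using length_root_path[OF assms] length_root_path[OF \<open>w \<in> V\<close>] \<open>lv w = _\<close> by auto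
  ultimately show "w \<in> V \<and> rp w = rp v @ [w]" using edge_root_path by blast
next
  assume w: "w \<in> V \<and> rp w = rp v @ [w]"
  then have "(last (rp v), w) \<in> edges T"
    using succ_root_path[of w] root_path_ne[OF assms] by (auto simp: successively_append_iff)
  then show "w \<in> children T v"
    using w last_root_path[OF assms] root_path_ne[OF assms]
    by (auto simp: children_def level_of_def)
qed

lemma children_in_V: "w \<in> children T v \<Longrightarrow> w \<in> V"
  using edge_in_V by (auto simp: children_def)

lemma level_children: "w \<in> children T v \<Longrightarrow> lv w = Suc (lv v)"
  by (simp add: children_def)

lemma parent_unique:
  assumes "w \<in> children T u" "w \<in> children T v" shows "u = v"
proof -
  have uv: "u \<in> V" "v \<in> V" using assms edge_in_V by (auto simp: children_def)
  then have "rp u = rp v" using assms by (simp add: children_iff)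
  then show ?thesis using uv last_root_path by metis
qed

lemma ex_parent:
  assumes "v \<in> V" "lv v = Suc n"
  obtains u where "u \<in> V" "lv u = n" "v \<in> children T u"
proof -
  define u where "u = rp v ! n"
  have u: "u \<in> V" "lv u = n" "rp u = take (Suc n) (rp v)"
    using assms root_path_nth_in_V[of v n] level_root_path_nth[of v n] root_path_nth[of v n]
    by (auto simp: u_def)
  have "rp v = take (Suc n) (rp v) @ [rp v ! Suc n]"
    using assms length_root_path[of v]
    by (metis lessI order_refl take_Suc_conv_app_nth take_all)
  then have "rp v = rp u @ [v]" using u assms root_path_nth_level[of v] by simp
  then show thesis using that[of u] u assms by (simp add: children_iff)
qed

lemma level_0: "v \<in> V \<Longrightarrow> lv v = 0 \<Longrightarrow> v = rt"
  by (metis root_path_nth_level root_path_nth_0)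

lemma edge_cases:
  assumes "(u, v) \<in> edges T" shows "v \<in> children T u \<or> u \<in> children T v"
  using edge_root_path[OF assms] edge_in_V[OF assms] children_iff by blast

lemma edge_iff_children: "(u, v) \<in> edges T \<longleftrightarrow> v \<in> children T u \<or> u \<in> children T v"
proof -
  have "(v, u) \<in> edges T \<Longrightarrow> (u, v) \<in> edges T"
    using rooted_tree by (auto simp: rooted_tree_def dest: symD)
  then show ?thesis using edge_cases[of u v] by (auto simp: children_def)
qed

text \<open>Entries of a root path are indexed by their levels, so \<open>v\<close> can occur only
  at position \<open>lv v\<close>.\<close>

lemma descendants_iff: "u \<in> descendants T v \<longleftrightarrow> u \<in> V \<and> lv v \<le> lv u \<and> rp u ! lv v = v"
proof
  assume "u \<in> descendants T v"
  then have u: "u \<in> V" "v \<in> set (rp u)" by (auto simp: descendants_def)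
  then obtain i where "i < length (rp u)" "rp u ! i = v" by (auto simp: in_set_conv_nth)
  with u show "u \<in> V \<and> lv v \<le> lv u \<and> rp u ! lv v = v"
    using length_root_path[of u] level_root_path_nth[of u i] by auto
next
  assume u: "u \<in> V \<and> lv v \<le> lv u \<and> rp u ! lv v = v"
  then have "lv v < length (rp u)" using length_root_path[of u] by simp
  then have "v \<in> set (rp u)" using u nth_mem by metis
  then show "u \<in> descendants T v" using u by (simp add: descendants_def)
qed

lemma descendants_refl: "v \<in> V \<Longrightarrow> v \<in> descendants T v"
  by (simp add: descendants_iff root_path_nth_level)

lemma descendants_in_V: "u \<in> descendants T v \<Longrightarrow> u \<in> V"
  by (simp add: descendants_def)

lemma descendants_trans:
  assumes "u \<in> descendants T v" "v \<in> descendants T w" shows "u \<in> descendants T w"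
proof -
  have *: "u \<in> V" "lv v \<le> lv u" "rp u ! lv v = v" "lv w \<le> lv v" "rp v ! lv w = w"
    using assms descendants_iff by auto
  then have "rp v = take (Suc (lv v)) (rp u)" using root_path_nth[of u "lv v"] by simp
  then have "rp u ! lv w = w" using * by simp
  then show ?thesis using * descendants_iff le_trans by blast
qed

lemma descendants_same_level: "u \<in> descendants T v \<Longrightarrow> lv u = lv v \<Longrightarrow> u = v"
  using root_path_nth_level[OF descendants_in_V] by (metis descendants_iff)

lemma descendants_disjoint:
  assumes "u \<in> descendants T v" "u \<in> descendants T w" "lv v = lv w" shows "v = w"
proof -
  have "v = rp u ! lv v" "w = rp u ! lv w" using assms(1,2) descendants_iff by auto
  then show ?thesis using assms(3) by (rule_tac box_equals) auto
qed

lemma children_descendants: "w \<in> children T v \<Longrightarrow> v \<in> V \<Longrightarrow> w \<in> descendants T v"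
  using children_iff[of v w] last_root_path[of v] root_path_ne[of v] last_in_set[of "rp v"]
  by (auto simp: descendants_def)


subsection \<open>Rays\<close>

abbreviation "bd \<equiv> boundary T"

text \<open>Injectivity rules out backtracking, so initial segments of rays are simple paths from
  the root; in particular the index of a vertex on a ray is its level.\<close>

lemma ray_root_path:
  assumes "\<xi> \<in> bd" shows "rp (\<xi> n) = map \<xi> [0..<Suc n]"
proof (rule root_path_eqI)
  have \<xi>: "\<xi> 0 = rt" "inj \<xi>" "range \<xi> \<subseteq> V" "\<And>i. (\<xi> i, \<xi> (Suc i)) \<in> edges T"
    using assms by (auto simp: boundary_def)
  have "successively (\<lambda>x y. (x, y) \<in> edges T) (map \<xi> [0..<Suc n])"
    by (induction n) (use \<xi> in \<open>auto simp: successively_append_iff\<close>)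
  then show "simple_path T rt (\<xi> n) (map \<xi> [0..<Suc n])"
    using \<xi>(1,3) inj_on_subset[OF \<xi>(2) subset_UNIV] root_in_V
    by (auto simp: simple_path_def distinct_map hd_append hd_map inj_on_image_mem_iff dest: injD[OF \<xi>(2)])
qed

lemma ray_in_V: "\<xi> \<in> bd \<Longrightarrow> \<xi> n \<in> V"
  by (auto simp: boundary_def)

lemma ray_level: "\<xi> \<in> bd \<Longrightarrow> lv (\<xi> n) = n"
  using ray_root_path[of \<xi> n] by (simp add: level_of_def)

lemma ray_0: "\<xi> \<in> bd \<Longrightarrow> \<xi> 0 = rt"
  by (simp add: boundary_def)

lemma ray_nth: "\<xi> \<in> bd \<Longrightarrow> i \<le> n \<Longrightarrow> rp (\<xi> n) ! i = \<xi> i"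
  by (simp add: ray_root_path nth_append del: upt_Suc)

lemma ray_agree: "\<xi> \<in> bd \<Longrightarrow> \<eta> \<in> bd \<Longrightarrow> \<xi> n = \<eta> n \<Longrightarrow> i \<le> n \<Longrightarrow> \<xi> i = \<eta> i"
  by (metis ray_nth)

lemma ray_child: "\<xi> \<in> bd \<Longrightarrow> \<xi> (Suc n) \<in> children T (\<xi> n)"
  by (simp add: ray_root_path ray_in_V children_iff)

lemma ray_descendant: "\<xi> \<in> bd \<Longrightarrow> i \<le> n \<Longrightarrow> \<xi> n \<in> descendants T (\<xi> i)"
  by (simp add: descendants_iff ray_level ray_nth ray_in_V)

text \<open>Each step to a child raises the level by one, which gives injectivity.\<close>

lemma boundaryI:
  assumes "\<xi> 0 = rt" "\<And>n. \<xi> (Suc n) \<in> children T (\<xi> n)" shows "\<xi> \<in> bd"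
proof -
  have "\<xi> n \<in> V" for n
    using assms(1) root_in_V children_in_V[OF assms(2)] by (cases n) auto
  moreover have lev: "lv (\<xi> n) = n" for n
    by (induction n) (use assms(1) level_root level_children[OF assms(2)] in auto)
  moreover have "inj \<xi>" by (rule injI) (metis lev)
  ultimately show ?thesis using assms by (auto simp: boundary_def children_def)
qed

text \<open>The boundary of the subtree below \<open>v\<close>, kept as a set of rays of the whole
  tree. A ray can meet \<open>v\<close> only at index \<open>lv v\<close>.\<close>

definition cyl :: "'v \<Rightarrow> (nat \<Rightarrow> 'v) set" where
  "cyl v = {\<xi> \<in> bd. \<xi> (lv v) = v}"

lemma cyl_ray: "\<xi> \<in> bd \<Longrightarrow> cyl (\<xi> n) = {\<eta> \<in> bd. \<eta> n = \<xi> n}"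
  by (simp add: cyl_def ray_level)

lemma ray_in_cyl: "\<xi> \<in> bd \<Longrightarrow> \<xi> \<in> cyl (\<xi> n)"
  by (simp add: cyl_ray)

lemma cyl_subset_boundary: "\<xi> \<in> cyl v \<Longrightarrow> \<xi> \<in> bd"
  by (simp add: cyl_def)

lemma cyl_mono:
  assumes "u \<in> descendants T v" shows "cyl u \<subseteq> cyl v"
proof
  fix \<xi> assume "\<xi> \<in> cyl u"
  then have \<xi>: "\<xi> \<in> bd" "\<xi> (lv u) = u" by (auto simp: cyl_def)
  then have "u \<in> V" using ray_in_V by metis
  have "\<xi> (lv v) = v" using assms \<xi> ray_nth[of \<xi> "lv v" "lv u"] by (simp add: descendants_iff)
  then show "\<xi> \<in> cyl v" using \<xi> by (simp add: cyl_def)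
qed

lemma cyl_root: "cyl rt = bd"
  by (auto simp: cyl_def level_root ray_0)

lemma cyl_descendant:
  "\<xi> \<in> cyl v \<Longrightarrow> lv v \<le> n \<Longrightarrow> \<xi> n \<in> descendants T v"
  using ray_descendant[of \<xi> "lv v" n] by (auto simp: cyl_def)

section \<open>Automorphisms\<close>

abbreviation "Aut \<equiv> carrier (aut_group T)"

sublocale aut: group "aut_group T"
  by (rule group_aut_group) (rule root_in_V)

lemma aut_iff:
  "g \<in> Aut \<longleftrightarrow> g \<in> Bij V \<and> g rt = rt \<and>
    (\<forall>u\<in>V. \<forall>v\<in>V. (g u, g v) \<in> edges T \<longleftrightarrow> (u, v) \<in> edges T)"
  by (simp add: aut_group_def)

lemma
  assumes "g \<in> Aut"
  shows aut_bij: "bij_betw g V V"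
    and aut_extensional: "g \<in> extensional V"
    and aut_root: "g rt = rt"
  using assms by (auto simp: aut_iff Bij_def)

lemma aut_in_V: "g \<in> Aut \<Longrightarrow> v \<in> V \<Longrightarrow> g v \<in> V"
  using aut_bij bij_betwE by blast

lemma aut_inj: "g \<in> Aut \<Longrightarrow> u \<in> V \<Longrightarrow> v \<in> V \<Longrightarrow> g u = g v \<longleftrightarrow> u = v"
  using aut_bij[of g] by (auto simp: bij_betw_def inj_on_def)

lemma aut_eqI:
  assumes "g \<in> Aut" "h \<in> Aut" "\<And>v. v \<in> V \<Longrightarrow> g v = h v" shows "g = h"
  using assms aut_extensional by (intro extensionalityI[of g V h]) auto

lemma mult_apply:
  assumes "g \<in> Aut" "h \<in> Aut" "v \<in> V"
  shows "(g \<otimes>\<^bsub>aut_group T\<^esub> h) v = g (h v)"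
  using assms by (simp add: aut_iff aut_group_def BijGroup_def compose_def)

lemma one_apply: "v \<in> V \<Longrightarrow> \<one>\<^bsub>aut_group T\<^esub> v = v"
  by (simp add: aut_group_def BijGroup_def)

lemma inv_apply:
  assumes "g \<in> Aut" "v \<in> V"
  shows "(inv\<^bsub>aut_group T\<^esub> g) (g v) = v" "g ((inv\<^bsub>aut_group T\<^esub> g) v) = v"
  using assms mult_apply[of g "inv\<^bsub>aut_group T\<^esub> g" v] mult_apply[of "inv\<^bsub>aut_group T\<^esub> g" g v]
  by (simp_all add: one_apply)

text \<open>The image of a simple path from the root is again one. Equivariance of levels, children
  and descendants follows from this.\<close>

lemma aut_root_path:
  assumes g: "g \<in> Aut" and v: "v \<in> V" shows "rp (g v) = map g (rp v)"
proof (rule root_path_eqI)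
  have "successively (\<lambda>x y. (g x, g y) \<in> edges T) (rp v)"
    by (rule successively_mono[OF succ_root_path[OF v]])
      (use g set_root_path[OF v] in \<open>auto simp: aut_iff\<close>)
  moreover have "inj_on g (set (rp v))"
    using inj_on_subset[OF _ set_root_path[OF v]] aut_bij[OF g] by (auto simp: bij_betw_def)
  moreover have "g ` set (rp v) \<subseteq> V" using aut_in_V[OF g] set_root_path[OF v] by auto
  ultimately show "simple_path T rt (g v) (map g (rp v))"
    using root_path_ne[OF v] hd_root_path[OF v] last_root_path[OF v] distinct_root_path[OF v]
      aut_root[OF g]
    by (simp add: simple_path_def hd_map last_map distinct_map successively_map)
qed

lemma aut_level: "g \<in> Aut \<Longrightarrow> v \<in> V \<Longrightarrow> lv (g v) = lv v"
  by (simp add: level_of_def aut_root_path)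

lemma aut_children:
  assumes g: "g \<in> Aut" and v: "v \<in> V" and w: "w \<in> children T v"
  shows "g w \<in> children T (g v)"
proof -
  have "w \<in> V" using w by (rule children_in_V)
  then show ?thesis
    using w v g by (simp add: children_iff aut_in_V aut_root_path)
qed

lemma aut_descendants:
  assumes "g \<in> Aut" "v \<in> V" "u \<in> descendants T v" shows "g u \<in> descendants T (g v)"
  using assms by (auto simp: descendants_def aut_in_V aut_root_path)

text \<open>\<open>g v\<close> is the ancestor of \<open>g u = u\<close> on the level of
  \<open>v\<close>, hence equal to \<open>v\<close>.\<close>

lemma aut_fixes_ancestors:
  assumes "g \<in> Aut" "v \<in> V" "u \<in> descendants T v" "g u = u" shows "g v = v"
  using assms descendants_disjoint[of u "g v" v] aut_descendants[of g v u] aut_level[of g v]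
  by simp

lemma aut_agree_ancestors:
  assumes "g \<in> Aut" "h \<in> Aut" "v \<in> V" "u \<in> descendants T v" "g u = h u"
  shows "g v = h v"
  using assms descendants_disjoint[of "g u" "g v" "h v"] aut_descendants[of g v u]
    aut_descendants[of h v u] aut_level[of g v] aut_level[of h v]
  by simp

lemma ray_image_apply: "ray_image g \<xi> n = g (\<xi> n)"
  by (simp add: ray_image_def)

lemma ray_image_in_boundary:
  assumes "g \<in> Aut" "\<xi> \<in> bd" shows "ray_image g \<xi> \<in> bd"
proof (rule boundaryI)
  show "ray_image g \<xi> 0 = rt" using assms by (simp add: ray_image_apply ray_0 aut_root)
  show "ray_image g \<xi> (Suc n) \<in> children T (ray_image g \<xi> n)" for n
    unfolding ray_image_apply
    by (rule aut_children[OF assms(1) ray_in_V[OF assms(2)] ray_child[OF assms(2)]])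
qed

lemma ray_image_mult:
  "g \<in> Aut \<Longrightarrow> h \<in> Aut \<Longrightarrow> \<xi> \<in> bd \<Longrightarrow>
    ray_image (g \<otimes>\<^bsub>aut_group T\<^esub> h) \<xi> = ray_image g (ray_image h \<xi>)"
  by (rule ext) (simp add: ray_image_apply mult_apply ray_in_V)

lemma ray_image_one: "\<xi> \<in> bd \<Longrightarrow> ray_image \<one>\<^bsub>aut_group T\<^esub> \<xi> = \<xi>"
  by (rule ext) (simp add: ray_image_apply one_apply ray_in_V)

lemma ray_image_inv:
  assumes "g \<in> Aut" "\<xi> \<in> bd"
  shows "ray_image (inv\<^bsub>aut_group T\<^esub> g) (ray_image g \<xi>) = \<xi>"
    "ray_image g (ray_image (inv\<^bsub>aut_group T\<^esub> g) \<xi>) = \<xi>"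
  using assms by (simp_all add: fun_eq_iff ray_image_apply inv_apply ray_in_V)

lemma image_ray_image_mult:
  "g \<in> Aut \<Longrightarrow> h \<in> Aut \<Longrightarrow> C \<subseteq> bd \<Longrightarrow>
    ray_image (g \<otimes>\<^bsub>aut_group T\<^esub> h) ` C = ray_image g ` ray_image h ` C"
  unfolding image_image by (rule image_cong) (auto simp: ray_image_mult)

lemma image_ray_image_one:
  assumes "C \<subseteq> bd" shows "ray_image \<one>\<^bsub>aut_group T\<^esub> ` C = C"
proof -
  have "ray_image \<one>\<^bsub>aut_group T\<^esub> ` C = id ` C"
    by (rule image_cong) (use assms in \<open>auto simp: ray_image_one\<close>)
  then show ?thesis by simp
qed

lemma image_ray_image_inv:
  assumes "g \<in> Aut" "C \<subseteq> bd"
  shows "ray_image (inv\<^bsub>aut_group T\<^esub> g) ` ray_image g ` C = C"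
    "ray_image g ` ray_image (inv\<^bsub>aut_group T\<^esub> g) ` C = C"
  using image_ray_image_mult[of "inv\<^bsub>aut_group T\<^esub> g" g C]
    image_ray_image_mult[of g "inv\<^bsub>aut_group T\<^esub> g" C] assms
  by (simp_all add: image_ray_image_one)


section \<open>Topology of the boundary\<close>

sublocale bd: Metric_space bd ray_dist
  by (rule Metric_space_boundary)

text \<open>Balls are cylinders: if the rays first differ at \<open>k\<close>, they agree at
  \<open>n\<close> exactly when \<open>n < k\<close>, since agreement at \<open>n\<close> propagates
  to all smaller indices.\<close>

lemma ray_dist_less_iff:
  assumes "\<xi> \<in> bd" "\<eta> \<in> bd"
  shows "ray_dist \<xi> \<eta> < (1/2) ^ n \<longleftrightarrow> \<xi> n = \<eta> n"
proof (cases "\<xi> = \<eta>")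
  case True
  then show ?thesis by (simp add: ray_dist_def)
next
  case False
  define k where "k = (LEAST i. \<xi> i \<noteq> \<eta> i)"
  have "\<exists>i. \<xi> i \<noteq> \<eta> i" using False by auto
  then have k: "\<xi> k \<noteq> \<eta> k" unfolding k_def by (rule LeastI_ex)
  have "ray_dist \<xi> \<eta> = (1/2) ^ k" using False by (simp add: ray_dist_def k_def)
  then have "ray_dist \<xi> \<eta> < (1/2) ^ n \<longleftrightarrow> n < k" by simp
  also have "\<dots> \<longleftrightarrow> \<xi> n = \<eta> n"
    using k ray_agree[OF assms, of n k] not_less_Least[of n "\<lambda>i. \<xi> i \<noteq> \<eta> i"]
    unfolding k_def[symmetric] by (meson not_less)
  finally show ?thesis .
qed

lemma openin_boundary_iff:
  "openin (boundary_topology T) U \<longleftrightarrow> U \<subseteq> bd \<and> (\<forall>\<xi>\<in>U. \<exists>n. cyl (\<xi> n) \<subseteq> U)"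
proof -
  have "(\<exists>r>0. bd.mball \<xi> r \<subseteq> U) \<longleftrightarrow> (\<exists>n. cyl (\<xi> n) \<subseteq> U)" if \<xi>: "\<xi> \<in> bd" for \<xi>
  proof -
    have ball: "bd.mball \<xi> ((1/2) ^ n) = cyl (\<xi> n)" for n
      using \<xi> by (auto simp: ray_dist_less_iff cyl_ray)
    show ?thesis
    proof
      assume "\<exists>r>0. bd.mball \<xi> r \<subseteq> U"
      then obtain r where r: "r > 0" "bd.mball \<xi> r \<subseteq> U" by blast
      obtain n where "(1/2::real) ^ n < r" using real_arch_pow_inv[OF r(1), of "1/2"] by auto
      then have "cyl (\<xi> n) \<subseteq> U"
        using r(2) bd.mball_subset_concentric[of "(1/2) ^ n" r \<xi>] ball[of n] by auto
      then show "\<exists>n. cyl (\<xi> n) \<subseteq> U" ..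
    next
      assume "\<exists>n. cyl (\<xi> n) \<subseteq> U"
      then obtain n where "cyl (\<xi> n) \<subseteq> U" ..
      then have "bd.mball \<xi> ((1/2) ^ n) \<subseteq> U" using ball by simp
      then show "\<exists>r>0. bd.mball \<xi> r \<subseteq> U" by (intro exI[of _ "(1/2) ^ n"]) simp
    qed
  qed
  then show ?thesis unfolding boundary_topology_def bd.openin_mtopology by (auto simp: subset_iff)
qed

text \<open>Closedness for the metric topology, stated through vertices only;
  \<open>closedin_boundary_iff\<close> shows the equivalence.\<close>

definition closed_rays :: "(nat \<Rightarrow> 'v) set \<Rightarrow> bool" where
  "closed_rays C \<longleftrightarrow> C \<subseteq> bd \<and> (\<forall>\<xi>\<in>bd. (\<forall>n. \<exists>\<eta>\<in>C. \<eta> n = \<xi> n) \<longrightarrow> \<xi> \<in> C)"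

lemma topspace_boundary_topology: "topspace (boundary_topology T) = bd"
  by (simp add: boundary_topology_def)

lemma closedin_boundary_iff: "closedin (boundary_topology T) C \<longleftrightarrow> closed_rays C"
proof -
  have *: "cyl (\<xi> n) \<subseteq> bd - C \<longleftrightarrow> \<not> (\<exists>\<eta>\<in>C. \<eta> n = \<xi> n)" if "\<xi> \<in> bd" "C \<subseteq> bd" for \<xi> n
    using that by (auto simp: cyl_ray)
  show ?thesis
    unfolding closedin_def openin_boundary_iff topspace_boundary_topology closed_rays_def
    using * by blast
qed

text \<open>Density of an orbit in \<open>C\<close> means meeting every cylinder around a ray of
  \<open>C\<close>, which is a condition on vertices level by level. Invariance of \<open>C\<close>
  keeps the orbit inside \<open>C\<close>.\<close>

lemma minimal_action_iff:
  assumes C: "C \<subseteq> bd" and H: "\<And>h. h \<in> H \<Longrightarrow> ray_image h ` C \<subseteq> C"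
  shows "minimal_action T H C \<longleftrightarrow> (\<forall>\<xi>\<in>C. \<forall>\<eta>\<in>C. \<forall>n. \<exists>h\<in>H. h (\<xi> n) = \<eta> n)"
proof -
  have "subtopology (boundary_topology T) C closure_of ((\<lambda>h. ray_image h \<xi>) ` H) = C \<longleftrightarrow>
    (\<forall>\<eta>\<in>C. \<forall>n. \<exists>h\<in>H. h (\<xi> n) = \<eta> n)" (is "?cl = C \<longleftrightarrow> _") if \<xi>: "\<xi> \<in> C" for \<xi>
  proof -
    have cyl_open: "openin (boundary_topology T) (cyl v)" for v
      unfolding openin_boundary_iff by (auto simp: cyl_def cyl_ray intro!: exI[of _ "lv v"])
    have "?cl = {\<eta> \<in> C. \<forall>n. \<exists>h\<in>H. h (\<xi> n) = \<eta> n}"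
    proof (intro subset_antisym subsetI)
      fix \<eta> assume \<eta>: "\<eta> \<in> ?cl"
      then have \<eta>C: "\<eta> \<in> C" by (simp add: in_closure_of)
      moreover have "\<exists>h\<in>H. h (\<xi> n) = \<eta> n" for n
      proof -
        have "openin (subtopology (boundary_topology T) C) (cyl (\<eta> n) \<inter> C)"
          using cyl_open by (auto simp: openin_subtopology)
        moreover have "\<eta> \<in> cyl (\<eta> n) \<inter> C" using \<eta>C C ray_in_cyl by auto
        ultimately obtain \<zeta> where "\<zeta> \<in> (\<lambda>h. ray_image h \<xi>) ` H" "\<zeta> \<in> cyl (\<eta> n)"
          using \<eta> unfolding in_closure_of by blast
        then show ?thesis using \<eta>C C by (auto simp: cyl_ray subset_iff ray_image_apply)
      qed
      ultimately show "\<eta> \<in> {\<eta> \<in> C. \<forall>n. \<exists>h\<in>H. h (\<xi> n) = \<eta> n}" by blast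
    next
      fix \<eta> assume "\<eta> \<in> {\<eta> \<in> C. \<forall>n. \<exists>h\<in>H. h (\<xi> n) = \<eta> n}"
      then have \<eta>: "\<eta> \<in> C" "\<And>n. \<exists>h\<in>H. h (\<xi> n) = \<eta> n" by auto
      have "\<exists>\<zeta>. \<zeta> \<in> (\<lambda>h. ray_image h \<xi>) ` H \<and> \<zeta> \<in> U"
        if U: "openin (subtopology (boundary_topology T) C) U" "\<eta> \<in> U" for U
      proof -
        obtain W where W: "openin (boundary_topology T) W" "U = W \<inter> C"
          using U by (auto simp: openin_subtopology)
        then obtain n where n: "cyl (\<eta> n) \<subseteq> W" using U(2) unfolding openin_boundary_iff by blast
        obtain h where h: "h \<in> H" "h (\<xi> n) = \<eta> n" using \<eta> by blast
        have "ray_image h \<xi> \<in> C" using H[OF h(1)] \<xi> by blast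
        moreover from this have "ray_image h \<xi> \<in> cyl (\<eta> n)"
          using h C \<eta>(1) by (auto simp: cyl_ray subset_iff ray_image_apply)
        ultimately show ?thesis using h(1) n W by blast
      qed
      then show "\<eta> \<in> ?cl"
        using \<eta>(1) C by (auto simp: in_closure_of topspace_subtopology topspace_boundary_topology)
    qed
    moreover have "{\<eta> \<in> C. P \<eta>} = C \<longleftrightarrow> (\<forall>\<eta>\<in>C. P \<eta>)" for P by blast
    ultimately show ?thesis by simp
  qed
  then show ?thesis unfolding minimal_action_def by simp
qed

text \<open>In a tree where every vertex has children, this is nonempty interior.\<close>

definition contains_cyl :: "(nat \<Rightarrow> 'v) set \<Rightarrow> bool" where
  "contains_cyl C \<longleftrightarrow> (\<exists>v\<in>V. cyl v \<subseteq> C)"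

lemma closed_raysD: "closed_rays C \<Longrightarrow> \<xi> \<in> bd \<Longrightarrow> (\<And>n. \<exists>\<eta>\<in>C. \<eta> n = \<xi> n) \<Longrightarrow> \<xi> \<in> C"
  by (auto simp: closed_rays_def)

lemma closed_rays_subset: "closed_rays C \<Longrightarrow> C \<subseteq> bd"
  by (simp add: closed_rays_def)

lemma closed_rays_Union: "finite \<D> \<Longrightarrow> (\<And>D. D \<in> \<D> \<Longrightarrow> closed_rays D) \<Longrightarrow> closed_rays (\<Union>\<D>)"
  unfolding closedin_boundary_iff[symmetric] by (rule closedin_Union)

lemma closed_rays_separate:
  assumes "closed_rays C" "\<xi> \<in> bd" "\<xi> \<notin> C"
  obtains m where "m \<ge> k" "cyl (\<xi> m) \<inter> C = {}"
proof -
  obtain n where n: "\<And>\<eta>. \<eta> \<in> C \<Longrightarrow> \<eta> n \<noteq> \<xi> n"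
    using assms unfolding closed_rays_def by blast
  have "cyl (\<xi> (max n k)) \<inter> C = {}"
    using n ray_agree[OF _ assms(2), of _ "max n k" n] by (auto simp: cyl_ray[OF assms(2)])
  then show thesis using that[of "max n k"] by simp
qed

lemma closed_rays_cyl_Int:
  assumes C: "closed_rays C" shows "closed_rays (C \<inter> cyl v)"
  unfolding closed_rays_def
proof (intro conjI ballI impI)
  fix \<xi> assume \<xi>: "\<xi> \<in> bd" "\<forall>n. \<exists>\<eta>\<in>C \<inter> cyl v. \<eta> n = \<xi> n"
  then have "\<xi> \<in> C" by (intro closed_raysD[OF C]) auto
  moreover have "\<xi> (lv v) = v" using \<xi>(2)[THEN spec, of "lv v"] by (auto simp: cyl_def)
  ultimately show "\<xi> \<in> C \<inter> cyl v" using \<xi>(1) by (simp add: cyl_def)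
qed (use closed_rays_subset[OF C] in auto)

text \<open>One inclusion is direct; the other is the same inclusion for the inverse of
  \<open>g\<close>.\<close>

lemma image_cyl:
  assumes g: "g \<in> Aut" and v: "v \<in> V" shows "ray_image g ` cyl v = cyl (g v)"
proof -
  have *: "ray_image h ` cyl u \<subseteq> cyl (h u)" if "h \<in> Aut" "u \<in> V" for h u
    using that by (auto simp: cyl_def ray_image_in_boundary ray_image_apply aut_level)
  let ?i = "inv\<^bsub>aut_group T\<^esub> g"
  have "ray_image ?i ` cyl (g v) \<subseteq> cyl v"
    using *[of ?i "g v"] g v by (simp add: aut_in_V inv_apply)
  then have "ray_image g ` ray_image ?i ` cyl (g v) \<subseteq> ray_image g ` cyl v" by (rule image_mono)
  then have "cyl (g v) \<subseteq> ray_image g ` cyl v"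
    using image_ray_image_inv(2)[OF g, of "cyl (g v)"] by (simp add: cyl_def)
  with *[OF g v] show ?thesis by blast
qed

lemma image_subset_boundary: "g \<in> Aut \<Longrightarrow> C \<subseteq> bd \<Longrightarrow> ray_image g ` C \<subseteq> bd"
  using ray_image_in_boundary by blast

lemma closed_rays_image:
  assumes g: "g \<in> Aut" and C: "closed_rays C" shows "closed_rays (ray_image g ` C)"
  unfolding closed_rays_def
proof (intro conjI ballI impI)
  show "ray_image g ` C \<subseteq> bd" by (rule image_subset_boundary[OF g closed_rays_subset[OF C]])
  fix \<xi> assume \<xi>: "\<xi> \<in> bd" "\<forall>n. \<exists>\<eta>\<in>ray_image g ` C. \<eta> n = \<xi> n"
  let ?i = "inv\<^bsub>aut_group T\<^esub> g"
  have "ray_image ?i \<xi> \<in> C"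
  proof (rule closed_raysD[OF C])
    show "ray_image ?i \<xi> \<in> bd" using g \<xi> by (simp add: ray_image_in_boundary)
    fix n
    obtain \<eta> where "\<eta> \<in> C" "g (\<eta> n) = \<xi> n" using \<xi>(2) by (auto simp: ray_image_apply)
    moreover from this have "?i (\<xi> n) = \<eta> n"
      using inv_apply(1)[OF g, of "\<eta> n"] ray_in_V closed_rays_subset[OF C] by auto
    ultimately show "\<exists>\<eta>\<in>C. \<eta> n = ray_image ?i \<xi> n" by (auto simp: ray_image_apply)
  qed
  then show "\<xi> \<in> ray_image g ` C" using ray_image_inv(2)[OF g \<xi>(1)] by force
qed

lemma contains_cyl_image:
  assumes g: "g \<in> Aut" and C: "C \<subseteq> bd" and "contains_cyl (ray_image g ` C)"
  shows "contains_cyl C"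
proof -
  let ?i = "inv\<^bsub>aut_group T\<^esub> g"
  obtain v where v: "v \<in> V" "cyl v \<subseteq> ray_image g ` C" using assms by (auto simp: contains_cyl_def)
  then have "ray_image ?i ` cyl v \<subseteq> ray_image ?i ` ray_image g ` C" by blast
  then have "cyl (?i v) \<subseteq> C"
    using image_ray_image_inv(1)[OF g C] image_cyl[of ?i v] g v by simp
  then show ?thesis using g v aut_in_V[of ?i v] by (auto simp: contains_cyl_def)
qed

lemma sstabD: "g \<in> sstab G C \<Longrightarrow> ray_image g ` C = C"
  by (simp add: sstab_def)

lemma minimal_sstab_iff:
  "C \<subseteq> bd \<Longrightarrow> minimal_action T (sstab G C) C \<longleftrightarrow>
    (\<forall>\<xi>\<in>C. \<forall>\<eta>\<in>C. \<forall>n. \<exists>h\<in>sstab G C. h (\<xi> n) = \<eta> n)"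
  by (rule minimal_action_iff) (auto simp: sstab_def)

text \<open>For any \<open>\<xi>\<close> in \<open>C\<close>, minimality supplies an element of the
  stabilizer that moves the vertex of \<open>\<xi>\<close> on level \<open>lv v\<close> to
  \<open>v\<close>; pulling \<open>cyl v\<close> back yields a neighbourhood of \<open>\<xi>\<close>
  inside \<open>C\<close>.\<close>

lemma openin_if_contains_cyl:
  assumes C: "C \<subseteq> bd" and G: "G \<subseteq> Aut" and min: "minimal_action T (sstab G C) C"
    and cc: "contains_cyl C" and ne: "\<And>v. v \<in> V \<Longrightarrow> cyl v \<noteq> {}"
  shows "openin (boundary_topology T) C"
proof -
  obtain v \<eta> where v: "v \<in> V" "cyl v \<subseteq> C" "\<eta> \<in> cyl v"
    using cc ne unfolding contains_cyl_def by blast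
  have "cyl (\<xi> (lv v)) \<subseteq> C" if \<xi>: "\<xi> \<in> C" for \<xi>
  proof -
    obtain h where h: "h \<in> sstab G C" "h (\<xi> (lv v)) = \<eta> (lv v)"
      using min \<xi> v unfolding minimal_sstab_iff[OF C] by blast
    then have hA: "h \<in> Aut" using G by (auto simp: sstab_def)
    have "ray_image h ` cyl (\<xi> (lv v)) = cyl v"
      using image_cyl[OF hA, of "\<xi> (lv v)"] \<xi> C h(2) v(3) ray_in_V by (auto simp: cyl_def)
    then have "ray_image h ` cyl (\<xi> (lv v)) \<subseteq> ray_image h ` C" using v sstabD[OF h(1)] by simp
    then have "ray_image (inv\<^bsub>aut_group T\<^esub> h) ` ray_image h ` cyl (\<xi> (lv v)) \<subseteq>
      ray_image (inv\<^bsub>aut_group T\<^esub> h) ` ray_image h ` C" by (rule image_mono)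
    then show ?thesis
      using image_ray_image_inv(1)[OF hA, of "cyl (\<xi> (lv v))"] image_ray_image_inv(1)[OF hA C]
      by (simp add: cyl_def)
  qed
  then show ?thesis unfolding openin_boundary_iff using C by blast
qed

end


section \<open>Closed subsets of the boundary and rigid stabilizers\<close>

locale regular_tree = rtree T for T :: "'v rooted_graph" +
  assumes regular: "spherically_regular_tree T"
begin

lemma two_children:
  assumes "v \<in> V" obtains a b where "a \<in> children T v" "b \<in> children T v" "a \<noteq> b"
  using regular assms by (auto simp: spherically_regular_tree_def)

text \<open>Down to \<open>v\<close> the ray is forced to be the root path; from there it follows
  the choice function. \<open>c\<close> also sees the level, so that choices can be encoded by a set
  of numbers.\<close>

lemma ex_ray_with_steps:
  assumes v: "v \<in> V" and c: "\<And>n u. u \<in> V \<Longrightarrow> c n u \<in> children T u"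
  shows "\<exists>\<xi>\<in>cyl v. \<forall>n\<ge>lv v. \<xi> (Suc n) = c n (\<xi> n)"
proof -
  define w where "w = rec_nat v (\<lambda>k u. c (lv v + k) u)"
  have w: "w 0 = v" "w (Suc k) = c (lv v + k) (w k)" for k by (simp_all add: w_def)
  have wV: "w k \<in> V" for k
  proof (induction k)
    case (Suc k)
    then show ?case using children_in_V[OF c] by (simp add: w)
  qed (simp add: w v)
  define \<xi> where "\<xi> i = (if i \<le> lv v then rp v ! i else w (i - lv v))" for i
  have step: "\<xi> (Suc n) = c n (\<xi> n) \<and> \<xi> n \<in> V" if "n \<ge> lv v" for n
  proof -
    have "\<xi> n = w (n - lv v)" using that v w(1) by (auto simp: \<xi>_def root_path_nth_level)
    moreover have "\<xi> (Suc n) = w (Suc (n - lv v))" using that by (simp add: \<xi>_def Suc_diff_le)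
    ultimately show ?thesis using that wV by (simp add: w)
  qed
  have "\<xi> \<in> bd"
  proof (rule boundaryI)
    show "\<xi> 0 = rt" using v by (simp add: \<xi>_def root_path_nth_0)
    fix n
    show "\<xi> (Suc n) \<in> children T (\<xi> n)"
    proof (cases "n < lv v")
      case True
      have "rp (rp v ! Suc n) = rp (rp v ! n) @ [rp v ! Suc n]"
        using True v length_root_path[OF v] by (simp add: root_path_nth take_Suc_conv_app_nth)
      then show ?thesis using True v by (simp add: \<xi>_def children_iff root_path_nth_in_V)
    next
      case False
      then show ?thesis using step[of n] c by simp
    qed
  qed
  moreover have "\<xi> (lv v) = v" using v by (simp add: \<xi>_def root_path_nth_level)
  ultimately show ?thesis using step by (auto simp: cyl_def)
qed

lemma cyl_nonempty:
  assumes v: "v \<in> V" shows "cyl v \<noteq> {}"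
proof -
  have "(SOME w. w \<in> children T u) \<in> children T u" if "u \<in> V" for u
    using two_children[OF that] by (metis someI)
  from ex_ray_with_steps[OF v, of "\<lambda>_ u. SOME w. w \<in> children T u", OF this] show ?thesis by blast
qed

text \<open>With two distinct children fixed at every vertex, a set \<open>A\<close> decides at each
  level from \<open>v\<close> on which one to take, and \<open>A\<close> can be read back from the
  ray.\<close>

lemma continuum_lepoll_cyl:
  assumes v: "v \<in> V" shows "(UNIV :: nat set set) \<lesssim> cyl v"
proof -
  have "\<exists>p. fst p \<in> children T u \<and> snd p \<in> children T u \<and> fst p \<noteq> snd p" if "u \<in> V" for u
    using two_children[OF that] by (metis fst_conv snd_conv)
  then obtain p where p: "\<And>u. u \<in> V \<Longrightarrow>
      fst (p u) \<in> children T u \<and> snd (p u) \<in> children T u \<and> fst (p u) \<noteq> snd (p u)"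
    by metis
  have "\<exists>\<xi>\<in>cyl v. \<forall>n\<ge>lv v. \<xi> (Suc n) = (if n - lv v \<in> A then fst (p (\<xi> n)) else snd (p (\<xi> n)))" for A
    using ex_ray_with_steps[OF v, of "\<lambda>n u. if n - lv v \<in> A then fst (p u) else snd (p u)"] p by simp
  then obtain r where r: "\<And>A. r A \<in> cyl v"
    "\<And>A n. n \<ge> lv v \<Longrightarrow> r A (Suc n) = (if n - lv v \<in> A then fst (p (r A n)) else snd (p (r A n)))"
    by metis
  have "n \<in> A \<longleftrightarrow> r A (Suc (lv v + n)) = fst (p (r A (lv v + n)))" for A n
    using r(2)[of "lv v + n" A] p[of "r A (lv v + n)"] ray_in_V[OF cyl_subset_boundary[OF r(1)]]
    by auto
  then have "A = B" if "r A = r B" for A B using that by (simp add: set_eq_iff)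
  then have "inj r" by (rule injI)
  then show ?thesis using r(1) unfolding lepoll_def by blast
qed

lemma cyl_not_singleton:
  assumes "v \<in> V" shows "\<not> cyl v \<subseteq> {\<xi>}"
proof
  assume s: "cyl v \<subseteq> {\<xi>}"
  obtain a b where ab: "a \<in> children T v" "b \<in> children T v" "a \<noteq> b" using two_children[OF assms] .
  have "\<xi> (Suc (lv v)) = w" if w: "w \<in> children T v" for w
  proof -
    obtain \<eta> where \<eta>: "\<eta> \<in> cyl w" using cyl_nonempty[OF children_in_V[OF w]] by blast
    then have "\<eta> \<in> cyl v" using cyl_mono[OF children_descendants[OF w assms]] by blast
    then show ?thesis using \<eta> s w by (auto simp: cyl_def level_children)
  qed
  from this[OF ab(1)] this[OF ab(2)] ab(3) show False by simp
qed

text \<open>An elementary form of Baire's theorem for finitely many closed sets.\<close>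

lemma finite_closed_cover_contains_cyl:
  assumes "finite \<D>" "\<And>D. D \<in> \<D> \<Longrightarrow> closed_rays D" "v \<in> V" "cyl v \<subseteq> \<Union>\<D>"
  shows "\<exists>D\<in>\<D>. contains_cyl D"
  using assms
proof (induction \<D> arbitrary: v)
  case empty
  then show ?case using cyl_nonempty by auto
next
  case (insert D \<D>)
  show ?case
  proof (cases "cyl v \<subseteq> D")
    case True
    then show ?thesis using insert.prems(2) by (auto simp: contains_cyl_def)
  next
    case False
    \<comment> \<open>A ray outside \<open>D\<close> has a cylinder inside \<open>cyl v\<close> that
      misses \<open>D\<close> and so is covered by the remaining sets.\<close>
    then obtain \<xi> where \<xi>: "\<xi> \<in> cyl v" "\<xi> \<notin> D" by blast
    then have \<xi>b: "\<xi> \<in> bd" by (simp add: cyl_def)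
    obtain m where m: "m \<ge> lv v" "cyl (\<xi> m) \<inter> D = {}"
      using closed_rays_separate[OF insert.prems(1)[of D] \<xi>b \<xi>(2)] by auto
    have "cyl (\<xi> m) \<subseteq> cyl v" by (rule cyl_mono[OF cyl_descendant[OF \<xi>(1) m(1)]])
    then have "cyl (\<xi> m) \<subseteq> \<Union>\<D>" using m(2) insert.prems(3) by auto
    then show ?thesis using insert.IH[of "\<xi> m"] insert.prems(1) ray_in_V[OF \<xi>b] by auto
  qed
qed

lemma closed_rays_finite:
  assumes "finite C" "C \<subseteq> bd" shows "closed_rays C"
proof -
  have "closed_rays {\<xi>}" if "\<xi> \<in> bd" for \<xi> using that by (auto simp: closed_rays_def)
  then have "closed_rays (\<Union>((\<lambda>\<xi>. {\<xi>}) ` C))" using assms by (intro closed_rays_Union) auto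
  then show ?thesis by simp
qed

text \<open>A cylinder inside \<open>C\<close> would be covered by singletons, one of which would
  then contain a cylinder.\<close>

lemma not_contains_cyl_finite:
  assumes "finite C" "C \<subseteq> bd" shows "\<not> contains_cyl C"
proof
  assume "contains_cyl C"
  then obtain v where v: "v \<in> V" "cyl v \<subseteq> C" by (auto simp: contains_cyl_def)
  have "\<exists>D\<in>(\<lambda>\<xi>. {\<xi>}) ` C. contains_cyl D"
    by (rule finite_closed_cover_contains_cyl[of _ v])
      (use assms v in \<open>auto intro: closed_rays_finite\<close>)
  then show False using cyl_not_singleton by (auto simp: contains_cyl_def)
qed

end

section \<open>Branch groups: finite index and closed sets of rays\<close>

locale branch = regular_tree T for T :: "'v rooted_graph" +
  fixes G :: "('v \<Rightarrow> 'v) set"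
  assumes branch: "branch_group T G"
begin

lemma subgroup_G: "subgroup G (aut_group T)"
  using branch by (simp add: branch_group_def)

lemma G_Aut: "g \<in> G \<Longrightarrow> g \<in> Aut"
  using subgroup_G subgroup.mem_carrier by metis

lemma G_subset_Aut: "G \<subseteq> Aut"
  using G_Aut by blast

lemma G_closed:
  shows "g \<in> G \<Longrightarrow> h \<in> G \<Longrightarrow> g \<otimes>\<^bsub>aut_group T\<^esub> h \<in> G"
    and "g \<in> G \<Longrightarrow> inv\<^bsub>aut_group T\<^esub> g \<in> G"
    and "\<one>\<^bsub>aut_group T\<^esub> \<in> G"
  using subgroup_G by (auto simp: subgroup.m_closed subgroup.m_inv_closed subgroup.one_closed)

lemma G_transitive:
  assumes "u \<in> V" "v \<in> V" "lv u = lv v" obtains g where "g \<in> G" "g u = v"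
proof -
  have "u \<in> level T (lv v)" "v \<in> level T (lv v)" using assms by (auto simp: level_def)
  then show thesis using branch that unfolding branch_group_def by blast
qed

text \<open>By level transitivity the union of the translates meets every cylinder; being a finite
  union of closed sets, it is the whole boundary. One translate then contains a cylinder, which is
  carried back to \<open>C\<close>.\<close>

lemma translates_contains_cyl:
  assumes C: "closed_rays C" "C \<noteq> {}" and fin: "finite ((\<lambda>g. ray_image g ` C) ` G)"
  shows "contains_cyl C"
proof -
  let ?D = "(\<lambda>g. ray_image g ` C) ` G"
  have cl: "closed_rays D" if "D \<in> ?D" for D
    using that C G_Aut by (auto intro: closed_rays_image)
  obtain \<zeta> where \<zeta>: "\<zeta> \<in> C" using C by blast
  have \<zeta>b: "\<zeta> \<in> bd" using \<zeta> closed_rays_subset[OF C(1)] by blast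
  have "bd \<subseteq> \<Union>?D"
  proof
    fix \<xi> assume \<xi>: "\<xi> \<in> bd"
    show "\<xi> \<in> \<Union>?D"
    proof (rule closed_raysD[OF closed_rays_Union[OF fin cl] \<xi>])
      fix n
      obtain g where g: "g \<in> G" "g (\<zeta> n) = \<xi> n"
        using G_transitive[of "\<zeta> n" "\<xi> n"] \<xi> \<zeta>b by (metis ray_in_V ray_level)
      then show "\<exists>\<eta>\<in>\<Union>?D. \<eta> n = \<xi> n"
        using \<zeta> by (intro bexI[of _ "ray_image g \<zeta>"]) (auto simp: ray_image_apply)
    qed
  qed
  then have "\<exists>D\<in>?D. contains_cyl D"
    using finite_closed_cover_contains_cyl[OF fin cl root_in_V] by (simp add: cyl_root)
  then show ?thesis
    using contains_cyl_image G_Aut closed_rays_subset[OF C(1)] by blast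
qed

lemma rist_subset: "rist T G v \<subseteq> G"
  by (auto simp: rist_def)

lemma rist_fixes_outside: "g \<in> rist T G v \<Longrightarrow> u \<in> V \<Longrightarrow> u \<notin> descendants T v \<Longrightarrow> g u = u"
  by (simp add: rist_def)

text \<open>On the level of \<open>v\<close> only \<open>v\<close> itself needs care: if
  \<open>g v\<close> were outside the subtree of \<open>v\<close>, then \<open>g\<close> would fix
  \<open>g v\<close>, and injectivity gives \<open>g v = v\<close>.\<close>

lemma rist_fixes_level:
  assumes g: "g \<in> rist T G v" and u: "u \<in> V" "lv u \<le> lv v" shows "g u = u"
proof (cases "u \<in> descendants T v")
  case True
  then have "lv u = lv v" using u by (auto simp: descendants_iff)
  then have uv: "u = v" using descendants_same_level True by blast
  have gA: "g \<in> Aut" using g rist_subset G_Aut by blast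
  show ?thesis
  proof (cases "g v \<in> descendants T v")
    case True
    then show ?thesis
      using descendants_same_level[OF True] aut_level[OF gA, of v] u uv by simp
  next
    case False
    then have "g (g v) = g v" using rist_fixes_outside[OF g] aut_in_V[OF gA, of v] u uv by simp
    then show ?thesis using aut_inj[OF gA, of "g v" v] aut_in_V[OF gA, of v] u uv by simp
  qed
qed (use assms rist_fixes_outside in blast)

text \<open>Up to the level of \<open>v\<close> every vertex is fixed, and beyond it the ray stays
  outside the subtree of \<open>v\<close>.\<close>

lemma rist_fixes_ray:
  assumes g: "g \<in> rist T G v" and \<xi>: "\<xi> \<in> bd" "\<xi> (lv v) \<noteq> v"
  shows "ray_image g \<xi> = \<xi>"
proof
  fix n
  have "\<xi> n \<notin> descendants T v" if "n > lv v"
    using \<xi> that by (simp add: descendants_iff ray_nth)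
  then show "ray_image g \<xi> n = \<xi> n"
    using rist_fixes_level[OF g, of "\<xi> n"] rist_fixes_outside[OF g, of "\<xi> n"] \<xi>(1)
    by (cases "n > lv v") (simp_all add: ray_image_apply ray_in_V ray_level)
qed

lemma rist_level_subset: "rist_level T G n \<subseteq> G"
  unfolding rist_level_def
  by (rule aut.generate_subgroup_incl[OF _ subgroup_G]) (use rist_subset in blast)

lemma rist_level_fixes:
  assumes "h \<in> rist_level T G n" "u \<in> V" "lv u \<le> n" shows "h u = u"
  using assms(1) unfolding rist_level_def
proof (induction rule: generate.induct)
  case one
  then show ?case using assms by (simp add: one_apply)
next
  case (incl h)
  then show ?case using rist_fixes_level assms(2,3) by (auto simp: level_def)
next
  case (inv h)
  then have "h u = u" "h \<in> Aut" using rist_fixes_level assms(2,3) rist_subset G_Aut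
    unfolding level_def by blast+
  then show ?case using inv_apply(1)[of h u] assms(2) by simp
next
  case (eng h1 h2)
  then have "h1 \<in> Aut" "h2 \<in> Aut" using rist_level_subset G_Aut unfolding rist_level_def by blast+
  then show ?case using eng assms(2) by (simp add: mult_apply)
qed

lemma finite_rcosets: "finite (rcosets\<^bsub>subgroup_struct T G\<^esub> (rist_level T G n))"
  using branch by (simp add: branch_group_def)

text \<open>Rigid stabilizers of other vertices of the level fix every ray of \<open>D\<close>,
  because these rays pass through \<open>v\<close>.\<close>

lemma rist_level_preserves:
  assumes v: "v \<in> V" and D: "D \<subseteq> cyl v" and inv: "\<And>g. g \<in> rist T G v \<Longrightarrow> ray_image g ` D = D"
    and h: "h \<in> rist_level T G (lv v)"
  shows "ray_image h ` D = D"
proof -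
  have Db: "D \<subseteq> bd" using D by (auto simp: cyl_def)
  have *: "ray_image h ` D = D \<and> h \<in> Aut" if h: "h \<in> (\<Union>u\<in>level T (lv v). rist T G u)" for h
  proof -
    obtain u where u: "u \<in> V" "lv u = lv v" "h \<in> rist T G u" using h by (auto simp: level_def)
    have "ray_image h ` D = D"
    proof (cases "u = v")
      case False
      have "ray_image h \<xi> = \<xi>" if "\<xi> \<in> D" for \<xi>
        by (rule rist_fixes_ray[OF u(3)]) (use that D u(2) False in \<open>auto simp: cyl_def\<close>)
      then show ?thesis by simp
    qed (use u inv in blast)
    then show ?thesis using u(3) rist_subset G_Aut by blast
  qed
  show ?thesis using h unfolding rist_level_def
  proof (induction rule: generate.induct)
    case one
    then show ?case using Db by (rule image_ray_image_one)
  next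
    case (incl h)
    then show ?case using * by blast
  next
    case (inv h)
    then show ?case using *[OF inv] image_ray_image_inv(1)[of h D] Db by simp
  next
    case (eng h1 h2)
    then have "h1 \<in> Aut" "h2 \<in> Aut" using rist_level_subset G_Aut unfolding rist_level_def by blast+
    then show ?case using eng by (simp add: image_ray_image_mult Db)
  qed
qed

text \<open>The translate depends only on the coset of \<open>g\<close>, and
  \<open>rist_level T G n\<close> has finite index.\<close>

lemma finite_translates:
  assumes D: "D \<subseteq> bd" and inv: "\<And>h. h \<in> rist_level T G n \<Longrightarrow> ray_image h ` D = D"
  shows "finite ((\<lambda>g. ray_image g ` D) ` G)"
proof -
  let ?H = "rist_level T G n"
  let ?A = "aut_group T"
  define F where "F = (\<lambda>K. ray_image (m_inv ?A (SOME x. x \<in> K)) ` D)"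
  have "ray_image g ` D \<in> F ` (rcosets\<^bsub>subgroup_struct T G\<^esub> ?H)" if g: "g \<in> G" for g
  proof -
    \<comment> \<open>\<open>rcosets\<close> consists of right cosets while translates are constant
      on left cosets; passing to inverses exchanges the two.\<close>
    define a where "a = inv\<^bsub>?A\<^esub> g"
    define K where "K = r_coset (subgroup_struct T G) ?H a"
    have aG: "a \<in> G" unfolding a_def using g G_closed by blast
    then have KR: "K \<in> rcosets\<^bsub>subgroup_struct T G\<^esub> ?H" by (auto simp: K_def RCOSETS_def)
    have "\<one>\<^bsub>?A\<^esub> \<in> ?H" unfolding rist_level_def by (rule generate.one)
    then have "\<exists>x. x \<in> K" by (auto simp: K_def r_coset_def)
    then have "(SOME x. x \<in> K) \<in> K" by (rule someI_ex)
    then obtain h where h: "h \<in> ?H" "(SOME x. x \<in> K) = h \<otimes>\<^bsub>?A\<^esub> a"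
      by (auto simp: K_def r_coset_def)
    have A: "g \<in> Aut" "h \<in> Aut" "a \<in> Aut" using g aG h(1) rist_level_subset G_Aut by blast+
    then have "F K = ray_image (g \<otimes>\<^bsub>?A\<^esub> inv\<^bsub>?A\<^esub> h) ` D"
      by (simp add: F_def h(2) a_def aut.inv_mult_group)
    also have "\<dots> = ray_image g ` ray_image (inv\<^bsub>?A\<^esub> h) ` D"
      using A D by (simp add: image_ray_image_mult)
    also have "ray_image (inv\<^bsub>?A\<^esub> h) ` D = D"
      using image_ray_image_inv(1)[OF A(2) D] inv[OF h(1)] by simp
    finally show ?thesis using KR by blast
  qed
  then have "(\<lambda>g. ray_image g ` D) ` G \<subseteq> F ` (rcosets\<^bsub>subgroup_struct T G\<^esub> ?H)" by blast
  then show ?thesis using finite_rcosets finite_surj by blast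
qed

text \<open>\<open>D\<close> is stable under a subgroup of finite index, so it has finitely many
  translates under \<open>G\<close>.\<close>

lemma rist_invariant_contains_cyl:
  assumes v: "v \<in> V" and D: "D \<subseteq> cyl v" "closed_rays D" "D \<noteq> {}"
    and inv: "\<And>g. g \<in> rist T G v \<Longrightarrow> ray_image g ` D = D"
  shows "contains_cyl D"
proof (rule translates_contains_cyl[OF D(2,3)])
  show "finite ((\<lambda>g. ray_image g ` D) ` G)"
    by (rule finite_translates[of D "lv v"])
      (use rist_level_preserves[OF v D(1) inv] closed_rays_subset[OF D(2)] in auto)
qed

text \<open>Otherwise a single ray through \<open>v\<close> would be an invariant closed set and
  would contain a cylinder.\<close>

lemma rist_nontrivial:
  assumes v: "v \<in> V" shows "\<exists>g\<in>rist T G v. \<exists>u\<in>V. g u \<noteq> u"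
proof (rule ccontr)
  assume "\<not> ?thesis"
  then have *: "g u = u" if "g \<in> rist T G v" "u \<in> V" for g u using that by blast
  obtain \<xi> where \<xi>: "\<xi> \<in> cyl v" using cyl_nonempty[OF v] by blast
  then have \<xi>b: "\<xi> \<in> bd" by (simp add: cyl_def)
  have "contains_cyl {\<xi>}"
  proof (rule rist_invariant_contains_cyl[OF v])
    show "ray_image g ` {\<xi>} = {\<xi>}" if "g \<in> rist T G v" for g
      using *[OF that] ray_in_V[OF \<xi>b] by (auto simp: ray_image_apply)
  qed (use \<xi> \<xi>b closed_rays_finite in auto)
  then show False using not_contains_cyl_finite[of "{\<xi>}"] \<xi>b by simp
qed

text \<open>The working form of the definition. The empty set is excluded because it is open; for a
  nonempty closed set with minimal action, being open is the same as containing a cylinder.\<close>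

lemma gen_parabolic_set_iff:
  "gen_parabolic_set T G C \<longleftrightarrow>
    closed_rays C \<and> C \<noteq> {} \<and> \<not> contains_cyl C \<and>
    (\<forall>\<xi>\<in>C. \<forall>\<eta>\<in>C. \<forall>n. \<exists>h\<in>sstab G C. h (\<xi> n) = \<eta> n)"
proof (cases "closed_rays C")
  case True
  then have C: "C \<subseteq> bd" by (rule closed_rays_subset)
  have "openin (boundary_topology T) C \<Longrightarrow> C \<noteq> {} \<Longrightarrow> contains_cyl C"
    using C ray_in_V unfolding openin_boundary_iff contains_cyl_def by (metis ex_in_conv subsetD)
  then show ?thesis
    using True openin_if_contains_cyl[OF C G_subset_Aut _ _ cyl_nonempty]
    unfolding gen_parabolic_set_def closedin_boundary_iff minimal_sstab_iff[OF C] by auto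
qed (simp add: gen_parabolic_set_def closedin_boundary_iff)

text \<open>The right-hand side involves \<open>C\<close> only through its stabilizer, which gives
  \<open>sstab_inj\<close>. For \<open>\<xi>\<close> in \<open>C\<close>, a rigid stabilizer inside
  \<open>sstab G C\<close> would preserve \<open>C \<inter> cyl (\<xi> n)\<close> and force a
  cylinder into \<open>C\<close>; for \<open>\<xi>\<close> outside, some cylinder around it misses
  \<open>C\<close>, and the corresponding rigid stabilizer acts trivially on
  \<open>C\<close>.\<close>

lemma gen_parabolic_set_rist:
  assumes "gen_parabolic_set T G C"
  shows "C = {\<xi> \<in> bd. \<forall>n. \<not> rist T G (\<xi> n) \<subseteq> sstab G C}"
proof -
  have C: "closed_rays C" "C \<noteq> {}" "\<not> contains_cyl C" "C \<subseteq> bd"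
    using assms closed_rays_subset by (auto simp: gen_parabolic_set_iff)
  have "\<not> rist T G (\<xi> n) \<subseteq> sstab G C" if \<xi>: "\<xi> \<in> C" for \<xi> n
  proof
    assume R: "rist T G (\<xi> n) \<subseteq> sstab G C"
    let ?v = "\<xi> n"
    have \<xi>b: "\<xi> \<in> bd" using \<xi> C by blast
    then have v: "?v \<in> V" by (rule ray_in_V)
    have "contains_cyl (C \<inter> cyl ?v)"
    proof (rule rist_invariant_contains_cyl[OF v])
      show "C \<inter> cyl ?v \<noteq> {}" using \<xi> ray_in_cyl[OF \<xi>b] by blast
      fix g assume g: "g \<in> rist T G ?v"
      then have gA: "g \<in> Aut" using rist_subset G_Aut by blast
      have inj: "inj_on (ray_image g) bd" using ray_image_inv(1)[OF gA] by (metis inj_on_inverseI)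
      have "ray_image g ` (C \<inter> cyl ?v) = ray_image g ` C \<inter> ray_image g ` cyl ?v"
        by (rule inj_on_image_Int[OF inj C(4)]) (auto simp: cyl_def)
      also have "\<dots> = C \<inter> cyl ?v"
        using sstabD[of g] R g image_cyl[OF gA v] rist_fixes_level[OF g v] by auto
      finally show "ray_image g ` (C \<inter> cyl ?v) = C \<inter> cyl ?v" .
    qed (use closed_rays_cyl_Int C in auto)
    then show False using C(3) by (auto simp: contains_cyl_def)
  qed
  moreover have "\<exists>n. rist T G (\<xi> n) \<subseteq> sstab G C" if \<xi>: "\<xi> \<in> bd" "\<xi> \<notin> C" for \<xi>
  proof -
    obtain n where n: "cyl (\<xi> n) \<inter> C = {}" using closed_rays_separate[OF C(1) \<xi>] by metis
    have "g \<in> sstab G C" if g: "g \<in> rist T G (\<xi> n)" for g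
    proof -
      have "ray_image g \<eta> = \<eta>" if "\<eta> \<in> C" for \<eta>
        by (rule rist_fixes_ray[OF g])
          (use that C(4) n \<xi>(1) in \<open>auto simp: ray_level cyl_ray\<close>)
      then have "ray_image g ` C = C" by simp
      then show ?thesis using g rist_subset by (auto simp: sstab_def)
    qed
    then show ?thesis by blast
  qed
  ultimately show ?thesis using C(4) by blast
qed

lemma sstab_inj:
  assumes "gen_parabolic_set T G C" "gen_parabolic_set T G D" "sstab G C = sstab G D"
  shows "C = D"
  using gen_parabolic_set_rist[OF assms(1)] gen_parabolic_set_rist[OF assms(2)] assms(3) by simp

end

section \<open>Constructing automorphisms\<close>

context rtree
begin

text \<open>Levels are preserved by induction. If \<open>\<phi> w\<close> is a child of
  \<open>\<phi> u\<close>, then the parent of \<open>w\<close> has the same image as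
  \<open>u\<close>, so injectivity shows that the child relation is also reflected.\<close>

lemma autI:
  assumes ext: "\<phi> \<in> extensional V" and bij: "bij_betw \<phi> V V" and root: "\<phi> rt = rt"
    and ch: "\<And>u w. u \<in> V \<Longrightarrow> w \<in> children T u \<Longrightarrow> \<phi> w \<in> children T (\<phi> u)"
  shows "\<phi> \<in> Aut"
proof -
  have \<phi>V: "\<phi> v \<in> V" if "v \<in> V" for v using bij that by (rule bij_betw_apply)
  have lev: "lv (\<phi> v) = n" if "v \<in> V" "lv v = n" for n v
    using that
  proof (induction n arbitrary: v)
    case 0
    then show ?case using level_0[of v] root level_root root_in_V by simp
  next
    case (Suc n)
    obtain u where u: "u \<in> V" "lv u = n" "v \<in> children T u" by (rule ex_parent[OF Suc.prems])
    then show ?case using Suc.IH[of u] level_children[OF ch[of u v]] by simp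
  qed
  have conv: "w \<in> children T u" if uw: "u \<in> V" "w \<in> V" "\<phi> w \<in> children T (\<phi> u)" for u w
  proof -
    have "lv w = Suc (lv u)"
      using level_children[OF uw(3)] lev[OF uw(1) refl] lev[OF uw(2) refl] by simp
    then obtain p where p: "p \<in> V" "lv p = lv u" "w \<in> children T p" by (rule ex_parent[OF uw(2)])
    then have "\<phi> p = \<phi> u" using parent_unique[OF _ uw(3)] ch by blast
    then have "p = u" using bij p(1) uw(1) by (auto simp: bij_betw_def dest: inj_onD)
    then show ?thesis using p by simp
  qed
  have "(\<phi> u, \<phi> v) \<in> edges T \<longleftrightarrow> (u, v) \<in> edges T" if "u \<in> V" "v \<in> V" for u v
    using that ch conv unfolding edge_iff_children by blast
  then show ?thesis using ext bij root by (simp add: aut_iff Bij_def)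
qed

text \<open>\<open>\<beta> u u'\<close> prescribes what happens to the children of \<open>u\<close>
  once \<open>u\<close> is sent to \<open>u'\<close>; the automorphism is built level by level from
  the root. Injectivity and surjectivity follow by induction on the level.\<close>

lemma ex_aut_from_children_bijections:
  assumes \<beta>: "\<And>u u'. u \<in> V \<Longrightarrow> u' \<in> V \<Longrightarrow> lv u = lv u' \<Longrightarrow>
    bij_betw (\<beta> u u') (children T u) (children T u')"
  shows "\<exists>\<phi>\<in>Aut. \<forall>u\<in>V. \<forall>w\<in>children T u. \<phi> w = \<beta> u (\<phi> u) w"
proof -
  \<comment> \<open>\<open>F n\<close> is meaningful on level \<open>n\<close> only. For
    \<open>v\<close> on level \<open>Suc n\<close>, the entry \<open>rp v ! n\<close> is the parent
    of \<open>v\<close>.\<close>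
  define F where "F = rec_nat (\<lambda>v. rt) (\<lambda>n f v. \<beta> (rp v ! n) (f (rp v ! n)) v)"
  have F: "F 0 v = rt" "F (Suc n) v = \<beta> (rp v ! n) (F n (rp v ! n)) v" for n v
    by (simp_all add: F_def)
  define \<phi> where "\<phi> = restrict (\<lambda>v. F (lv v) v) V"
  have root: "\<phi> rt = rt" by (simp add: \<phi>_def root_in_V level_root F)
  have step: "\<phi> w = \<beta> u (\<phi> u) w" if "u \<in> V" "w \<in> children T u" for u w
  proof -
    have "rp w ! lv u = u" "w \<in> V" "lv w = Suc (lv u)"
      using that children_descendants[OF that(2,1)] level_children[OF that(2)]
      by (auto simp: descendants_iff)
    then show ?thesis using that(1) by (simp add: \<phi>_def F)
  qed
  have A: "\<phi> v \<in> V \<and> lv (\<phi> v) = n" if "v \<in> V" "lv v = n" for n v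
    using that
  proof (induction n arbitrary: v)
    case 0
    then show ?case using level_0[of v] root level_root root_in_V by simp
  next
    case (Suc n)
    obtain u where u: "u \<in> V" "lv u = n" "v \<in> children T u" by (rule ex_parent[OF Suc.prems])
    then have "\<phi> v \<in> children T (\<phi> u)"
      using Suc.IH[of u] \<beta>[of u "\<phi> u"] step[of u v] by (simp add: bij_betw_apply)
    then show ?case using children_in_V level_children Suc.IH[of u] u by simp
  qed
  have ch: "\<phi> w \<in> children T (\<phi> u)" if "u \<in> V" "w \<in> children T u" for u w
    using A[of u] \<beta>[of u "\<phi> u"] step[of u w] that by (simp add: bij_betw_apply)
  have inj: "v = v'" if "v \<in> V" "v' \<in> V" "lv v = n" "lv v' = n" "\<phi> v = \<phi> v'" for n v v'
    using that
  proof (induction n arbitrary: v v')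
    case 0
    then show ?case using level_0[of v] level_0[of v'] by simp
  next
    case (Suc n)
    obtain u where u: "u \<in> V" "lv u = n" "v \<in> children T u" 
      by (rule ex_parent[OF Suc.prems(1,3)])
    obtain u' where u': "u' \<in> V" "lv u' = n" "v' \<in> children T u'"
      by (rule ex_parent[OF Suc.prems(2,4)])
    have "\<phi> u = \<phi> u'" using ch[OF u(1,3)] ch[OF u'(1,3)] Suc.prems(5) parent_unique by simp
    then have "u = u'" using Suc.IH u u' by blast
    moreover have "inj_on (\<beta> u (\<phi> u)) (children T u)"
      using \<beta>[of u "\<phi> u"] A[of u] u by (auto simp: bij_betw_def)
    ultimately show ?case
      using step[OF u(1,3)] step[OF u'(1,3)] u(3) u'(3) Suc.prems(5) by (auto dest: inj_onD)
  qed
  have surj: "\<exists>v\<in>V. \<phi> v = w" if "w \<in> V" "lv w = n" for n w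
    using that
  proof (induction n arbitrary: w)
    case 0
    then show ?case using level_0[of w] root root_in_V by auto
  next
    case (Suc n)
    obtain p where p: "p \<in> V" "lv p = n" "w \<in> children T p" by (rule ex_parent[OF Suc.prems])
    then obtain u where u: "u \<in> V" "\<phi> u = p" using Suc.IH by blast
    then have "\<beta> u p ` children T u = children T p"
      using \<beta>[of u p] A[of u] p by (auto simp: bij_betw_def)
    then have "w \<in> \<beta> u p ` children T u" using p(3) by simp
    then obtain v where "v \<in> children T u" "\<beta> u p v = w" by blast
    then show ?case using step[of u v] u children_in_V by auto
  qed
  have "\<phi> \<in> Aut"
  proof (rule autI)
    show "bij_betw \<phi> V V" unfolding bij_betw_def
    proof
      show "inj_on \<phi> V" by (rule inj_onI) (metis inj A)
      show "\<phi> ` V = V" using A surj by blast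
    qed
  qed (use root ch in \<open>auto simp: \<phi>_def\<close>)
  then show ?thesis using step by blast
qed

section \<open>Subtrees spanned by closed sets of rays\<close>

definition tree_of :: "(nat \<Rightarrow> 'v) set \<Rightarrow> 'v set" where
  "tree_of C = {v. \<exists>\<xi>\<in>C. \<exists>n. \<xi> n = v}"

lemma tree_of_iff: "C \<subseteq> bd \<Longrightarrow> v \<in> tree_of C \<longleftrightarrow> (\<exists>\<xi>\<in>C. \<xi> (lv v) = v)"
  by (auto simp: tree_of_def ray_level subset_iff)

lemma tree_of_ray: "\<xi> \<in> C \<Longrightarrow> \<xi> n \<in> tree_of C"
  by (auto simp: tree_of_def)

lemma in_closed_rays_iff:
  assumes "closed_rays C" "\<xi> \<in> bd" shows "\<xi> \<in> C \<longleftrightarrow> (\<forall>n. \<xi> n \<in> tree_of C)"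
proof
  assume *: "\<forall>n. \<xi> n \<in> tree_of C"
  show "\<xi> \<in> C"
    by (rule closed_raysD[OF assms])
      (use * assms(2) in \<open>simp add: tree_of_iff[OF closed_rays_subset[OF assms(1)]] ray_level\<close>)
qed (auto simp: tree_of_def)

lemma tree_of_parent:
  assumes "C \<subseteq> bd" "w \<in> children T u" "w \<in> tree_of C" shows "u \<in> tree_of C"
proof -
  obtain \<xi> where \<xi>: "\<xi> \<in> C" "\<xi> (lv w) = w" using assms by (auto simp: tree_of_iff)
  then have "w \<in> children T (\<xi> (lv u))"
    using ray_child[of \<xi> "lv u"] assms level_children[OF assms(2)] by auto
  then have "\<xi> (lv u) = u" using parent_unique assms(2) by blast
  then show ?thesis using \<xi>(1) by (metis tree_of_ray)
qed

lemma tree_of_inj: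
  assumes "closed_rays C" "closed_rays D" "tree_of C = tree_of D" shows "C = D"
proof -
  have "\<xi> \<in> C \<longleftrightarrow> \<xi> \<in> D" if "\<xi> \<in> bd" for \<xi>
    using in_closed_rays_iff[OF assms(1) that] in_closed_rays_iff[OF assms(2) that] assms(3) by simp
  then show ?thesis using closed_rays_subset assms(1,2) by blast
qed

text \<open>This makes the number of vertices on each level an invariant of
  tree-equivalence.\<close>

lemma card_level_image:
  assumes "\<phi> \<in> Aut" "C \<subseteq> bd"
  shows "card ((\<lambda>\<xi>. \<xi> n) ` ray_image \<phi> ` C) = card ((\<lambda>\<xi>. \<xi> n) ` C)"
proof -
  have "(\<lambda>\<xi>. \<xi> n) ` ray_image \<phi> ` C = \<phi> ` (\<lambda>\<xi>. \<xi> n) ` C"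
    by (simp add: image_image ray_image_apply)
  moreover have "inj_on \<phi> ((\<lambda>\<xi>. \<xi> n) ` C)"
    by (rule inj_onI) (auto simp: aut_inj[OF assms(1)] ray_in_V subsetD[OF assms(2)])
  ultimately show ?thesis by (simp add: card_image)
qed

lemma inj_on_ray_image: "g \<in> Aut \<Longrightarrow> inj_on (ray_image g) bd"
  using ray_image_inv(1) by (metis inj_on_inverseI)

end

text \<open>Glue a bijection of \<open>S\<close> with \<open>S'\<close> and one of the
  complements.\<close>

lemma ex_bij_betw_subset:
  assumes "finite A" "finite B" "card A = card B" "S \<subseteq> A" "S' \<subseteq> B" "card S = card S'"
  shows "\<exists>f. bij_betw f A B \<and> (\<forall>x\<in>A. f x \<in> S' \<longleftrightarrow> x \<in> S)"
proof -
  have fin: "finite S" "finite S'" using assms finite_subset by blast+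
  obtain f where f: "bij_betw f S S'" using finite_same_card_bij[OF fin assms(6)] by blast
  have "card (A - S) = card (B - S')" using assms fin by (simp add: card_Diff_subset)
  then obtain g where g: "bij_betw g (A - S) (B - S')"
    using finite_same_card_bij[of "A - S" "B - S'"] assms(1,2) by auto
  define h where "h x = (if x \<in> S then f x else g x)" for x
  have "bij_betw h S S'" using f by (rule bij_betw_cong[THEN iffD1, rotated]) (simp add: h_def)
  moreover have "bij_betw h (A - S) (B - S')"
    using g by (rule bij_betw_cong[THEN iffD1, rotated]) (simp add: h_def)
  ultimately have "bij_betw h (S \<union> (A - S)) (S' \<union> (B - S'))"
    by (rule bij_betw_combine) auto
  moreover have "h x \<in> S' \<longleftrightarrow> x \<in> S" if "x \<in> A" for x
    using that bij_betw_apply[OF f, of x] bij_betw_apply[OF g, of x] by (auto simp: h_def)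
  ultimately show ?thesis using assms(4,5) by (intro exI[of _ h]) (simp add: Un_absorb1)
qed

context regular_tree
begin

text \<open>The hypothesis compares all vertices of a level, so in both subtrees the number of
  children depends on the level only. Bijections of children that respect the subtrees therefore
  exist, and the automorphism assembled from them maps one subtree onto the other.\<close>

lemma ex_aut_closed_rays:
  assumes fin: "\<And>v. v \<in> V \<Longrightarrow> finite (children T v)"
    and C: "closed_rays C" "C \<noteq> {}" and D: "closed_rays D" "D \<noteq> {}"
    and card: "\<And>u u'. u \<in> tree_of C \<Longrightarrow> u' \<in> tree_of D \<Longrightarrow> lv u = lv u' \<Longrightarrow>
      card (children T u \<inter> tree_of C) = card (children T u' \<inter> tree_of D)"
  shows "\<exists>\<phi>\<in>Aut. ray_image \<phi> ` C = D"
proof -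
  have sub: "C \<subseteq> bd" "D \<subseteq> bd" using C D closed_rays_subset by auto
  have "\<exists>f. bij_betw f (children T u) (children T u') \<and>
      (u \<in> tree_of C \<longrightarrow> u' \<in> tree_of D \<longrightarrow>
        (\<forall>x\<in>children T u. f x \<in> tree_of D \<longleftrightarrow> x \<in> tree_of C))"
    if u: "u \<in> V" "u' \<in> V" "lv u = lv u'" for u u'
  proof -
    have "children T u \<approx> children T u'"
      using regular u by (auto simp: spherically_regular_tree_def)
    then have eq: "card (children T u) = card (children T u')"
      using fin u by (simp add: eqpoll_iff_card)
    show ?thesis
    proof (cases "u \<in> tree_of C \<and> u' \<in> tree_of D")
      case True
      then have "card (children T u \<inter> tree_of C) = card (children T u' \<inter> tree_of D)"
        using card u by blast
      from ex_bij_betw_subset[OF fin[OF u(1)] fin[OF u(2)] eq _ _ this]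
      obtain f where "bij_betw f (children T u) (children T u')"
        "\<forall>x\<in>children T u. f x \<in> children T u' \<inter> tree_of D \<longleftrightarrow> x \<in> children T u \<inter> tree_of C"
        by auto
      then show ?thesis by (metis IntD2 IntI bij_betw_apply)
    next
      case False
      \<comment> \<open>When \<open>u\<close> or \<open>u'\<close> is off its subtree, nothing is
        asked beyond bijectivity, which spherical regularity provides.\<close>
      then show ?thesis using finite_same_card_bij[OF fin[OF u(1)] fin[OF u(2)] eq] by blast
    qed
  qed
  then obtain \<beta> where \<beta>: "\<And>u u'. u \<in> V \<Longrightarrow> u' \<in> V \<Longrightarrow> lv u = lv u' \<Longrightarrow>
      bij_betw (\<beta> u u') (children T u) (children T u') \<and>
      (u \<in> tree_of C \<longrightarrow> u' \<in> tree_of D \<longrightarrow>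
        (\<forall>x\<in>children T u. \<beta> u u' x \<in> tree_of D \<longleftrightarrow> x \<in> tree_of C))"
    by metis
  have "\<exists>\<phi>\<in>Aut. \<forall>u\<in>V. \<forall>w\<in>children T u. \<phi> w = \<beta> u (\<phi> u) w"
    by (rule ex_aut_from_children_bijections) (use \<beta> in blast)
  then obtain \<phi> where \<phi>: "\<phi> \<in> Aut" "\<And>u w. u \<in> V \<Longrightarrow> w \<in> children T u \<Longrightarrow> \<phi> w = \<beta> u (\<phi> u) w"
    by blast
  have tr: "\<phi> v \<in> tree_of D \<longleftrightarrow> v \<in> tree_of C" if "v \<in> V" "lv v = n" for n v
    using that
  proof (induction n arbitrary: v)
    case 0
    then have "v = rt" using level_0 by simp
    moreover have "rt \<in> tree_of E" if E: "E \<subseteq> bd" "E \<noteq> {}" for E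
    proof -
      obtain \<xi> where "\<xi> \<in> E" using E(2) by blast
      then show ?thesis using tree_of_ray[of \<xi> E 0] ray_0[of \<xi>] E(1) by auto
    qed
    ultimately show ?case using aut_root[OF \<phi>(1)] C(2) D(2) sub by simp
  next
    case (Suc n)
    obtain u where u: "u \<in> V" "lv u = n" "v \<in> children T u" by (rule ex_parent[OF Suc.prems])
    have \<phi>u: "\<phi> u \<in> V" "lv u = lv (\<phi> u)" using aut_in_V aut_level \<phi>(1) u(1) by auto
    have \<phi>v: "\<phi> v \<in> children T (\<phi> u)" using aut_children \<phi>(1) u by blast
    show ?case
    proof (cases "u \<in> tree_of C")
      case True
      then have "\<phi> u \<in> tree_of D" using Suc.IH u by blast
      then show ?thesis using \<beta>[OF u(1) \<phi>u] True u(1,3) \<phi>(2) by simp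
    next
      case False
      then have "\<phi> u \<notin> tree_of D" using Suc.IH u by blast
      then show ?thesis using False tree_of_parent u(3) \<phi>v sub by blast
    qed
  qed
  have iff: "ray_image \<phi> \<xi> \<in> D \<longleftrightarrow> \<xi> \<in> C" if "\<xi> \<in> bd" for \<xi>
    using that tr ray_image_in_boundary[OF \<phi>(1) that]
    by (simp add: in_closed_rays_iff[OF C(1)] in_closed_rays_iff[OF D(1)] ray_image_apply ray_in_V)
  have "ray_image \<phi> ` C = D"
  proof
    show "ray_image \<phi> ` C \<subseteq> D" using iff sub by blast
    show "D \<subseteq> ray_image \<phi> ` C"
    proof
      fix \<eta> assume \<eta>: "\<eta> \<in> D"
      let ?\<xi> = "ray_image (inv\<^bsub>aut_group T\<^esub> \<phi>) \<eta>"
      have "?\<xi> \<in> bd" "ray_image \<phi> ?\<xi> = \<eta>"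
        using \<eta> sub \<phi>(1) ray_image_in_boundary ray_image_inv(2) by auto
      then show "\<eta> \<in> ray_image \<phi> ` C" using iff[of ?\<xi>] \<eta> by force
    qed
  qed
  then show ?thesis using \<phi>(1) by blast
qed

end

section \<open>Closures of orbits\<close>

context rtree
begin

text \<open>For a group \<open>H\<close> of automorphisms this is the closure of the orbit of
  \<open>\<xi>\<close>; the element \<open>h\<close> may change with \<open>n\<close>.\<close>

definition orbit_closure :: "('v \<Rightarrow> 'v) set \<Rightarrow> (nat \<Rightarrow> 'v) \<Rightarrow> (nat \<Rightarrow> 'v) set" where
  "orbit_closure H \<xi> = {\<eta> \<in> bd. \<forall>n. \<exists>h\<in>H. h (\<xi> n) = \<eta> n}"

text \<open>A local form of freeness: for a group \<open>H\<close>, orbits do not branch any further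
  below \<open>v\<close>.\<close>

definition stab_trivial_below :: "('v \<Rightarrow> 'v) set \<Rightarrow> 'v \<Rightarrow> bool" where
  "stab_trivial_below H v \<longleftrightarrow> (\<forall>h\<in>H. h v = v \<longrightarrow> (\<forall>u\<in>descendants T v. h u = u))"

lemma subgroup_Aut: "subgroup H (aut_group T) \<Longrightarrow> h \<in> H \<Longrightarrow> h \<in> Aut"
  by (rule subgroup.mem_carrier)

lemma orbit_closure_subset: "orbit_closure H \<xi> \<subseteq> bd"
  by (auto simp: orbit_closure_def)

lemma orbit_closureD: "\<eta> \<in> orbit_closure H \<xi> \<Longrightarrow> \<exists>h\<in>H. h (\<xi> n) = \<eta> n"
  unfolding orbit_closure_def by blast

lemma closed_orbit_closure: "closed_rays (orbit_closure H \<xi>)"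
  unfolding closed_rays_def
proof (intro conjI ballI impI)
  fix \<eta> assume \<eta>: "\<eta> \<in> bd" "\<forall>n. \<exists>\<zeta>\<in>orbit_closure H \<xi>. \<zeta> n = \<eta> n"
  have "\<exists>h\<in>H. h (\<xi> n) = \<eta> n" for n
  proof -
    obtain \<zeta> where \<zeta>: "\<zeta> \<in> orbit_closure H \<xi>" "\<zeta> n = \<eta> n" using \<eta>(2) by blast
    then show ?thesis using orbit_closureD[OF \<zeta>(1), of n] by simp
  qed
  then show "\<eta> \<in> orbit_closure H \<xi>" using \<eta>(1) by (simp add: orbit_closure_def)
qed (rule orbit_closure_subset)

context
  fixes H \<xi>
  assumes H: "subgroup H (aut_group T)" and \<xi>: "\<xi> \<in> bd"
begin

lemma ray_image_in_orbit_closure: "h \<in> H \<Longrightarrow> ray_image h \<xi> \<in> orbit_closure H \<xi>"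
  using subgroup_Aut[OF H] \<xi> by (auto simp: orbit_closure_def ray_image_in_boundary ray_image_apply)

lemma base_in_orbit_closure: "\<xi> \<in> orbit_closure H \<xi>"
  using ray_image_in_orbit_closure[OF subgroup.one_closed[OF H]] \<xi> by (simp add: ray_image_one)

text \<open>Passing to the closure adds no vertices to the orbit.\<close>

lemma level_orbit_closure: "(\<lambda>\<eta>. \<eta> n) ` orbit_closure H \<xi> = (\<lambda>h. h (\<xi> n)) ` H"
proof
  show "(\<lambda>\<eta>. \<eta> n) ` orbit_closure H \<xi> \<subseteq> (\<lambda>h. h (\<xi> n)) ` H"
  proof
    fix v assume "v \<in> (\<lambda>\<eta>. \<eta> n) ` orbit_closure H \<xi>"
    then obtain \<eta> where "\<eta> \<in> orbit_closure H \<xi>" "v = \<eta> n" by blast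
    then obtain h where "h \<in> H" "h (\<xi> n) = v" unfolding orbit_closure_def by blast
    then show "v \<in> (\<lambda>h. h (\<xi> n)) ` H" by blast
  qed
  show "(\<lambda>h. h (\<xi> n)) ` H \<subseteq> (\<lambda>\<eta>. \<eta> n) ` orbit_closure H \<xi>"
  proof
    fix v assume "v \<in> (\<lambda>h. h (\<xi> n)) ` H"
    then obtain h where "h \<in> H" "v = h (\<xi> n)" by blast
    then show "v \<in> (\<lambda>\<eta>. \<eta> n) ` orbit_closure H \<xi>"
      using ray_image_in_orbit_closure[of h] ray_image_apply[of h \<xi> n]
      by (intro image_eqI[of _ _ "ray_image h \<xi>"]) simp_all
  qed
qed

lemma image_orbit_closure:
  assumes g: "g \<in> H" shows "ray_image g ` orbit_closure H \<xi> = orbit_closure H \<xi>"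
proof -
  have *: "ray_image g ` orbit_closure H \<xi> \<subseteq> orbit_closure H \<xi>" if g: "g \<in> H" for g
  proof
    fix \<zeta> assume "\<zeta> \<in> ray_image g ` orbit_closure H \<xi>"
    then obtain \<eta> where \<eta>: "\<eta> \<in> orbit_closure H \<xi>" "\<zeta> = ray_image g \<eta>" by blast
    have gA: "g \<in> Aut" using subgroup_Aut[OF H g] .
    have "\<exists>h\<in>H. h (\<xi> n) = \<zeta> n" for n
    proof -
      obtain h where h: "h \<in> H" "h (\<xi> n) = \<eta> n" using orbit_closureD[OF \<eta>(1)] by blast
      then have "(g \<otimes>\<^bsub>aut_group T\<^esub> h) (\<xi> n) = \<zeta> n"
        using \<eta>(2) mult_apply[OF gA subgroup_Aut[OF H h(1)] ray_in_V[OF \<xi>]]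
        by (simp add: ray_image_apply)
      then show ?thesis using subgroup.m_closed[OF H g h(1)] by blast
    qed
    moreover have "\<zeta> \<in> bd"
      using \<eta> ray_image_in_boundary[OF gA] orbit_closure_subset by auto
    ultimately show "\<zeta> \<in> orbit_closure H \<xi>" by (simp add: orbit_closure_def)
  qed
  have "ray_image g ` ray_image (inv\<^bsub>aut_group T\<^esub> g) ` orbit_closure H \<xi> \<subseteq> ray_image g ` orbit_closure H \<xi>"
    by (rule image_mono) (rule *[OF subgroup.m_inv_closed[OF H g]])
  then have "orbit_closure H \<xi> \<subseteq> ray_image g ` orbit_closure H \<xi>"
    by (simp add: image_ray_image_inv(2)[OF subgroup_Aut[OF H g] orbit_closure_subset])
  with *[OF g] show ?thesis by blast
qed

text \<open>Both vertices are in the orbit of \<open>\<xi> n\<close>. This is minimality in the form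
  of \<open>minimal_action_iff\<close>.\<close>

lemma orbit_closure_transitive:
  assumes "\<eta> \<in> orbit_closure H \<xi>" "\<zeta> \<in> orbit_closure H \<xi>"
  shows "\<exists>h\<in>H. h (\<eta> n) = \<zeta> n"
proof -
  obtain h k where hk: "h \<in> H" "h (\<xi> n) = \<eta> n" "k \<in> H" "k (\<xi> n) = \<zeta> n"
    using assms[THEN orbit_closureD, of n] by blast
  let ?i = "inv\<^bsub>aut_group T\<^esub> h"
  have A: "h \<in> Aut" "k \<in> Aut" using hk subgroup_Aut[OF H] by auto
  have v: "\<xi> n \<in> V" using ray_in_V[OF \<xi>] .
  have "k \<otimes>\<^bsub>aut_group T\<^esub> ?i \<in> H"
    by (rule subgroup.m_closed[OF H hk(3) subgroup.m_inv_closed[OF H hk(1)]])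
  moreover have "(k \<otimes>\<^bsub>aut_group T\<^esub> ?i) (\<eta> n) = \<zeta> n"
    using A v hk(4) aut_in_V[OF A(1) v] inv_apply(1)[OF A(1) v] unfolding hk(2)[symmetric]
    by (simp add: mult_apply)
  ultimately show ?thesis by blast
qed

lemma tree_of_orbit_closure: "v \<in> tree_of (orbit_closure H \<xi>) \<longleftrightarrow> (\<exists>h\<in>H. h (\<xi> (lv v)) = v)"
proof -
  have "v \<in> tree_of (orbit_closure H \<xi>) \<longleftrightarrow> v \<in> (\<lambda>\<eta>. \<eta> (lv v)) ` orbit_closure H \<xi>"
    unfolding tree_of_iff[OF orbit_closure_subset] image_iff by (simp add: eq_commute)
  then show ?thesis unfolding level_orbit_closure image_iff by (simp add: eq_commute)
qed

text \<open>\<open>H\<close> preserves the subtree, so \<open>h\<close> restricts to a bijection of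
  the relevant children. Branching therefore need only be computed along
  \<open>\<xi>\<close>.\<close>

lemma card_children_orbit_closure:
  assumes h: "h \<in> H"
  shows "card (children T (h (\<xi> n)) \<inter> tree_of (orbit_closure H \<xi>)) =
    card (children T (\<xi> n) \<inter> tree_of (orbit_closure H \<xi>))"
proof -
  let ?W = "tree_of (orbit_closure H \<xi>)"
  have *: "g w \<in> children T (g v) \<inter> ?W" if g: "g \<in> H" and v: "v \<in> V" and w: "w \<in> children T v \<inter> ?W" for g v w
  proof -
    have gA: "g \<in> Aut" using subgroup_Aut[OF H g] .
    have wV: "w \<in> V" using w children_in_V by blast
    obtain k where k: "k \<in> H" "k (\<xi> (lv w)) = w" using w tree_of_orbit_closure by blast
    have "(g \<otimes>\<^bsub>aut_group T\<^esub> k) (\<xi> (lv w)) = g w"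
      using mult_apply[OF gA subgroup_Aut[OF H k(1)] ray_in_V[OF \<xi>]] k(2) by simp
    moreover have "lv (g w) = lv w" using aut_level[OF gA wV] .
    ultimately have "g w \<in> ?W"
      using subgroup.m_closed[OF H g k(1)] tree_of_orbit_closure by auto
    then show ?thesis using aut_children[OF gA v] w by blast
  qed
  have hA: "h \<in> Aut" using subgroup_Aut[OF H h] .
  have v: "\<xi> n \<in> V" using ray_in_V[OF \<xi>] .
  let ?i = "inv\<^bsub>aut_group T\<^esub> h"
  have "bij_betw h (children T (\<xi> n) \<inter> ?W) (children T (h (\<xi> n)) \<inter> ?W)"
  proof (rule bij_betw_byWitness[where f' = ?i])
    show "\<forall>w\<in>children T (\<xi> n) \<inter> ?W. ?i (h w) = w"
      using inv_apply(1)[OF hA] children_in_V by blast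
    show "\<forall>w\<in>children T (h (\<xi> n)) \<inter> ?W. h (?i w) = w"
      using inv_apply(2)[OF hA] children_in_V by blast
    show "h ` (children T (\<xi> n) \<inter> ?W) \<subseteq> children T (h (\<xi> n)) \<inter> ?W"
      using *[OF h v] by blast
    show "?i ` (children T (h (\<xi> n)) \<inter> ?W) \<subseteq> children T (\<xi> n) \<inter> ?W"
      using *[OF subgroup.m_inv_closed[OF H h] aut_in_V[OF hA v]] inv_apply(1)[OF hA v] by auto
  qed
  then show ?thesis by (simp add: bij_betw_same_card)
qed

text \<open>A finite orbit is already closed.\<close>

lemma orbit_closure_finite:
  assumes fin: "finite H" shows "orbit_closure H \<xi> = (\<lambda>h. ray_image h \<xi>) ` H"
proof
  let ?O = "(\<lambda>h. ray_image h \<xi>) ` H"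
  show "?O \<subseteq> orbit_closure H \<xi>" using ray_image_in_orbit_closure by blast
  have sing: "closed_rays {\<eta>}" if "\<eta> \<in> bd" for \<eta> using that by (auto simp: closed_rays_def)
  have "closed_rays (\<Union>((\<lambda>\<xi>. {\<xi>}) ` ?O))"
    by (rule closed_rays_Union)
      (use fin sing ray_image_in_boundary subgroup_Aut[OF H] \<xi> in auto)
  then have cl: "closed_rays ?O" by simp
  show "orbit_closure H \<xi> \<subseteq> ?O"
  proof
    fix \<eta> assume \<eta>: "\<eta> \<in> orbit_closure H \<xi>"
    then have \<eta>b: "\<eta> \<in> bd" using orbit_closure_subset by blast
    show "\<eta> \<in> ?O"
    proof (rule closed_raysD[OF cl \<eta>b])
      fix n
      obtain h where "h \<in> H" "h (\<xi> n) = \<eta> n" using orbit_closureD[OF \<eta>] by blast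
      then show "\<exists>\<zeta>\<in>?O. \<zeta> n = \<eta> n" by (auto simp: ray_image_apply)
    qed
  qed
qed

end

text \<open>Some \<open>h\<close> carries a deep vertex of \<open>\<xi>\<close> to the vertex of
  \<open>\<eta>\<close> on the same level. Both are below \<open>w\<close>, so \<open>h\<close>
  fixes \<open>w\<close> and acts trivially there, which makes the two vertices equal.\<close>

lemma orbit_closure_inj:
  assumes H: "subgroup H (aut_group T)" and st: "stab_trivial_below H w"
    and \<xi>: "\<xi> \<in> cyl w" and \<eta>: "\<eta> \<in> cyl w" and eq: "orbit_closure H \<xi> = orbit_closure H \<eta>"
  shows "\<xi> = \<eta>"
proof
  fix n
  have b: "\<xi> \<in> bd" "\<eta> \<in> bd" using \<xi> \<eta> by (auto simp: cyl_def)
  define m where "m = max n (lv w)"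
  have "\<eta> \<in> orbit_closure H \<xi>" using base_in_orbit_closure[OF H b(2)] eq by simp
  then obtain h where h: "h \<in> H" "h (\<xi> m) = \<eta> m" by (blast dest: orbit_closureD)
  have hA: "h \<in> Aut" using subgroup_Aut[OF H h(1)] .
  have d: "\<xi> m \<in> descendants T w" "\<eta> m \<in> descendants T w"
    using \<xi> \<eta> by (auto intro!: cyl_descendant simp: m_def)
  have w: "w \<in> V" using \<xi> b(1) ray_in_V[of \<xi> "lv w"] by (simp add: cyl_def)
  have "h (\<xi> m) \<in> descendants T (h w)" by (rule aut_descendants[OF hA w d(1)])
  then have "h w = w"
    using descendants_disjoint[of "\<eta> m" "h w" w] d(2) h(2) aut_level[OF hA w] by simp
  then have "h (\<xi> m) = \<xi> m" using st h(1) d(1) by (auto simp: stab_trivial_below_def)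
  then have "\<xi> m = \<eta> m" using h(2) by simp
  then show "\<xi> n = \<eta> n" by (rule ray_agree[OF b]) (simp add: m_def)
qed

text \<open>A descendant of \<open>v\<close> with smallest stabilizer works.\<close>

lemma ex_stab_trivial_below:
  assumes H: "subgroup H (aut_group T)" "finite H" and v: "v \<in> V"
  shows "\<exists>w\<in>descendants T v. stab_trivial_below H w"
proof -
  define s where "s w = {h \<in> H. h w = w}" for w
  obtain w where w: "w \<in> descendants T v"
    "\<And>x. x \<in> descendants T v \<Longrightarrow> card (s w) \<le> card (s x)"
    using ex_has_least_nat[of "\<lambda>w. w \<in> descendants T v" v "\<lambda>w. card (s w)"] descendants_refl[OF v]
    by blast
  have "h x = x" if hx: "h \<in> H" "h w = w" "x \<in> descendants T w" for h x
  proof -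
    \<comment> \<open>Fixing \<open>x\<close> implies fixing its ancestor \<open>w\<close>; since
      the stabilizer of \<open>w\<close> has least cardinality, the two stabilizers
      coincide.\<close>
    have "s x \<subseteq> s w"
      using aut_fixes_ancestors[OF subgroup_Aut[OF H(1)] descendants_in_V[OF w(1)] hx(3)]
      by (auto simp: s_def)
    moreover have "card (s w) \<le> card (s x)" using w(2) descendants_trans[OF hx(3) w(1)] .
    moreover have "finite (s w)" using H(2) by (simp add: s_def)
    ultimately have "s x = s w" using card_seteq by blast
    then show ?thesis using hx by (auto simp: s_def)
  qed
  then show ?thesis using w(1) by (auto simp: stab_trivial_below_def)
qed

end

context branch
begin

text \<open>\<open>H\<close> lies in the stabilizer of the closure and already moves any vertex of
  the closure to any other on the same level, so only the condition on cylinders remains an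
  assumption.\<close>

lemma gen_parabolic_orbit_closure:
  assumes H: "subgroup H (aut_group T)" "H \<subseteq> G" and \<xi>: "\<xi> \<in> bd"
    and nc: "\<not> contains_cyl (orbit_closure H \<xi>)"
  shows "gen_parabolic_set T G (orbit_closure H \<xi>)"
proof -
  have "H \<subseteq> sstab G (orbit_closure H \<xi>)"
    using H image_orbit_closure[OF H(1) \<xi>] by (auto simp: sstab_def)
  then show ?thesis
    unfolding gen_parabolic_set_iff
    using nc closed_orbit_closure base_in_orbit_closure[OF H(1) \<xi>]
      orbit_closure_transitive[OF H(1) \<xi>] by blast
qed

lemma gen_parabolic_finite_orbit:
  assumes H: "subgroup H (aut_group T)" "H \<subseteq> G" "finite H" and \<xi>: "\<xi> \<in> bd"
  shows "gen_parabolic_set T G (orbit_closure H \<xi>)"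
proof -
  have "finite (orbit_closure H \<xi>)" using orbit_closure_finite[OF H(1) \<xi> H(3)] H(3) by simp
  then show ?thesis
    using gen_parabolic_orbit_closure[OF H(1,2) \<xi>] not_contains_cyl_finite orbit_closure_subset
    by blast
qed


section \<open>Cardinalities\<close>

text \<open>\<open>rist_level T G n\<close> fixes \<open>v\<close>, so \<open>cyl v\<close> has
  finitely many translates; by transitivity these include all the cylinders of the level.\<close>

lemma finite_level: "finite (level T n)"
proof (cases "level T n = {}")
  case False
  then obtain v where v: "v \<in> V" "lv v = n" by (auto simp: level_def)
  have D: "cyl v \<subseteq> bd" by (auto simp: cyl_def)
  have "ray_image h ` cyl v = cyl v" if h: "h \<in> rist_level T G n" for h
    using image_cyl[of h v] rist_level_fixes[OF h v(1)] rist_level_subset G_Aut h v by auto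
  from finite_translates[OF D this] have fin: "finite ((\<lambda>g. ray_image g ` cyl v) ` G)" by simp
  have "cyl ` level T n \<subseteq> (\<lambda>g. ray_image g ` cyl v) ` G"
  proof
    fix c assume "c \<in> cyl ` level T n"
    then obtain u where u: "u \<in> V" "lv u = n" "c = cyl u" by (auto simp: level_def)
    then obtain g where g: "g \<in> G" "g v = u" using G_transitive[of v u] v by auto
    then have "c = ray_image g ` cyl v" using image_cyl[OF G_Aut[OF g(1)] v(1)] u by simp
    then show "c \<in> (\<lambda>g. ray_image g ` cyl v) ` G" using g(1) by blast
  qed
  then have "finite (cyl ` level T n)" using fin finite_subset by blast
  moreover have "inj_on cyl (level T n)"
  proof (rule inj_onI)
    fix u w assume uw: "u \<in> level T n" "w \<in> level T n" "cyl u = cyl w"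
    then obtain \<xi> where "\<xi> \<in> cyl u" "\<xi> \<in> cyl w" using cyl_nonempty[of u] by (auto simp: level_def)
    then show "u = w" using uw by (auto simp: cyl_def level_def)
  qed
  ultimately show ?thesis by (rule finite_imageD)
qed simp

lemma finite_children: "v \<in> V \<Longrightarrow> finite (children T v)"
  by (rule finite_subset[OF _ finite_level[of "Suc (lv v)"]])
    (auto simp: level_def level_children children_in_V)

lemma countable_V: "countable V"
proof -
  have "V = (\<Union>n. level T n)" by (auto simp: level_def)
  then show ?thesis using finite_level by (metis countable_UN countable_finite countableI_type)
qed

text \<open>A closed set is determined by its subtree, a subset of the countable set
  \<open>V\<close>.\<close>

lemma gen_parabolics_lepoll: "gen_parabolics T G \<lesssim> (UNIV :: nat set set)"
proof -
  have "gen_parabolics T G = sstab G ` {C. gen_parabolic_set T G C}"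
    by (auto simp: gen_parabolics_def)
  then have "gen_parabolics T G \<lesssim> {C. gen_parabolic_set T G C}" by (simp add: image_lepoll)
  also have "\<dots> \<lesssim> Pow V"
    unfolding lepoll_def
  proof (intro exI conjI)
    show "inj_on tree_of {C. gen_parabolic_set T G C}"
      using tree_of_inj by (auto simp: inj_on_def gen_parabolic_set_iff)
    show "tree_of ` {C. gen_parabolic_set T G C} \<subseteq> Pow V"
      using closed_rays_subset ray_in_V by (fastforce simp: gen_parabolic_set_iff tree_of_def)
  qed
  also have "Pow V \<lesssim> (UNIV :: nat set set)"
  proof -
    have "inj_on ((`) (to_nat_on V)) (Pow V)"
      using inj_on_to_nat_on[OF countable_V] inj_on_image_Pow by blast
    then show ?thesis unfolding lepoll_def by blast
  qed
  finally show ?thesis .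
qed

text \<open>By the Schroeder-Bernstein theorem, only lower bounds remain to be shown for families of
  subgroups.\<close>

lemma continuum_if_gen_parabolics:
  assumes "S \<subseteq> gen_parabolics T G" "(UNIV :: nat set set) \<lesssim> S" shows "continuum S"
  unfolding continuum_def
  using lepoll_antisym[OF _ assms(2)] gen_parabolics_lepoll subset_imp_lepoll[OF assms(1)] lepoll_trans
  by blast

section \<open>Tree-equivalence classes\<close>

lemma tree_equiv_iff:
  assumes "gen_parabolic_set T G C" "gen_parabolic_set T G D"
  shows "(sstab G C, sstab G D) \<in> tree_equiv T G \<longleftrightarrow> (\<exists>\<phi>\<in>Aut. ray_image \<phi> ` C = D)"
proof
  assume "(sstab G C, sstab G D) \<in> tree_equiv T G"
  then obtain C1 D1 where *: "sstab G C = sstab G C1" "sstab G D = sstab G D1"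
    "gen_parabolic_set T G C1" "gen_parabolic_set T G D1" "\<exists>\<phi>\<in>Aut. ray_image \<phi> ` C1 = D1"
    by (auto simp: tree_equiv_def)
  \<comment> \<open>The sets witnessing \<open>tree_equiv\<close> are the given ones, because a
    stabilizer determines its set.\<close>
  have "C = C1" "D = D1" using sstab_inj[OF assms(1) *(3,1)] sstab_inj[OF assms(2) *(4,2)] .
  then show "\<exists>\<phi>\<in>Aut. ray_image \<phi> ` C = D" using *(5) by simp
qed (use assms in \<open>auto simp: tree_equiv_def\<close>)

definition tree_class :: "(nat \<Rightarrow> 'v) set \<Rightarrow> ('v \<Rightarrow> 'v) set set" where
  "tree_class C = tree_equiv T G `` {sstab G C}"

lemma tree_class_in_tree_classes: "gen_parabolic_set T G C \<Longrightarrow> tree_class C \<in> tree_classes T G"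
  by (auto simp: tree_class_def tree_classes_def gen_parabolics_def intro!: quotientI)

lemma tree_class_subset: "tree_class C \<subseteq> gen_parabolics T G"
  by (auto simp: tree_class_def tree_equiv_def gen_parabolics_def)

lemma sstab_in_tree_class_iff:
  "gen_parabolic_set T G C \<Longrightarrow> gen_parabolic_set T G D \<Longrightarrow>
    sstab G D \<in> tree_class C \<longleftrightarrow> (\<exists>\<phi>\<in>Aut. ray_image \<phi> ` C = D)"
  by (simp add: tree_class_def tree_equiv_iff)

lemma sstab_in_own_tree_class:
  assumes "gen_parabolic_set T G C" shows "sstab G C \<in> tree_class C"
  unfolding sstab_in_tree_class_iff[OF assms assms]
  using assms image_ray_image_one closed_rays_subset aut.one_closed
  by (metis gen_parabolic_set_iff)

text \<open>The numbers of children along the two rays agree: down to \<open>w\<close> the rays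
  coincide, hence so do the subtrees up to that level, and from \<open>w\<close> on every vertex of
  the ray has exactly one child in the subtree.\<close>

lemma finite_orbit_tree_equivalent:
  assumes H: "subgroup H (aut_group T)" and st: "stab_trivial_below H w"
    and \<xi>: "\<xi> \<in> cyl w" and \<eta>: "\<eta> \<in> cyl w"
  shows "\<exists>\<phi>\<in>Aut. ray_image \<phi> ` orbit_closure H \<xi> = orbit_closure H \<eta>"
proof (rule ex_aut_closed_rays)
  have b: "\<xi> \<in> bd" "\<eta> \<in> bd" using \<xi> \<eta> by (auto simp: cyl_def)
  have w: "w \<in> V" using \<xi> b(1) ray_in_V[of \<xi> "lv w"] by (simp add: cyl_def)
  show "orbit_closure H \<xi> \<noteq> {}" "orbit_closure H \<eta> \<noteq> {}"
    using base_in_orbit_closure[OF H] b by auto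
  have tr: "v \<in> tree_of (orbit_closure H \<zeta>) \<longleftrightarrow> v \<in> (\<lambda>h. h (\<zeta> n)) ` H"
    if "\<zeta> \<in> bd" "lv v = n" for \<zeta> v n
    unfolding tree_of_orbit_closure[OF H that(1), of v] that(2) by (blast intro: sym)
  \<comment> \<open>An element mapping \<open>\<zeta> (Suc n)\<close> to a child of
    \<open>\<zeta> n\<close> fixes \<open>\<zeta> n\<close>, hence \<open>w\<close>, hence
    everything below \<open>w\<close>.\<close>
  have single: "children T (\<zeta> n) \<inter> tree_of (orbit_closure H \<zeta>) = {\<zeta> (Suc n)}"
    if \<zeta>: "\<zeta> \<in> cyl w" and n: "n \<ge> lv w" for \<zeta> n
  proof
    have \<zeta>b: "\<zeta> \<in> bd" using \<zeta> by (simp add: cyl_def)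
    show "{\<zeta> (Suc n)} \<subseteq> children T (\<zeta> n) \<inter> tree_of (orbit_closure H \<zeta>)"
      using ray_child[OF \<zeta>b] tree_of_ray[OF base_in_orbit_closure[OF H \<zeta>b]] by simp
    show "children T (\<zeta> n) \<inter> tree_of (orbit_closure H \<zeta>) \<subseteq> {\<zeta> (Suc n)}"
    proof
      fix x assume x: "x \<in> children T (\<zeta> n) \<inter> tree_of (orbit_closure H \<zeta>)"
      then have "lv x = Suc n" using level_children[of x "\<zeta> n"] ray_level[OF \<zeta>b] by simp
      then obtain h where h: "h \<in> H" "x = h (\<zeta> (Suc n))" using x tr[OF \<zeta>b] by blast
      have hA: "h \<in> Aut" using subgroup_Aut[OF H h(1)] .
      have "x \<in> children T (h (\<zeta> n))"
        using aut_children[OF hA ray_in_V[OF \<zeta>b] ray_child[OF \<zeta>b]] h(2) by simp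
      then have "h (\<zeta> n) = \<zeta> n" using parent_unique x by blast
      then have "h w = w" using aut_fixes_ancestors[OF hA w cyl_descendant[OF \<zeta> n]] by simp
      then have "h (\<zeta> (Suc n)) = \<zeta> (Suc n)"
        using st h(1) cyl_descendant[OF \<zeta>, of "Suc n"] n by (auto simp: stab_trivial_below_def)
      then show "x \<in> {\<zeta> (Suc n)}" using h(2) by simp
    qed
  qed
  fix u u' assume u: "u \<in> tree_of (orbit_closure H \<xi>)" "u' \<in> tree_of (orbit_closure H \<eta>)" "lv u = lv u'"
  define n where "n = lv u"
  obtain h where h: "h \<in> H" "u = h (\<xi> n)" using u(1) tr[OF b(1)] n_def by blast
  obtain h' where h': "h' \<in> H" "u' = h' (\<eta> n)" using u(2,3) tr[OF b(2), of u' n] n_def by auto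
  have "card (children T (\<xi> n) \<inter> tree_of (orbit_closure H \<xi>)) =
    card (children T (\<eta> n) \<inter> tree_of (orbit_closure H \<eta>))"
  proof (cases "n \<ge> lv w")
    case True
    then show ?thesis using single \<xi> \<eta> by simp
  next
    case False
    \<comment> \<open>Since \<open>n < lv w\<close>, the children have level
      \<open>Suc n \<le> lv w\<close>, where the two rays still agree.\<close>
    have agree: "\<xi> i = \<eta> i" if "i \<le> lv w" for i
      using ray_agree[OF b, of "lv w" i] \<xi> \<eta> that by (simp add: cyl_def)
    have "x \<in> tree_of (orbit_closure H \<xi>) \<longleftrightarrow> x \<in> tree_of (orbit_closure H \<eta>)"
      if "x \<in> children T (\<xi> n)" for x
    proof -
      have "lv x = Suc n" using level_children[OF that] ray_level[OF b(1)] by simp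
      then show ?thesis using tr[OF b(1)] tr[OF b(2)] agree[of "Suc n"] False by simp
    qed
    then have "children T (\<xi> n) \<inter> tree_of (orbit_closure H \<xi>) =
      children T (\<eta> n) \<inter> tree_of (orbit_closure H \<eta>)"
      using agree[of n] False by auto
    then show ?thesis by simp
  qed
  then show "card (children T u \<inter> tree_of (orbit_closure H \<xi>)) =
    card (children T u' \<inter> tree_of (orbit_closure H \<eta>))"
    using card_children_orbit_closure[OF H b(1) h(1), of n]
      card_children_orbit_closure[OF H b(2) h'(1), of n] h(2) h'(2) by simp
qed (use finite_children closed_orbit_closure in auto)

section \<open>Elements of finite order\<close>

abbreviation "ordG \<equiv> group.ord (subgroup_struct T G)"

lemma group_G: "group (subgroup_struct T G)"
  by (rule subgroup.subgroup_is_group[OF subgroup_G aut.is_group])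

lemma subgroup_generate: "g \<in> G \<Longrightarrow> subgroup (generate (aut_group T) {g}) (aut_group T)"
  using G_Aut by (intro aut.generate_is_subgroup) auto

lemma generate_subset_G: "g \<in> G \<Longrightarrow> generate (aut_group T) {g} \<subseteq> G"
  using subgroup_G by (intro aut.generate_subgroup_incl) auto

text \<open>The order is the cardinality of the cyclic group, and \<open>card\<close> is 0 on
  infinite sets.\<close>

lemma finite_generate:
  assumes g: "g \<in> G" and ord: "ordG g \<noteq> 0" shows "finite (generate (aut_group T) {g})"
proof -
  have "generate (subgroup_struct T G) {g} = generate (aut_group T) {g}"
    using g by (intro aut.generate_consistent subgroup_G) auto
  then have "ordG g = card (generate (aut_group T) {g})"
    using group.generate_pow_card[OF group_G, of g] g by simp
  then show ?thesis using ord card.infinite by metis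
qed

lemma pow_apply:
  assumes g: "g \<in> G" and v: "v \<in> V"
  shows "(g [^]\<^bsub>subgroup_struct T G\<^esub> (m::nat)) v = (g ^^ m) v"
  using v
proof (induction m arbitrary: v)
  case 0
  then show ?case by (simp add: one_apply)
next
  case (Suc m)
  interpret K: group "subgroup_struct T G" by (rule group_G)
  have "g [^]\<^bsub>subgroup_struct T G\<^esub> m \<in> G" using K.nat_pow_closed[of g m] g by simp
  then have "(g [^]\<^bsub>subgroup_struct T G\<^esub> Suc m) v = (g [^]\<^bsub>subgroup_struct T G\<^esub> m) (g v)"
    using mult_apply[of "g [^]\<^bsub>subgroup_struct T G\<^esub> m" g v] G_Aut g Suc.prems by simp
  also have "\<dots> = (g ^^ m) (g v)" using Suc.IH[of "g v"] aut_in_V[OF G_Aut[OF g] Suc.prems] by simp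
  finally show ?case by (simp add: funpow_swap1)
qed

lemma pow_in_generate:
  assumes g: "g \<in> G" shows "\<exists>h\<in>generate (aut_group T) {g}. \<forall>v\<in>V. h v = (g ^^ m) v"
proof (induction m)
  case 0
  show ?case by (rule bexI[OF _ generate.one]) (simp add: one_apply)
next
  case (Suc m)
  then obtain h where h: "h \<in> generate (aut_group T) {g}" "\<forall>v\<in>V. h v = (g ^^ m) v" by blast
  have "g \<in> generate (aut_group T) {g}" by (simp add: generate.incl)
  then have "g \<otimes>\<^bsub>aut_group T\<^esub> h \<in> generate (aut_group T) {g}" using h(1) by (rule generate.eng)
  moreover have "(g \<otimes>\<^bsub>aut_group T\<^esub> h) v = (g ^^ Suc m) v" if "v \<in> V" for v
    using that h mult_apply[of g h v] G_Aut g generate_subset_G[OF g] by auto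
  ultimately show ?case by blast
qed

text \<open>If every vertex returned to itself after at most \<open>B\<close> steps, then the power
  of \<open>g\<close> with exponent \<open>fact B\<close> would be trivial and the order would
  divide \<open>fact B\<close>.\<close>

lemma ex_vertex_large_orbit:
  assumes g: "g \<in> G" and ord: "fact B < ordG g"
  shows "\<exists>v\<in>V. \<forall>m. 0 < m \<and> m \<le> B \<longrightarrow> (g ^^ m) v \<noteq> v"
proof (rule ccontr)
  interpret K: group "subgroup_struct T G" by (rule group_G)
  assume neg: "\<not> ?thesis"
  have "(g ^^ fact B) v = v" if v: "v \<in> V" for v
  proof -
    obtain m where m: "0 < m" "m \<le> B" "(g ^^ m) v = v" using neg v by blast
    then have "m dvd fact B" by (intro dvd_fact) auto
    then obtain k where k: "fact B = m * k" by (rule dvdE)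
    have "((g ^^ m) ^^ k) v = v" by (induction k) (simp_all add: m(3))
    then show ?thesis by (simp add: funpow_mult k mult.commute)
  qed
  then have "g [^]\<^bsub>subgroup_struct T G\<^esub> (fact B :: nat) = \<one>\<^bsub>subgroup_struct T G\<^esub>"
    using G_Aut K.nat_pow_closed[of g "fact B"] g
    by (intro aut_eqI) (simp_all add: pow_apply one_apply)
  then have "ordG g dvd fact B" using K.pow_eq_id[of g "fact B"] g by simp
  then have "ordG g \<le> fact B" by (rule dvd_imp_le) simp
  then show False using ord by simp
qed

text \<open>The \<open>B + 1\<close> vertices obtained from \<open>v\<close> by powers of
  \<open>g\<close> with exponent at most \<open>B\<close> are distinct, and all lie on rays of the
  orbit.\<close>

lemma card_orbit_closure_gt:
  assumes g: "g \<in> G" and fin: "finite (generate (aut_group T) {g})" and \<xi>: "\<xi> \<in> cyl v" and v: "v \<in> V"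
    and B: "\<And>m. 0 < m \<Longrightarrow> m \<le> B \<Longrightarrow> (g ^^ m) v \<noteq> v"
  shows "B < card (orbit_closure (generate (aut_group T) {g}) \<xi>)"
proof -
  let ?L = "generate (aut_group T) {g}"
  let ?C = "orbit_closure ?L \<xi>"
  note L = subgroup_generate[OF g]
  have \<xi>b: "\<xi> \<in> bd" using \<xi> by (simp add: cyl_def)
  have gV: "(g ^^ m) u \<in> V" if "u \<in> V" for m u
    by (induction m) (use that aut_in_V[OF G_Aut[OF g]] in auto)
  have gI: "u = u'" if "(g ^^ m) u = (g ^^ m) u'" "u \<in> V" "u' \<in> V" for m u u'
    using that by (induction m) (auto simp: aut_inj[OF G_Aut[OF g]] gV)
  have ne: "(g ^^ i) v \<noteq> (g ^^ j) v" if "i < j" "j \<le> B" for i j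
  proof
    assume "(g ^^ i) v = (g ^^ j) v"
    moreover have "(g ^^ j) v = (g ^^ i) ((g ^^ (j - i)) v)"
      using \<open>i < j\<close> funpow_add[of i "j - i" g] by simp
    ultimately have "(g ^^ (j - i)) v = v" using gI[of i v "(g ^^ (j - i)) v"] gV[OF v] v by simp
    then show False using B[of "j - i"] that by simp
  qed
  have "inj_on (\<lambda>m. (g ^^ m) v) {..B}"
    by (rule inj_onI) (metis ne atMost_iff linorder_neqE_nat)
  then have "card ((\<lambda>m. (g ^^ m) v) ` {..B}) = Suc B" by (simp add: card_image)
  moreover have "(\<lambda>m. (g ^^ m) v) ` {..B} \<subseteq> (\<lambda>\<eta>. \<eta> (lv v)) ` ?C"
  proof
    fix u assume "u \<in> (\<lambda>m. (g ^^ m) v) ` {..B}"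
    then obtain m where m: "u = (g ^^ m) v" by blast
    obtain h where h: "h \<in> ?L" "\<forall>v\<in>V. h v = (g ^^ m) v" using pow_in_generate[OF g] by blast
    then have "u = ray_image h \<xi> (lv v)" using m v \<xi> by (simp add: ray_image_apply cyl_def)
    then show "u \<in> (\<lambda>\<eta>. \<eta> (lv v)) ` ?C" using ray_image_in_orbit_closure[OF L \<xi>b h(1)] by blast
  qed
  moreover have finC: "finite ?C" using orbit_closure_finite[OF L \<xi>b fin] fin by simp
  ultimately have "Suc B \<le> card ((\<lambda>\<eta>. \<eta> (lv v)) ` ?C)" by (metis card_mono finite_imageI)
  also have "\<dots> \<le> card ?C" using finC by (rule card_image_le)
  finally show ?thesis by simp
qed

text \<open>Single rays give the parabolic subgroups; with \<open>sstab_inj\<close> this separates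
  them from the stabilizers of larger sets.\<close>

lemma gen_parabolic_singleton:
  assumes "\<xi> \<in> bd" shows "gen_parabolic_set T G {\<xi>}"
proof -
  have "ray_image \<one>\<^bsub>aut_group T\<^esub> ` {\<xi>} = {\<xi>}" using image_ray_image_one[of "{\<xi>}"] assms by simp
  then have "\<one>\<^bsub>aut_group T\<^esub> \<in> sstab G {\<xi>}" using G_closed(3) by (simp add: sstab_def)
  then show ?thesis
    unfolding gen_parabolic_set_iff
    using assms closed_rays_finite[of "{\<xi>}"] not_contains_cyl_finite[of "{\<xi>}"]
      one_apply[OF ray_in_V[OF assms]] by auto
qed

lemma not_parabolic:
  assumes C: "gen_parabolic_set T G C" and C2: "\<xi> \<in> C" "\<eta> \<in> C" "\<xi> \<noteq> \<eta>"
  shows "sstab G C \<notin> parabolics T G"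
proof
  assume "sstab G C \<in> parabolics T G"
  then obtain \<zeta> where \<zeta>: "\<zeta> \<in> bd" "sstab G C = ray_stab G \<zeta>" by (auto simp: parabolics_def)
  have "ray_stab G \<zeta> = sstab G {\<zeta>}" by (auto simp: ray_stab_def sstab_def)
  then have "C = {\<zeta>}" using sstab_inj[OF C gen_parabolic_singleton[OF \<zeta>(1)]] \<zeta>(2) by simp
  then show False using C2 by simp
qed

text \<open>The rays through \<open>w\<close> parametrize the subgroups injectively, by
  \<open>orbit_closure_inj\<close> and \<open>sstab_inj\<close>. \<open>S\<close> stands for the set
  of nonparabolic subgroups in one application and for a single tree-equivalence class in the
  other.\<close>

lemma continuum_lepoll_finite_orbits:
  assumes H: "subgroup H (aut_group T)" "H \<subseteq> G" "finite H"
    and w: "w \<in> V" and st: "stab_trivial_below H w"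
    and S: "\<And>\<xi>. \<xi> \<in> cyl w \<Longrightarrow> sstab G (orbit_closure H \<xi>) \<in> S"
  shows "(UNIV :: nat set set) \<lesssim> S"
proof -
  have "inj_on (\<lambda>\<xi>. sstab G (orbit_closure H \<xi>)) (cyl w)"
  proof (rule inj_onI)
    fix \<xi> \<eta> assume *: "\<xi> \<in> cyl w" "\<eta> \<in> cyl w" "sstab G (orbit_closure H \<xi>) = sstab G (orbit_closure H \<eta>)"
    then have "orbit_closure H \<xi> = orbit_closure H \<eta>"
      by (intro sstab_inj gen_parabolic_finite_orbit[OF H] cyl_subset_boundary)
    then show "\<xi> = \<eta>" by (rule orbit_closure_inj[OF H(1) st *(1,2)])
  qed
  then have "cyl w \<lesssim> S" unfolding lepoll_def using S by blast
  then show ?thesis by (rule lepoll_trans[OF continuum_lepoll_cyl[OF w]])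
qed

text \<open>\<open>w\<close> is chosen below a vertex moved by \<open>g\<close>, so every ray
  through \<open>w\<close> is moved and its orbit has at least two elements.\<close>

lemma continuum_nonparabolic:
  assumes "\<not> torsion_free (subgroup_struct T G)"
  shows "continuum (gen_parabolics T G - parabolics T G)"
proof -
  obtain g where g: "g \<in> G" "g \<noteq> \<one>\<^bsub>aut_group T\<^esub>" "ordG g \<noteq> 0"
    using assms by (auto simp: torsion_free_def)
  let ?L = "generate (aut_group T) {g}"
  note L = subgroup_generate[OF g(1)] generate_subset_G[OF g(1)] finite_generate[OF g(1,3)]
  have gL: "g \<in> ?L" by (simp add: generate.incl)
  have "\<exists>u\<in>V. g u \<noteq> \<one>\<^bsub>aut_group T\<^esub> u"
    using aut_eqI[OF G_Aut[OF g(1)] aut.one_closed] g(2) by blast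
  then obtain u where u: "u \<in> V" "g u \<noteq> u" by (auto simp: one_apply)
  obtain w where w: "w \<in> descendants T u" "stab_trivial_below ?L w"
    using ex_stab_trivial_below[OF L(1,3) u(1)] by blast
  have "(UNIV :: nat set set) \<lesssim> gen_parabolics T G - parabolics T G"
  proof (rule continuum_lepoll_finite_orbits[OF L descendants_in_V[OF w(1)] w(2)])
    fix \<xi> assume \<xi>: "\<xi> \<in> cyl w"
    then have \<xi>u: "\<xi> \<in> bd" "\<xi> (lv u) = u" using cyl_mono[OF w(1)] by (auto simp: cyl_def)
    have gp: "gen_parabolic_set T G (orbit_closure ?L \<xi>)"
      by (rule gen_parabolic_finite_orbit[OF L \<xi>u(1)])
    have "\<xi> \<noteq> ray_image g \<xi>" using \<xi>u(2) u(2) ray_image_apply[of g \<xi> "lv u"] by auto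
    then have "sstab G (orbit_closure ?L \<xi>) \<notin> parabolics T G"
      using not_parabolic[OF gp base_in_orbit_closure[OF L(1) \<xi>u(1)]
          ray_image_in_orbit_closure[OF L(1) \<xi>u(1) gL]] by blast
    then show "sstab G (orbit_closure ?L \<xi>) \<in> gen_parabolics T G - parabolics T G"
      using gp by (auto simp: gen_parabolics_def)
  qed
  then show ?thesis by (rule continuum_if_gen_parabolics[rotated]) blast
qed

text \<open>An order above \<open>fact B\<close> yields a vertex \<open>v\<close> with more than
  \<open>B\<close> translates; choosing \<open>w\<close> below \<open>v\<close> keeps the orbits of
  all rays through \<open>w\<close> that large.\<close>

lemma ex_large_continuum_class:
  assumes "unbounded_finite_orders (subgroup_struct T G)"
  shows "\<exists>C. gen_parabolic_set T G C \<and> B < card C \<and> continuum (tree_class C)"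
proof -
  obtain g where g: "g \<in> G" "ordG g \<noteq> 0" "Suc (fact B) \<le> ordG g"
    using assms by (auto simp: unbounded_finite_orders_def)
  let ?L = "generate (aut_group T) {g}"
  note L = subgroup_generate[OF g(1)] generate_subset_G[OF g(1)] finite_generate[OF g(1,2)]
  obtain v where v: "v \<in> V" "\<And>m. 0 < m \<Longrightarrow> m \<le> B \<Longrightarrow> (g ^^ m) v \<noteq> v"
    using ex_vertex_large_orbit[OF g(1), of B] g(3) by auto
  obtain w where w: "w \<in> descendants T v" "stab_trivial_below ?L w"
    using ex_stab_trivial_below[OF L(1,3) v(1)] by blast
  have wV: "w \<in> V" using w(1) descendants_in_V by blast
  obtain \<xi> where \<xi>: "\<xi> \<in> cyl w" using cyl_nonempty[OF wV] by blast
  let ?C = "orbit_closure ?L \<xi>"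
  have gp: "gen_parabolic_set T G (orbit_closure ?L \<eta>)" if "\<eta> \<in> cyl w" for \<eta>
    by (rule gen_parabolic_finite_orbit[OF L cyl_subset_boundary[OF that]])
  have "(UNIV :: nat set set) \<lesssim> tree_class ?C"
  proof (rule continuum_lepoll_finite_orbits[OF L wV w(2)])
    fix \<eta> assume \<eta>: "\<eta> \<in> cyl w"
    show "sstab G (orbit_closure ?L \<eta>) \<in> tree_class ?C"
      unfolding sstab_in_tree_class_iff[OF gp[OF \<xi>] gp[OF \<eta>]]
      by (rule finite_orbit_tree_equivalent[OF L(1) w(2) \<xi> \<eta>])
  qed
  then have "continuum (tree_class ?C)" by (rule continuum_if_gen_parabolics[OF tree_class_subset])
  moreover have "B < card ?C"
    by (rule card_orbit_closure_gt[OF g(1) L(3) _ v]) (use \<xi> cyl_mono[OF w(1)] in auto)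
  ultimately show ?thesis using gp[OF \<xi>] by blast
qed

text \<open>The cardinality of the underlying set is an invariant of the class and takes arbitrarily
  large values on classes of continuum size.\<close>

lemma infinite_continuum_classes:
  assumes "unbounded_finite_orders (subgroup_struct T G)"
  shows "infinite {c \<in> tree_classes T G. continuum c}" (is "infinite ?S")
proof
  assume fin: "finite ?S"
  \<comment> \<open>Any member of a class gives the same value, because automorphisms act
    injectively on rays.\<close>
  define k where "k c = card (SOME C. gen_parabolic_set T G C \<and> sstab G C \<in> c)" for c
  have k: "k (tree_class C) = card C" if C: "gen_parabolic_set T G C" for C
  proof -
    define D where "D = (SOME D. gen_parabolic_set T G D \<and> sstab G D \<in> tree_class C)"
    have "gen_parabolic_set T G D \<and> sstab G D \<in> tree_class C"
      unfolding D_def by (rule someI[of _ C]) (use C sstab_in_own_tree_class in blast)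
    then obtain \<phi> where \<phi>: "\<phi> \<in> Aut" "ray_image \<phi> ` C = D"
      using sstab_in_tree_class_iff[OF C] by blast
    have "inj_on (ray_image \<phi>) C"
      by (rule inj_on_subset[OF inj_on_ray_image[OF \<phi>(1)]])
        (use C closed_rays_subset in \<open>auto simp: gen_parabolic_set_iff\<close>)
    then have "card D = card C" using \<phi>(2) card_image by blast
    then show ?thesis by (simp add: k_def D_def)
  qed
  have "\<forall>B. \<exists>n\<in>k ` ?S. B < n"
  proof
    fix B
    obtain C where "gen_parabolic_set T G C" "B < card C" "continuum (tree_class C)"
      using ex_large_continuum_class[OF assms] by blast
    then have "tree_class C \<in> ?S" "k (tree_class C) = card C" "B < card C"
      using k tree_class_in_tree_classes by auto
    then show "\<exists>n\<in>k ` ?S. B < n" by force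
  qed
  then have "infinite (k ` ?S)" by (metis Max_ge finite_imageI leD fin)
  then show False using fin by blast
qed

end

context rtree
begin

section \<open>Chains of vertices\<close>

lemma root_path_step:
  assumes "v \<in> V" "n < lv v" shows "rp v ! Suc n \<in> children T (rp v ! n)"
proof -
  have "rp (rp v ! Suc n) = rp (rp v ! n) @ [rp v ! Suc n]"
    using assms length_root_path[OF assms(1)] by (simp add: root_path_nth take_Suc_conv_app_nth)
  then show ?thesis using assms by (simp add: children_iff root_path_nth_in_V)
qed

lemma root_path_descendant:
  assumes "u \<in> descendants T v" "n \<le> lv v" shows "rp u ! n = rp v ! n"
proof -
  have "u \<in> V" "lv v \<le> lv u" "rp u ! lv v = v" using assms(1) descendants_iff by auto
  then have "rp v = take (Suc (lv v)) (rp u)" using root_path_nth[of u "lv v"] by simp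
  then show ?thesis using assms(2) by simp
qed

text \<open>The root paths of the chain extend one another, so they fit together to a ray.\<close>

lemma ex_ray_through_chain:
  assumes V: "\<And>i. v i \<in> V" and desc: "\<And>i. v (Suc i) \<in> descendants T (v i)"
    and lev: "\<And>i. lv (v i) < lv (v (Suc i))"
  shows "\<exists>\<xi>\<in>bd. \<forall>i. \<xi> (lv (v i)) = v i"
proof -
  have ge: "i \<le> lv (v i)" for i
  proof (induction i)
    case (Suc i)
    then show ?case using lev[of i] by simp
  qed simp
  have chain: "v j \<in> descendants T (v i)" if "i \<le> j" for i j
    using that
  proof (induction j rule: dec_induct)
    case base
    show ?case by (rule descendants_refl[OF V])
  next
    case (step j)
    then show ?case using desc descendants_trans by blast
  qed
  have eq: "rp (v j) ! n = rp (v i) ! n" if "n \<le> lv (v i)" "n \<le> lv (v j)" for i j n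
    using that root_path_descendant[OF chain, of i j n] root_path_descendant[OF chain, of j i n]
    by (cases "i \<le> j") auto
  \<comment> \<open>Levels grow strictly, so \<open>v n\<close> lies on a level at least
    \<open>n\<close> and its root path has an entry at \<open>n\<close>.\<close>
  define \<xi> where "\<xi> n = rp (v n) ! n" for n
  have "\<xi> \<in> bd"
  proof (rule boundaryI)
    show "\<xi> 0 = rt" by (simp add: \<xi>_def root_path_nth_0[OF V])
    show "\<xi> (Suc n) \<in> children T (\<xi> n)" for n
      using root_path_step[OF V[of "Suc n"], of n] ge[of "Suc n"] ge[of n]
        eq[of n n "Suc n"]
      by (simp add: \<xi>_def)
  qed
  moreover have "\<xi> (lv (v i)) = v i" for i
    using eq[of "lv (v i)" i "lv (v i)"] ge[of "lv (v i)"]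
      root_path_nth_level[OF V[of i]] by (simp add: \<xi>_def)
  ultimately show ?thesis by blast
qed

text \<open>An element fixing \<open>w\<close> fixes its ancestor \<open>v\<close>.\<close>

lemma stab_trivial_below_descendant:
  assumes H: "H \<subseteq> Aut" and st: "stab_trivial_below H v" and v: "v \<in> V" and w: "w \<in> descendants T v"
  shows "stab_trivial_below H w"
  unfolding stab_trivial_below_def
proof (intro ballI impI)
  fix h u assume h: "h \<in> H" "h w = w" and u: "u \<in> descendants T w"
  have "h v = v" using aut_fixes_ancestors[of h v w] H h v w by blast
  then show "h u = u" using st h(1) descendants_trans[OF u w] by (auto simp: stab_trivial_below_def)
qed

end

text \<open>Sending \<open>f x\<close> to \<open>g x\<close> is a well-defined bijection between the
  images.\<close>

lemma card_image_cong_kernel: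
  assumes "\<And>x y. x \<in> S \<Longrightarrow> y \<in> S \<Longrightarrow> f x = f y \<longleftrightarrow> g x = g y"
  shows "card (f ` S) = card (g ` S)"
proof -
  define F where "F y = g (SOME x. x \<in> S \<and> f x = y)" for y
  have F: "F (f x) = g x" if "x \<in> S" for x
  proof -
    have "(SOME z. z \<in> S \<and> f z = f x) \<in> S \<and> f (SOME z. z \<in> S \<and> f z = f x) = f x"
      by (rule someI[of _ x]) (use that in simp)
    then show ?thesis using assms that by (auto simp: F_def)
  qed
  then have "inj_on F (f ` S)" using assms by (auto simp: inj_on_def)
  moreover have "F ` f ` S = g ` S" using F by (force simp: image_image)
  ultimately show ?thesis using card_image by metis
qed

context branch
begin

section \<open>Groups generated along a ray\<close>

lemma subgroup_rist: "subgroup (rist T G v) (aut_group T)"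
proof (rule aut.subgroupI)
  show "rist T G v \<subseteq> Aut" using rist_subset G_Aut by blast
  have "\<one>\<^bsub>aut_group T\<^esub> \<in> rist T G v" using G_closed(3) by (simp add: rist_def one_apply)
  then show "rist T G v \<noteq> {}" by blast
next
  fix g assume g: "g \<in> rist T G v"
  then have "g \<in> G" "g \<in> Aut" using rist_subset G_Aut by blast+
  moreover have "(inv\<^bsub>aut_group T\<^esub> g) u = u" if "u \<in> V" "u \<notin> descendants T v" for u
    using inv_apply(1)[OF \<open>g \<in> Aut\<close> that(1)] rist_fixes_outside[OF g that] by simp
  ultimately show "inv\<^bsub>aut_group T\<^esub> g \<in> rist T G v" using G_closed(2) by (simp add: rist_def)
next
  fix g h assume gh: "g \<in> rist T G v" "h \<in> rist T G v"
  then have "g \<in> G" "h \<in> G" "g \<in> Aut" "h \<in> Aut" using rist_subset G_Aut by blast+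
  then show "g \<otimes>\<^bsub>aut_group T\<^esub> h \<in> rist T G v"
    using G_closed(1) gh by (simp add: rist_def mult_apply)
qed

text \<open>\<open>generate\<close> has a separate rule for inverses of generators; this reduces
  that case to the one for generators.\<close>

lemma inv_in_Un:
  assumes "subgroup K (aut_group T)" "subgroup L (aut_group T)" "k \<in> K \<union> L"
  shows "inv\<^bsub>aut_group T\<^esub> k \<in> K \<union> L"
  using assms by (auto simp: subgroup.m_inv_closed)

context
  fixes K L v
  assumes K: "subgroup K (aut_group T)" and L: "subgroup L (aut_group T)" "L \<subseteq> rist T G v"
    and v: "v \<in> V"
begin

text \<open>\<open>L\<close> fixes all vertices up to the level of \<open>v\<close>, so there a word
  in \<open>K \<union> L\<close> acts as the product of its letters from \<open>K\<close>.\<close>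

lemma generate_Un_agree:
  assumes "k \<in> generate (aut_group T) (K \<union> L)"
  shows "k \<in> Aut \<and> (\<exists>k'\<in>K. \<forall>u\<in>V. lv u \<le> lv v \<longrightarrow> k u = k' u)"
proof -
  have base: "k \<in> Aut \<and> (\<exists>k'\<in>K. \<forall>u\<in>V. lv u \<le> lv v \<longrightarrow> k u = k' u)" if k: "k \<in> K \<union> L" for k
  proof (cases "k \<in> K")
    case True
    then show ?thesis using subgroup_Aut[OF K] by blast
  next
    case False
    then have kL: "k \<in> L" using k by blast
    then have "k u = \<one>\<^bsub>aut_group T\<^esub> u" if "u \<in> V" "lv u \<le> lv v" for u
      using rist_fixes_level[of k v u] L(2) that by (auto simp: one_apply)
    then show ?thesis using subgroup_Aut[OF L(1) kL] subgroup.one_closed[OF K] by blast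
  qed
  show ?thesis using assms
  proof (induction rule: generate.induct)
    case one
    then show ?case using subgroup.one_closed[OF K] aut.one_closed by blast
  next
    case (incl k)
    then show ?case by (rule base)
  next
    case (inv k)
    then show ?case using base[OF inv_in_Un[OF K L(1)]] by blast
  next
    case (eng k1 k2)
    then obtain a1 a2 where a: "a1 \<in> K" "a2 \<in> K" "\<And>u. u \<in> V \<Longrightarrow> lv u \<le> lv v \<Longrightarrow> k1 u = a1 u"
      "\<And>u. u \<in> V \<Longrightarrow> lv u \<le> lv v \<Longrightarrow> k2 u = a2 u" by blast
    have A: "k1 \<in> Aut" "k2 \<in> Aut" "a1 \<in> Aut" "a2 \<in> Aut" using eng a subgroup_Aut[OF K] by auto
    have "(k1 \<otimes>\<^bsub>aut_group T\<^esub> k2) u = (a1 \<otimes>\<^bsub>aut_group T\<^esub> a2) u" if "u \<in> V" "lv u \<le> lv v" for u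
      using a(3)[of "a2 u"] a(4)[OF that] A that by (simp add: mult_apply aut_in_V aut_level)
    moreover have "a1 \<otimes>\<^bsub>aut_group T\<^esub> a2 \<in> K" by (rule subgroup.m_closed[OF K a(1,2)])
    ultimately show ?case using A by blast
  qed
qed

text \<open>If \<open>K\<close> acts freely enough below \<open>v\<close>, then the generated group acts on the union of the
  subtrees \<open>T\<^sub>u\<close>, \<open>u \<in> K v\<close>, as a permutational wreath product of \<open>L\<close> by \<open>K\<close>.\<close>

lemma generate_Un_wreath:
  assumes st: "stab_trivial_below K v" and k: "k \<in> generate (aut_group T) (K \<union> L)" and a: "a \<in> K"
  shows "\<exists>b\<in>K. \<exists>c\<in>L. \<forall>x\<in>descendants T v. k (a x) = b (c x)"
proof -
  note one = subgroup.one_closed[OF K] subgroup.one_closed[OF L(1)]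
  have Lv: "c x \<in> descendants T v" if "c \<in> L" "x \<in> descendants T v" for c x
    using aut_descendants[OF subgroup_Aut[OF L(1) that(1)] v that(2)] rist_fixes_level[of c v v]
      L(2) that(1) v by auto
  \<comment> \<open>A letter from \<open>K\<close> is absorbed into \<open>a\<close>. A letter from
    \<open>L\<close> acts directly if \<open>a\<close> fixes \<open>v\<close>, because
    \<open>a\<close> is then trivial below \<open>v\<close>; if \<open>a\<close> moves
    \<open>v\<close>, the letter fixes the image subtree pointwise.\<close>
  have base: "\<exists>b\<in>K. \<exists>c\<in>L. \<forall>x\<in>descendants T v. k (a x) = b (c x)" if k: "k \<in> K \<union> L" and a: "a \<in> K" for k a
  proof (cases "k \<in> K")
    case True
    have "k (a x) = (k \<otimes>\<^bsub>aut_group T\<^esub> a) (\<one>\<^bsub>aut_group T\<^esub> x)" if "x \<in> descendants T v" for x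
      using descendants_in_V[OF that] mult_apply[OF subgroup_Aut[OF K True] subgroup_Aut[OF K a]]
      by (simp add: one_apply)
    then show ?thesis using subgroup.m_closed[OF K True a] one(2) by blast
  next
    case False
    then have kL: "k \<in> L" using k by blast
    have aA: "a \<in> Aut" using subgroup_Aut[OF K a] .
    show ?thesis
    proof (cases "a v = v")
      case True
      then have "k (a x) = \<one>\<^bsub>aut_group T\<^esub> (k x)" if "x \<in> descendants T v" for x
        using st a that Lv[OF kL that] descendants_in_V
        by (auto simp: stab_trivial_below_def one_apply)
      then show ?thesis using one(1) kL by blast
    next
      case False
      have "k (a x) = a (\<one>\<^bsub>aut_group T\<^esub> x)" if x: "x \<in> descendants T v" for x
      proof -
        have "a x \<in> descendants T (a v)" using aut_descendants[OF aA v x] .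
        then have "a x \<notin> descendants T v"
          using descendants_disjoint[of "a x" "a v" v] aut_level[OF aA v] False by blast
        then show ?thesis
          using rist_fixes_outside[of k v "a x"] kL L(2) aut_in_V[OF aA] descendants_in_V[OF x]
          by (auto simp: one_apply)
      qed
      then show ?thesis using a one(2) by blast
    qed
  qed
  show ?thesis using k a
  proof (induction arbitrary: a rule: generate.induct)
    case one
    have "\<one>\<^bsub>aut_group T\<^esub> (a x) = a (\<one>\<^bsub>aut_group T\<^esub> x)" if "x \<in> descendants T v" for x
      using descendants_in_V[OF that] aut_in_V[OF subgroup_Aut[OF K one]] by (simp add: one_apply)
    then show ?case using one \<open>\<one>\<^bsub>aut_group T\<^esub> \<in> L\<close> by blast
  next
    case (incl k)
    then show ?case by (rule base)
  next
    case (inv k)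
    then show ?case using base[OF inv_in_Un[OF K L(1)]] by blast
  next
    case (eng k1 k2)
    obtain b c where bc: "b \<in> K" "c \<in> L" "\<And>x. x \<in> descendants T v \<Longrightarrow> k2 (a x) = b (c x)"
      using eng.IH(2)[OF eng.prems] by blast
    \<comment> \<open>The right factor has replaced \<open>a\<close> by \<open>b\<close>, so the
      induction hypothesis for \<open>k1\<close> is needed at \<open>b\<close>; this is why
      \<open>a\<close> is arbitrary.\<close>
    obtain b' c' where bc': "b' \<in> K" "c' \<in> L" "\<And>x. x \<in> descendants T v \<Longrightarrow> k1 (b x) = b' (c' x)"
      using eng.IH(1)[OF bc(1)] by blast
    have A: "k1 \<in> Aut" "k2 \<in> Aut" using eng.hyps generate_Un_agree by auto
    have "(k1 \<otimes>\<^bsub>aut_group T\<^esub> k2) (a x) = b' ((c' \<otimes>\<^bsub>aut_group T\<^esub> c) x)" if x: "x \<in> descendants T v" for x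
      using bc(3)[OF x] bc'(3)[OF Lv[OF bc(2) x]] descendants_in_V[OF x]
        mult_apply[OF A aut_in_V[OF subgroup_Aut[OF K eng.prems]]]
        mult_apply[OF subgroup_Aut[OF L(1) bc'(2)] subgroup_Aut[OF L(1) bc(2)]]
      by simp
    then show ?case using bc'(1) subgroup.m_closed[OF L(1) bc'(2) bc(2)] by blast
  qed
qed

text \<open>Below \<open>v\<close>, \<open>k\<close> has the form \<open>b\<close> after
  \<open>c\<close>. If \<open>k\<close> fixes \<open>w\<close>, then \<open>b\<close> fixes
  \<open>v\<close> and is trivial below it, so \<open>k\<close> acts there as \<open>c\<close>, to
  which the assumption on \<open>L\<close> applies.\<close>

lemma stab_trivial_below_generate_Un:
  assumes st: "stab_trivial_below K v" and stL: "stab_trivial_below L w" and w: "w \<in> descendants T v"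
  shows "stab_trivial_below (generate (aut_group T) (K \<union> L)) w"
  unfolding stab_trivial_below_def
proof (intro ballI impI)
  fix k u assume k: "k \<in> generate (aut_group T) (K \<union> L)" "k w = w" and u: "u \<in> descendants T w"
  obtain b c where bc: "b \<in> K" "c \<in> L"
    "\<And>x. x \<in> descendants T v \<Longrightarrow> k (\<one>\<^bsub>aut_group T\<^esub> x) = b (c x)"
    using generate_Un_wreath[OF st k(1) subgroup.one_closed[OF K]] by blast
  have kx: "k x = b (c x)" if "x \<in> descendants T v" for x
    using bc(3)[OF that] descendants_in_V[OF that] by (simp add: one_apply)
  have cA: "c \<in> Aut" "b \<in> Aut" using subgroup_Aut L(1) K bc by auto
  have cv: "c v = v" using rist_fixes_level[of c v v] L(2) bc(2) v by auto
  have cd: "c x \<in> descendants T v" if "x \<in> descendants T v" for x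
    using aut_descendants[OF cA(1) v that] cv by simp
  have "w \<in> descendants T (b v)" using aut_descendants[OF cA(2) v cd[OF w]] kx[OF w] k(2) by simp
  then have "b v = v" using descendants_disjoint[of w "b v" v] w aut_level[OF cA(2) v] by simp
  then have "b x = x" if "x \<in> descendants T v" for x
    using st bc(1) that by (auto simp: stab_trivial_below_def)
  then have kc: "k x = c x" if "x \<in> descendants T v" for x using kx[OF that] cd[OF that] by simp
  then have "c w = w" using k(2) w by simp
  then have "c u = u" using stL bc(2) u by (auto simp: stab_trivial_below_def)
  then show "k u = u" using kc[OF descendants_trans[OF u w]] by simp
qed

end

section \<open>Translates under the group and the size of classes\<close>

lemma gen_parabolic_set_image:
  assumes C: "gen_parabolic_set T G C" and g: "g \<in> G" shows "gen_parabolic_set T G (ray_image g ` C)"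
  unfolding gen_parabolic_set_iff
proof (intro conjI ballI allI)
  have C': "closed_rays C" "C \<noteq> {}" "\<not> contains_cyl C" "C \<subseteq> bd"
    using C closed_rays_subset by (auto simp: gen_parabolic_set_iff)
  note gA = G_Aut[OF g]
  show "closed_rays (ray_image g ` C)" by (rule closed_rays_image[OF gA C'(1)])
  show "ray_image g ` C \<noteq> {}" using C'(2) by simp
  show "\<not> contains_cyl (ray_image g ` C)" using contains_cyl_image[OF gA C'(4)] C'(3) by blast
  fix \<xi>' \<eta>' n assume "\<xi>' \<in> ray_image g ` C" "\<eta>' \<in> ray_image g ` C"
  then obtain \<xi> \<eta> where \<xi>: "\<xi> \<in> C" "\<xi>' = ray_image g \<xi>" and \<eta>: "\<eta> \<in> C" "\<eta>' = ray_image g \<eta>" by blast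
  obtain h where h: "h \<in> sstab G C" "h (\<xi> n) = \<eta> n"
    using C \<xi>(1) \<eta>(1) unfolding gen_parabolic_set_iff by blast
  have hG: "h \<in> G" using h(1) by (simp add: sstab_def)
  note hA = G_Aut[OF hG]
  let ?i = "inv\<^bsub>aut_group T\<^esub> g"
  \<comment> \<open>The conjugate of \<open>h\<close> by \<open>g\<close> stabilizes the
    translate.\<close>
  let ?k = "g \<otimes>\<^bsub>aut_group T\<^esub> (h \<otimes>\<^bsub>aut_group T\<^esub> ?i)"
  have \<xi>V: "\<xi> n \<in> V" using \<xi>(1) C'(4) ray_in_V by blast
  have "?k \<in> G" using g hG G_closed by simp
  moreover have "ray_image ?k ` ray_image g ` C = ray_image g ` C"
  proof -
    have gC: "ray_image g ` C \<subseteq> bd" by (rule image_subset_boundary[OF gA C'(4)])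
    have "ray_image ?k ` ray_image g ` C = ray_image g ` ray_image h ` ray_image ?i ` ray_image g ` C"
      using gA hA gC by (simp add: image_ray_image_mult image_subset_boundary)
    also have "\<dots> = ray_image g ` C" using image_ray_image_inv(1)[OF gA C'(4)] sstabD[OF h(1)] by simp
    finally show ?thesis .
  qed
  ultimately have "?k \<in> sstab G (ray_image g ` C)" by (simp add: sstab_def)
  moreover have "?k (\<xi>' n) = \<eta>' n"
    using gA hA \<xi>V h(2) aut_in_V[OF gA \<xi>V]
    by (simp add: \<xi>(2) \<eta>(2) ray_image_apply mult_apply inv_apply)
  ultimately show "\<exists>k\<in>sstab G (ray_image g ` C). k (\<xi>' n) = \<eta>' n" by blast
qed

text \<open>The translates of \<open>C\<close> under \<open>G\<close> give members of its class,
  distinct by \<open>sstab_inj\<close>. If they were finitely many, \<open>C\<close> would contain a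
  cylinder.\<close>

lemma infinite_tree_class:
  assumes C: "gen_parabolic_set T G C" shows "infinite (tree_class C)"
proof
  assume fin: "finite (tree_class C)"
  let ?D = "(\<lambda>g. ray_image g ` C) ` G"
  have gp: "gen_parabolic_set T G D" if "D \<in> ?D" for D using that gen_parabolic_set_image[OF C] by blast
  have "sstab G D \<in> tree_class C" if D: "D \<in> ?D" for D
    unfolding sstab_in_tree_class_iff[OF C gp[OF D]] using D G_Aut by blast
  then have "sstab G ` ?D \<subseteq> tree_class C" by blast
  then have "finite (sstab G ` ?D)" using fin finite_subset by blast
  moreover have "inj_on (sstab G) ?D" by (rule inj_onI) (metis sstab_inj gp)
  ultimately have "finite ?D" by (rule finite_imageD)
  then show False using translates_contains_cyl C by (auto simp: gen_parabolic_set_iff)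
qed

lemma tree_classes_lepoll: "tree_classes T G \<lesssim> (UNIV :: nat set set)"
proof -
  have "tree_classes T G = (\<lambda>x. tree_equiv T G `` {x}) ` gen_parabolics T G"
    by (auto simp: tree_classes_def quotient_def)
  then show ?thesis using image_lepoll gen_parabolics_lepoll lepoll_trans by metis
qed

text \<open>A nontrivial element \<open>h\<close> of the rigid stabilizer moves some
  \<open>u\<close> below \<open>v\<close>, and torsion makes the group it generates finite. Any
  \<open>w\<close> below \<open>u\<close> is moved too.\<close>

lemma ex_torsion_step:
  assumes tor: "torsion (subgroup_struct T G)" and v: "v \<in> V"
  shows "\<exists>h w. h \<in> rist T G v \<and> w \<in> descendants T v \<and> h w \<noteq> w \<and>
    stab_trivial_below (generate (aut_group T) {h}) w"
proof -
  obtain h u where h: "h \<in> rist T G v" "u \<in> V" "h u \<noteq> u" using rist_nontrivial[OF v] by blast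
  then have hG: "h \<in> G" using rist_subset by blast
  have ud: "u \<in> descendants T v" using rist_fixes_outside[OF h(1,2)] h(3) by blast
  have "ordG h \<noteq> 0" using tor hG by (simp add: torsion_def)
  then obtain w where w: "w \<in> descendants T u" "stab_trivial_below (generate (aut_group T) {h}) w"
    using ex_stab_trivial_below[OF subgroup_generate[OF hG] finite_generate[OF hG] h(2)] by blast
  have "h w \<noteq> w" using aut_fixes_ancestors[OF G_Aut[OF hG] h(2) w(1)] h(3) by blast
  then show ?thesis using h(1) w descendants_trans[OF w(1) ud] by blast
qed

end

text \<open>The elements \<open>h i\<close> move \<open>v (Suc i)\<close> inside the subtree below \<open>v i\<close>. Each set \<open>A\<close> of indices
  selects some of them, and \<open>A\<close> can be read off the level sizes of the resulting orbit closure.\<close>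

locale torsion_chain = branch T G for T :: "'v rooted_graph" and G +
  fixes v :: "nat \<Rightarrow> 'v" and h :: "nat \<Rightarrow> 'v \<Rightarrow> 'v" and \<xi> :: "nat \<Rightarrow> 'v"
  assumes v: "v i \<in> V" "v (Suc i) \<in> descendants T (v i)" "h i (v (Suc i)) \<noteq> v (Suc i)"
    and h: "h i \<in> rist T G (v i)"
    and st: "stab_trivial_below (generate (aut_group T) {h i}) (v (Suc i))"
    and \<xi>: "\<xi> \<in> bd" "\<xi> (lv (v i)) = v i"
begin

lemma h_G: "h i \<in> G"
  using h rist_subset by blast

lemma level_less: "lv (v i) < lv (v (Suc i))"
  using rist_fixes_level[OF h[of i] v(1)[of "Suc i"]] v(3)[of i] by (metis not_le)

lemma level_mono: "i \<le> j \<Longrightarrow> lv (v i) \<le> lv (v j)"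
  by (rule lift_Suc_mono_le[of "\<lambda>i. lv (v i)"]) (simp_all add: level_less less_imp_le)

lemma le_level: "i \<le> lv (v i)"
proof (induction i)
  case (Suc i)
  then show ?case using level_less[of i] by simp
qed simp

text \<open>The group generated by the \<open>h j\<close> with \<open>j < i\<close> and
  \<open>j \<in> A\<close>, built one index at a time so that the results on
  \<open>K \<union> L\<close> apply with \<open>L\<close> cyclic.\<close>

definition stage :: "nat set \<Rightarrow> nat \<Rightarrow> ('v \<Rightarrow> 'v) set" where
  "stage A = rec_nat {\<one>\<^bsub>aut_group T\<^esub>}
    (\<lambda>i K. if i \<in> A then generate (aut_group T) (K \<union> generate (aut_group T) {h i}) else K)"

lemma stage_0: "stage A 0 = {\<one>\<^bsub>aut_group T\<^esub>}"
  and stage_Suc: "stage A (Suc i) =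
    (if i \<in> A then generate (aut_group T) (stage A i \<union> generate (aut_group T) {h i}) else stage A i)"
  by (simp_all add: stage_def)

lemma generate_h_rist: "generate (aut_group T) {h i} \<subseteq> rist T G (v i)"
  by (rule aut.generate_subgroup_incl[OF _ subgroup_rist]) (simp add: h)

lemma subgroup_stage: "subgroup (stage A i) (aut_group T) \<and> stage A i \<subseteq> G"
proof (induction i)
  case 0
  show ?case using aut.triv_subgroup G_closed(3) by (simp add: stage_0)
next
  case (Suc i)
  have gen: "stage A i \<union> generate (aut_group T) {h i} \<subseteq> G"
    using Suc generate_h_rist rist_subset by blast
  then show ?case
    using Suc aut.generate_is_subgroup[of "stage A i \<union> generate (aut_group T) {h i}"]
      aut.generate_subgroup_incl[OF gen subgroup_G] G_subset_Aut
    by (auto simp: stage_Suc)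
qed

lemma stage_mono: "i \<le> j \<Longrightarrow> stage A i \<subseteq> stage A j"
  by (rule lift_Suc_mono_le[of "stage A"]) (auto simp: stage_Suc intro: generate.incl)

text \<open>A selected index passes triviality from \<open>v i\<close> to \<open>v (Suc i)\<close>
  through the wreath structure; at an unselected one the group is unchanged and only the vertex
  descends.\<close>

lemma stab_trivial_stage: "stab_trivial_below (stage A i) (v i)"
proof (induction i)
  case 0
  show ?case using descendants_in_V by (auto simp: stage_0 stab_trivial_below_def one_apply)
next
  case (Suc i)
  note sg = subgroup_stage[of A i]
  show ?case
  proof (cases "i \<in> A")
    case True
    then show ?thesis
      using stab_trivial_below_generate_Un[OF _ subgroup_generate[OF h_G] generate_h_rist
          v(1)[of i] Suc st[of i] v(2)[of i]] sg
      by (simp add: stage_Suc)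
  next
    case False
    have "stage A i \<subseteq> Aut" using sg G_subset_Aut by blast
    from stab_trivial_below_descendant[OF this Suc v(1)[of i] v(2)[of i]] show ?thesis
      using False by (simp add: stage_Suc)
  qed
qed

definition limit_group :: "nat set \<Rightarrow> ('v \<Rightarrow> 'v) set" where
  "limit_group A = (\<Union>i. stage A i)"

lemma limit_group_subset: "limit_group A \<subseteq> G"
  using subgroup_stage by (auto simp: limit_group_def)

lemma subgroup_limit_group: "subgroup (limit_group A) (aut_group T)"
proof (rule aut.subgroupI)
  show "limit_group A \<subseteq> Aut" using limit_group_subset G_subset_Aut by blast
  show "limit_group A \<noteq> {}" using stage_0 by (force simp: limit_group_def)
  show "inv\<^bsub>aut_group T\<^esub> k \<in> limit_group A" if k: "k \<in> limit_group A" for k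
  proof -
    obtain i where "k \<in> stage A i" using k by (auto simp: limit_group_def)
    then have "inv\<^bsub>aut_group T\<^esub> k \<in> stage A i"
      using subgroup.m_inv_closed[OF conjunct1[OF subgroup_stage]] by blast
    then show ?thesis by (auto simp: limit_group_def)
  qed
  fix k l assume "k \<in> limit_group A" "l \<in> limit_group A"
  then obtain i j where "k \<in> stage A i" "l \<in> stage A j" by (auto simp: limit_group_def)
  then have "k \<in> stage A (max i j)" "l \<in> stage A (max i j)"
    using stage_mono[of i "max i j" A] stage_mono[of j "max i j" A] by auto
  then have "k \<otimes>\<^bsub>aut_group T\<^esub> l \<in> stage A (max i j)"
    by (rule subgroup.m_closed[OF conjunct1[OF subgroup_stage]])
  then show "k \<otimes>\<^bsub>aut_group T\<^esub> l \<in> limit_group A" by (auto simp: limit_group_def)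
qed

lemma limit_group_Aut: "k \<in> limit_group A \<Longrightarrow> k \<in> Aut"
  by (rule subgroup_Aut[OF subgroup_limit_group])

text \<open>Generators \<open>h j\<close> with \<open>j \<ge> i\<close> fix every vertex up to the
  level of \<open>v i\<close>, since they lie in the rigid stabilizer of \<open>v j\<close>.\<close>

lemma limit_group_agree:
  assumes "k \<in> limit_group A"
  shows "\<exists>k'\<in>stage A i. \<forall>u\<in>V. lv u \<le> lv (v i) \<longrightarrow> k u = k' u"
proof -
  have *: "\<exists>k'\<in>stage A i. \<forall>u\<in>V. lv u \<le> lv (v i) \<longrightarrow> k u = k' u" if "i \<le> j" "k \<in> stage A j" for j k
    using that
  proof (induction j arbitrary: k rule: dec_induct)
    case base
    then show ?case by blast
  next
    case (step j)
    have "\<exists>k'\<in>stage A j. \<forall>u\<in>V. lv u \<le> lv (v j) \<longrightarrow> k u = k' u"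
    proof (cases "j \<in> A")
      case True
      then show ?thesis
        using generate_Un_agree[OF _ subgroup_generate[OF h_G] generate_h_rist v(1), of "stage A j" k j]
          subgroup_stage[of A j] step.prems by (auto simp: stage_Suc)
    qed (use step.prems in \<open>auto simp: stage_Suc\<close>)
    then obtain k' where k': "k' \<in> stage A j" "\<And>u. u \<in> V \<Longrightarrow> lv u \<le> lv (v j) \<Longrightarrow> k u = k' u" by blast
    obtain k'' where "k'' \<in> stage A i" "\<And>u. u \<in> V \<Longrightarrow> lv u \<le> lv (v i) \<Longrightarrow> k' u = k'' u"
      using step.IH[OF k'(1)] by blast
    moreover from this k'(2) have "k u = k'' u" if "u \<in> V" "lv u \<le> lv (v i)" for u
      using that level_mono[OF step.hyps(1)] by simp
    ultimately show ?case by blast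
  qed
  obtain j where j: "k \<in> stage A j" using assms by (auto simp: limit_group_def)
  then have "k \<in> stage A (max i j)" using stage_mono[of j "max i j" A] by auto
  then show ?thesis using *[of "max i j"] by simp
qed

text \<open>The quotient of \<open>k\<close> by \<open>k'\<close> fixes \<open>v i\<close>, and up
  to the level of \<open>v (Suc i)\<close> it agrees with an element of
  \<open>stage A (Suc i)\<close>, which is \<open>stage A i\<close>. Fixing \<open>v i\<close>, that
  element is trivial below \<open>v i\<close>.\<close>

lemma limit_group_unselected:
  assumes k: "k \<in> limit_group A" "k' \<in> limit_group A" and i: "i \<notin> A" and eq: "k (v i) = k' (v i)"
  shows "k (v (Suc i)) = k' (v (Suc i))"
proof -
  let ?q = "inv\<^bsub>aut_group T\<^esub> k' \<otimes>\<^bsub>aut_group T\<^esub> k"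
  have A: "k \<in> Aut" "k' \<in> Aut" "?q \<in> Aut" using k limit_group_Aut by auto
  have "?q \<in> limit_group A"
    using subgroup.m_closed[OF subgroup_limit_group] subgroup.m_inv_closed[OF subgroup_limit_group] k
    by blast
  then obtain q where q: "q \<in> stage A (Suc i)" "\<And>u. u \<in> V \<Longrightarrow> lv u \<le> lv (v (Suc i)) \<Longrightarrow> ?q u = q u"
    using limit_group_agree[of ?q A "Suc i"] by blast
  have "q (v i) = ?q (v i)" using q(2)[of "v i"] v(1) level_less[of i] by simp
  also have "\<dots> = v i" using A eq v(1) by (simp add: mult_apply inv_apply)
  finally have "q (v (Suc i)) = v (Suc i)"
    using stab_trivial_stage[of A i] q(1) i v(2) by (auto simp: stage_Suc stab_trivial_below_def)
  then have "?q (v (Suc i)) = v (Suc i)" using q(2)[of "v (Suc i)"] v(1) by simp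
  then have "k' (v (Suc i)) = k' (?q (v (Suc i)))" by simp
  also have "\<dots> = k (v (Suc i))"
    using A v(1)[of "Suc i"] by (simp add: mult_apply inv_apply aut_in_V)
  finally show ?thesis by simp
qed

definition limit_set :: "nat set \<Rightarrow> (nat \<Rightarrow> 'v) set" where
  "limit_set A = orbit_closure (limit_group A) \<xi>"

lemma limit_set_level: "(\<lambda>\<eta>. \<eta> (lv (v i))) ` limit_set A = (\<lambda>k. k (v i)) ` limit_group A"
  unfolding limit_set_def level_orbit_closure[OF subgroup_limit_group \<xi>(1)] \<xi>(2) ..

lemma h_in_limit_group: "i \<in> A \<Longrightarrow> h i \<in> limit_group A"
  unfolding limit_group_def
  by (intro UN_I[of "Suc i"]) (auto simp: stage_Suc intro: generate.incl)

text \<open>Taking ancestors maps the orbit of \<open>v (Suc i)\<close> onto that of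
  \<open>v i\<close>. For unselected \<open>i\<close>, elements agreeing at \<open>v i\<close> agree
  at \<open>v (Suc i)\<close>, so the orbits have equal size; for selected \<open>i\<close>, the
  vertices \<open>v (Suc i)\<close> and \<open>h i (v (Suc i))\<close> have the same ancestor, and
  finiteness of levels makes the sizes differ.\<close>

lemma in_iff_card_level:
  "i \<in> A \<longleftrightarrow> card ((\<lambda>\<eta>. \<eta> (lv (v i))) ` limit_set A) \<noteq> card ((\<lambda>\<eta>. \<eta> (lv (v (Suc i)))) ` limit_set A)"
proof (cases "i \<in> A")
  case False
  have "k (v i) = k' (v i) \<longleftrightarrow> k (v (Suc i)) = k' (v (Suc i))"
    if k: "k \<in> limit_group A" "k' \<in> limit_group A" for k k'
    using limit_group_unselected[OF k False] limit_group_Aut k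
      aut_agree_ancestors[OF _ _ v(1) v(2), of k k' i] by blast
  then have "card ((\<lambda>k. k (v i)) ` limit_group A) = card ((\<lambda>k. k (v (Suc i))) ` limit_group A)"
    by (rule card_image_cong_kernel)
  then show ?thesis using False by (simp add: limit_set_level)
next
  case True
  define p where "p u = rp u ! lv (v i)" for u
  let ?S = "\<lambda>i. (\<lambda>k. k (v i)) ` limit_group A"
  have pk: "p (k (v (Suc i))) = k (v i)" if "k \<in> limit_group A" for k
    using aut_root_path[OF limit_group_Aut[OF that] v(1), of "Suc i"] v(2)[of i]
      length_root_path[OF v(1)[of "Suc i"]]
      level_less[of i] by (simp add: p_def descendants_iff)
  then have img: "p ` ?S (Suc i) = ?S i" by (simp add: image_image)
  have "?S (Suc i) \<subseteq> level T (lv (v (Suc i)))"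
    using limit_group_Aut v(1) by (auto simp: level_def aut_in_V aut_level)
  then have fin: "finite (?S (Suc i))" using finite_level finite_subset by blast
  have one: "\<one>\<^bsub>aut_group T\<^esub> \<in> limit_group A" by (rule subgroup.one_closed[OF subgroup_limit_group])
  have "\<not> inj_on p (?S (Suc i))"
  proof
    assume inj: "inj_on p (?S (Suc i))"
    have "p (h i (v (Suc i))) = p (\<one>\<^bsub>aut_group T\<^esub> (v (Suc i)))"
      using pk[OF h_in_limit_group[OF True]] pk[OF one] rist_fixes_level[OF h[of i] v(1)[of i]] v(1)
      by (simp add: one_apply)
    then have "h i (v (Suc i)) = \<one>\<^bsub>aut_group T\<^esub> (v (Suc i))"
      using inj h_in_limit_group[OF True] one by (auto dest!: inj_onD)
    then show False using v(1,3) by (simp add: one_apply)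
  qed
  then have "card (?S i) \<noteq> card (?S (Suc i))" using eq_card_imp_inj_on[OF fin, of p] img by metis
  then show ?thesis using True by (simp add: limit_set_level)
qed

text \<open>For an unselected index \<open>i \<ge> lv u\<close>, a vertex of the orbit of
  \<open>v i\<close> has a single continuation to the level of \<open>v (Suc i)\<close>, while a
  cylinder contains rays through two different children.\<close>

lemma limit_set_not_contains_cyl:
  assumes A: "\<And>n. \<exists>i\<ge>n. i \<notin> A" shows "\<not> contains_cyl (limit_set A)"
proof
  assume "contains_cyl (limit_set A)"
  then obtain u where u: "u \<in> V" "cyl u \<subseteq> limit_set A" by (auto simp: contains_cyl_def)
  obtain i where i: "i \<ge> lv u" "i \<notin> A" using A by blast
  define n where "n = lv (v i)"
  define m where "m = lv (v (Suc i))"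
  have nm: "Suc n \<le> m" using level_less[of i] by (simp add: n_def m_def)
  obtain \<eta> where \<eta>: "\<eta> \<in> cyl u" using cyl_nonempty[OF u(1)] by blast
  then have \<eta>b: "\<eta> \<in> bd" by (simp add: cyl_def)
  let ?x = "\<eta> n"
  have xV: "?x \<in> V" using ray_in_V[OF \<eta>b] .
  have xu: "cyl ?x \<subseteq> cyl u"
    by (rule cyl_mono[OF cyl_descendant[OF \<eta>]]) (use i(1) le_level[of i] in \<open>simp add: n_def\<close>)
  obtain a b where ab: "a \<in> children T ?x" "b \<in> children T ?x" "a \<noteq> b" using two_children[OF xV] .
  have step: "\<exists>k\<in>limit_group A. \<exists>\<zeta>\<in>bd. \<zeta> (Suc n) = c \<and> \<zeta> m = k (v (Suc i)) \<and> k (v i) = ?x"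
    if c: "c \<in> children T ?x" for c
  proof -
    obtain \<zeta> where \<zeta>: "\<zeta> \<in> cyl c" using cyl_nonempty[OF children_in_V[OF c]] by blast
    then have \<zeta>x: "\<zeta> \<in> cyl ?x" using cyl_mono[OF children_descendants[OF c xV]] by blast
    then have \<zeta>b: "\<zeta> \<in> bd" "\<zeta> n = ?x" by (auto simp: cyl_ray[OF \<eta>b])
    have \<zeta>c: "\<zeta> (Suc n) = c" using \<zeta> level_children[OF c] ray_level[OF \<eta>b] by (simp add: cyl_def)
    have "\<zeta> \<in> orbit_closure (limit_group A) \<xi>" using \<zeta>x xu u(2) by (auto simp: limit_set_def)
    then obtain k where k: "k \<in> limit_group A" "k (\<xi> m) = \<zeta> m" by (blast dest: orbit_closureD)
    have "ray_image k \<xi> n = \<zeta> n"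
      by (rule ray_agree[OF ray_image_in_boundary[OF limit_group_Aut[OF k(1)] \<xi>(1)] \<zeta>b(1), of m])
        (use k(2) nm in \<open>simp_all add: ray_image_apply\<close>)
    then have "k (v i) = ?x" using \<zeta>b(2) \<xi>(2)[of i] by (simp add: ray_image_apply n_def)
    moreover have "\<zeta> m = k (v (Suc i))" using k(2) \<xi>(2)[of "Suc i"] by (simp add: m_def)
    ultimately show ?thesis using k(1) \<zeta>b(1) \<zeta>c by blast
  qed
  obtain k \<zeta> where 1: "k \<in> limit_group A" "\<zeta> \<in> bd" "\<zeta> (Suc n) = a" "\<zeta> m = k (v (Suc i))" "k (v i) = ?x"
    using step[OF ab(1)] by blast
  obtain k' \<zeta>' where 2: "k' \<in> limit_group A" "\<zeta>' \<in> bd" "\<zeta>' (Suc n) = b"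
    "\<zeta>' m = k' (v (Suc i))" "k' (v i) = ?x"
    using step[OF ab(2)] by blast
  have "k (v (Suc i)) = k' (v (Suc i))" by (rule limit_group_unselected[OF 1(1) 2(1) i(2)]) (simp add: 1 2)
  then have "\<zeta> m = \<zeta>' m" by (simp add: 1 2)
  then have "\<zeta> (Suc n) = \<zeta>' (Suc n)" by (rule ray_agree[OF 1(2) 2(2) _ nm])
  then show False using 1(3) 2(3) ab(3) by simp
qed

lemma gen_parabolic_limit_set:
  "(\<And>n. \<exists>i\<ge>n. i \<notin> A) \<Longrightarrow> gen_parabolic_set T G (limit_set A)"
  using gen_parabolic_orbit_closure[OF subgroup_limit_group limit_group_subset \<xi>(1)]
    limit_set_not_contains_cyl by (simp add: limit_set_def)

text \<open>Level sizes are invariant under automorphisms and determine the set of indices by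
  \<open>in_iff_card_level\<close>.\<close>

lemma tree_class_limit_set_inj:
  assumes A: "\<And>n. \<exists>i\<ge>n. i \<notin> A" and B: "\<And>n. \<exists>i\<ge>n. i \<notin> B"
    and eq: "tree_class (limit_set A) = tree_class (limit_set B)"
  shows "A = B"
proof -
  note gA = gen_parabolic_limit_set[OF A] and gB = gen_parabolic_limit_set[OF B]
  have "sstab G (limit_set B) \<in> tree_class (limit_set A)" using sstab_in_own_tree_class[OF gB] eq by simp
  then obtain \<phi> where \<phi>: "\<phi> \<in> Aut" "ray_image \<phi> ` limit_set A = limit_set B"
    using sstab_in_tree_class_iff[OF gA gB] by blast
  have "limit_set A \<subseteq> bd" by (simp add: limit_set_def orbit_closure_subset)
  then have "card ((\<lambda>\<eta>. \<eta> n) ` limit_set B) = card ((\<lambda>\<eta>. \<eta> n) ` limit_set A)" for n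
    using card_level_image[OF \<phi>(1)] \<phi>(2) by metis
  then have "i \<in> A \<longleftrightarrow> i \<in> B" for i
    using in_iff_card_level[of i A] in_iff_card_level[of i B] by simp
  then show ?thesis by (simp add: set_eq_iff)
qed

end

section \<open>Continuum many classes for torsion groups\<close>

context branch
begin

lemma ex_torsion_chain:
  assumes tor: "torsion (subgroup_struct T G)"
  shows "\<exists>v h \<xi>. torsion_chain T G v h \<xi>"
proof -
  obtain hh ww where step: "\<And>u. u \<in> V \<Longrightarrow> hh u \<in> rist T G u \<and> ww u \<in> descendants T u \<and> hh u (ww u) \<noteq> ww u \<and>
    stab_trivial_below (generate (aut_group T) {hh u}) (ww u)"
    using ex_torsion_step[OF tor] by metis
  define v where "v = rec_nat rt (\<lambda>_ u. ww u)"
  have v: "v 0 = rt" "v (Suc i) = ww (v i)" for i by (simp_all add: v_def)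
  have vV: "v i \<in> V" for i
    by (induction i) (use step descendants_in_V in \<open>auto simp: v root_in_V\<close>)
  \<comment> \<open>\<open>hh (v i)\<close> fixes all vertices up to the level of \<open>v i\<close>
    but moves \<open>v (Suc i)\<close>.\<close>
  have "lv (v i) < lv (v (Suc i))" for i
    using step[OF vV[of i]] rist_fixes_level[of "hh (v i)" "v i" "v (Suc i)"] vV[of "Suc i"]
    by (metis v(2) not_less)
  then obtain \<xi> where "\<xi> \<in> bd" "\<And>i. \<xi> (lv (v i)) = v i"
    using ex_ray_through_chain[of v] vV step by (metis v(2))
  then have "torsion_chain T G v (\<lambda>i. hh (v i)) \<xi>"
    by unfold_locales (use step vV in \<open>auto simp: v(2)\<close>)
  then show ?thesis by blast
qed

lemma continuum_infinite_classes:
  assumes tor: "torsion (subgroup_struct T G)"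
  shows "continuum {c \<in> tree_classes T G. infinite c}" (is "continuum ?S")
proof -
  obtain v h \<xi> where "torsion_chain T G v h \<xi>" using ex_torsion_chain[OF tor] by blast
  then interpret torsion_chain T G v h \<xi> .
  \<comment> \<open>Doubling is injective and leaves all odd indices unselected, as
    \<open>limit_set_not_contains_cyl\<close> requires.\<close>
  define dbl :: "nat set \<Rightarrow> nat set" where "dbl A = (*) 2 ` A" for A
  have dbl: "\<exists>i\<ge>n. i \<notin> dbl A" for A n
  proof -
    have "2 * n + 1 \<noteq> 2 * x" for x :: nat by presburger
    then have "2 * n + 1 \<notin> dbl A" unfolding dbl_def by blast
    then show ?thesis by (intro exI[of _ "2 * n + 1"]) simp
  qed
  have inj: "A = B" if "dbl A = dbl B" for A B
  proof -
    have "inj ((*) (2 :: nat))" by (rule injI) simp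
    then show ?thesis using that unfolding dbl_def by (simp add: inj_image_eq_iff)
  qed
  have "(UNIV :: nat set set) \<lesssim> ?S"
    unfolding lepoll_def
  proof (intro exI conjI)
    show "inj (\<lambda>A. tree_class (limit_set (dbl A)))"
      by (rule injI) (rule inj, rule tree_class_limit_set_inj[OF dbl dbl])
    show "range (\<lambda>A. tree_class (limit_set (dbl A))) \<subseteq> ?S"
      using tree_class_in_tree_classes infinite_tree_class gen_parabolic_limit_set[OF dbl] by auto
  qed
  moreover have "?S \<lesssim> (UNIV :: nat set set)"
    by (rule lepoll_trans[OF subset_imp_lepoll tree_classes_lepoll]) blast
  ultimately show ?thesis unfolding continuum_def by (intro lepoll_antisym)
qed

end

theorem corollary1p8:
  fixes T :: "'v rooted_graph" and G :: "('v \<Rightarrow> 'v) set"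
  assumes "spherically_regular_tree T" and "branch_group T G"
  shows "(\<not> torsion_free (subgroup_struct T G) \<longrightarrow>
            continuum (gen_parabolics T G - parabolics T G)) \<and>
         (unbounded_finite_orders (subgroup_struct T G) \<longrightarrow>
            infinite {c \<in> tree_classes T G. continuum c}) \<and>
         (torsion (subgroup_struct T G) \<longrightarrow>
            continuum {c \<in> tree_classes T G. infinite c})"
proof -
  interpret branch T G
    by unfold_locales (use assms in \<open>auto simp: spherically_regular_tree_def\<close>)
  show ?thesis
    using continuum_nonparabolic infinite_continuum_classes continuum_infinite_classes by blast
qed

end
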